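(* Let $\dot A$ be the non-negative symmetric Schrödinger operator in $L_2[a,+\infty)$ with deficiency indices $(1,1)$ and $m_\infty(-0)<\infty$ described in the context, and let $T_h$ ($\operatorname{Im} h>0$) be a $\theta$-sectorial Schrödinger operator. Put $$\mu_0=\frac{(\operatorname{Im} h)^2}{m_\infty(-0)+\operatorname{Re} h}+\operatorname{Re} h .$$ Let $\mu_*\in(\mu_0,+\infty)$ be fixed, and let $\Theta$ be the accretive L-system whose state-space operator $\mathbb A=\mathbb A_{\mu_*}$ is the $( * )$-extension of $T_h$ with parameter $\mu=\mu_*$. Suppose that the impedance function $V_\Theta(z)$ belongs to the class $S^{\alpha_1,\alpha_2}$. Then for every $\mu\in[\mu_*,+\infty)$ the $( * )$-extension $\mathbb A_\mu$ of $T_h$ is $\beta$-sectorial, where $\beta$ is given by $$\tan\beta=\tan\alpha_2+2\sqrt{\tan\alpha_1\,\tan\alpha_2}.$$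
   Context: **Schrödinger operators.** Let $\mathcal H=L_2[a,+\infty)$ and $l(y)=-y''+q(x)y$ with $q$ real and locally summable. Let $\dot A y=l(y)$ with boundary conditions $y(a)=y'(a)=0$ be the (closed, densely defined) minimal symmetric operator; it is assumed to have deficiency indices $(1,1)$ and to be non-negative. Then $\mathcal H_+=\operatorname{Dom}(\dot A^* )$ is the set of $y\in L_2[a,+\infty)$ such that $y,y'$ are locally absolutely continuous and $l(y)\in L_2[a,+\infty)$, with inner product $(y,z)_+=\int_a^\infty (y\bar z+l(y)\overline{l(z)})\,dx$. $\mathcal H_+\subset\mathcal H\subset\mathcal H_-$ is the corresponding rigged Hilbert space ($\mathcal H_-$ is the dual of $\mathcal H_+$ with respect to the pairing extending the inner product $(\cdot,\cdot)$ of $\mathcal H$). $[\mathcal H_+,\mathcal H_-]$ is the set of bounded linear operators from $\mathcal H_+$ to $\mathcal H_-$; the adjoint of $\mathbb A\in[\mathcal H_+,\mathcal H_-]$ is again in $[\mathcal H_+,\mathcal H_-]$. The functionals $\delta(x-a),\delta'(x-a)\in\mathcal H_-$ act by $(y,\delta(x-a))=y(a)$, $(y,\delta'(x-a))=-y'(a)$. For $h\in\mathbb C$ with $\operatorname{Im}h>0$, $T_h y=l(y)$ with domain $\{y\in\mathcal H_+: y'(a)=hy(a)\}$. **The function $m_\infty$.** Let $\varphi_1,\varphi_2$ solve $l(\varphi_k)=\lambda\varphi_k$ with $\varphi_1(a,\lambda)=0,\ \varphi_1'(a,\lambda)=1$, $\varphi_2(a,\lambda)=-1,\ \varphi_2'(a,\lambda)=0$.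 $m_\infty(\lambda)$ is the function for which $\varphi_2(x,\lambda)+m_\infty(\lambda)\varphi_1(x,\lambda)\in L_2[a,+\infty)$, and $m_\infty(-0)=\lim_{x\to-0}m_\infty(x)$. It is assumed that $m_\infty(-0)<\infty$. **$( * )$-extensions.** The $( * )$-extensions of $T_h$ are in one-to-one correspondence with the parameters $\mu\in[-\infty,+\infty]$ (with $\pm\infty$ identified); they are the operators $\mathbb A=\mathbb A_\mu\in[\mathcal H_+,\mathcal H_-]$, $$\mathbb A_\mu y=-y''+q(x)y-\frac{1}{\mu-h}\,[y'(a)-hy(a)]\,[\mu\,\delta(x-a)+\delta'(x-a)],$$ with $\mathbb A_{\infty}y=-y''+q(x)y+[hy(a)-y'(a)]\,\delta(x-a)$. $\operatorname{Re}\mathbb A=(\mathbb A+\mathbb A^* )/2$, $\operatorname{Im}\mathbb A=(\mathbb A-\mathbb A^* )/(2i)$. **L-system.** For such $\mathbb A=\mathbb A_\mu$ one has $\operatorname{Im}\mathbb A=KK^*$ with $K:\mathbb C\to\mathcal H_-$, $Kc=cg$, $g=\frac{(\operatorname{Im}h)^{1/2}}{|\mu-h|}[\mu\delta(x-a)+\delta'(x-a)]$. The L-system $\Theta$ is the array consisting of $\mathbb A$ (state-space operator), $K$ (channel operator) and the triplet $\mathcal H_+\subset\mathcal H\subset\mathcal H_-$ with input-output space $\mathbb C$; $T_h$ is its main operator. $\Theta$ is called accretive if $\operatorname{Re}(\mathbb Af,f)\ge0$ for all $f\in\mathcal H_+$. Its impedance function is $V_\Theta(z)=K^*(\operatorname{Re}\mathbb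 A-zI)^{-1}K$, which equals $$V_\Theta(z)=\frac{(m_\infty(z)+\mu)\operatorname{Im}h}{(\mu-\operatorname{Re}h)\,m_\infty(z)+\mu\operatorname{Re}h-|h|^2}.$$ **Sectoriality.** For $\alpha\in(0,\pi/2)$, an operator $T$ in $\mathcal H$ is $\alpha$-sectorial if $(\cot\alpha)|\operatorname{Im}(Tf,f)|\le\operatorname{Re}(Tf,f)$ for all $f\in\operatorname{Dom}(T)$; an operator $\mathbb A\in[\mathcal H_+,\mathcal H_-]$ is $\alpha$-sectorial if the same inequality holds for $(\mathbb Af,f)$, $f\in\mathcal H_+$. (For $\operatorname{Im}h>0$, $T_h$ is $\theta$-sectorial for some $\theta\in(0,\pi/2)$ if and only if $\operatorname{Re}h>-m_\infty(-0)$.) **Class $S^{\alpha_1,\alpha_2}$.** A scalar Stieltjes function is a function $V$ holomorphic in $\mathbb C\setminus[0,+\infty)$ with $\overline{V(z)}=V(\bar z)$, $\operatorname{Im}V(z)\ge0$ for $\operatorname{Im}z>0$, and $\operatorname{Im}[zV(z)]/\operatorname{Im}z\ge0$ for $\operatorname{Im} z\neq 0$. For $0\le\alpha_1\le\alpha_2\le\pi/2$, a Stieltjes function $V$ belongs to $S^{\alpha_1,\alpha_2}$ if $\tan\alpha_1=\lim_{x\to-\infty}V(x)$ and $\tan\alpha_2=\lim_{x\to-0}V(x)$ (with $\tan\frac{\pi}{2}=+\infty$). *)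

theory Defs
  imports "HOL-Analysis.Analysis"
begin

section \<open>The space L2 of the half-line\<close>

text \<open>
  Elements are represented by functions on the whole real line of which only the values on
  \<open>{a..}\<close> matter; equality in L2 is equality almost everywhere on \<open>{a..}\<close>.
\<close>

definition L2 :: "real \<Rightarrow> (real \<Rightarrow> complex) set" where
  "L2 a = {f. f \<in> borel_measurable (lebesgue_on {a..}) \<and>
              integrable (lebesgue_on {a..}) (\<lambda>x. (cmod (f x))\<^sup>2)}"

definition ip :: "real \<Rightarrow> (real \<Rightarrow> complex) \<Rightarrow> (real \<Rightarrow> complex) \<Rightarrow> complex" where
  "ip a f g = integral\<^sup>L (lebesgue_on {a..}) (\<lambda>x. f x * cnj (g x))"

definition locally_summable :: "real \<Rightarrow> (real \<Rightarrow> real) \<Rightarrow> bool" where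
  "locally_summable a q \<longleftrightarrow> (\<forall>b>a. q absolutely_integrable_on {a..b})"

section \<open>The differential expression and its maximal domain\<close>

definition abs_cont_on :: "real \<Rightarrow> real \<Rightarrow> (real \<Rightarrow> complex) \<Rightarrow> bool" where
  "abs_cont_on a b f \<longleftrightarrow>
     (\<forall>\<epsilon>>0. \<exists>\<delta>>0. \<forall>(n::nat) u v.
        (\<forall>i<n. a \<le> u i \<and> u i \<le> v i \<and> v i \<le> b) \<and>
        disjoint_family_on (\<lambda>i. {u i<..<v i}) {..<n} \<and>
        (\<Sum>i<n. v i - u i) < \<delta>
        \<longrightarrow> (\<Sum>i<n. cmod (f (v i) - f (u i))) < \<epsilon>)"

definition loc_abs_cont :: "real \<Rightarrow> (real \<Rightarrow> complex) \<Rightarrow> bool" where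
  "loc_abs_cont a f \<longleftrightarrow> (\<forall>b>a. abs_cont_on a b f)"

text \<open>The derivative on \<open>{a..}\<close>; it is one-sided at \<open>a\<close>.\<close>

definition D :: "real \<Rightarrow> (real \<Rightarrow> complex) \<Rightarrow> real \<Rightarrow> complex" where
  "D a y x = vector_derivative y (at x within {a..})"

text \<open>
  When the first derivative of \<open>y\<close> is locally absolutely continuous, the second derivative exists
  almost everywhere, and \<open>D a (D a y)\<close> is unspecified only on a null set.
\<close>

definition l :: "real \<Rightarrow> (real \<Rightarrow> real) \<Rightarrow> (real \<Rightarrow> complex) \<Rightarrow> real \<Rightarrow> complex" where
  "l a q y x = - D a (D a y) x + complex_of_real (q x) * y x"

definition regular :: "real \<Rightarrow> (real \<Rightarrow> complex) set" where
  "regular a = {y. (\<forall>x\<ge>a. y differentiable (at x within {a..})) \<and>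
                   loc_abs_cont a y \<and> loc_abs_cont a (D a y)}"

definition Hplus :: "real \<Rightarrow> (real \<Rightarrow> real) \<Rightarrow> (real \<Rightarrow> complex) set" where
  "Hplus a q = {y. y \<in> L2 a \<and> y \<in> regular a \<and> l a q y \<in> L2 a}"

definition solves :: "real \<Rightarrow> (real \<Rightarrow> real) \<Rightarrow> complex \<Rightarrow> (real \<Rightarrow> complex) \<Rightarrow> bool" where
  "solves a q z y \<longleftrightarrow> y \<in> regular a \<and> (AE x in lebesgue_on {a..}. l a q y x = z * y x)"

section \<open>Operators in L2, given by a domain and an action\<close>

definition symmetric_op ::
  "real \<Rightarrow> (real \<Rightarrow> complex) set \<Rightarrow> ((real \<Rightarrow> complex) \<Rightarrow> real \<Rightarrow> complex) \<Rightarrow> bool" where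
  "symmetric_op a Dom T \<longleftrightarrow> (\<forall>f\<in>Dom. \<forall>g\<in>Dom. ip a (T f) g = ip a f (T g))"

definition nonneg_op ::
  "real \<Rightarrow> (real \<Rightarrow> complex) set \<Rightarrow> ((real \<Rightarrow> complex) \<Rightarrow> real \<Rightarrow> complex) \<Rightarrow> bool" where
  "nonneg_op a Dom T \<longleftrightarrow> symmetric_op a Dom T \<and> (\<forall>f\<in>Dom. 0 \<le> Re (ip a (T f) f))"

text \<open>The kernel of the adjoint of \<open>T\<close> minus \<open>z\<close>.\<close>

definition deficiency_space ::
  "real \<Rightarrow> (real \<Rightarrow> complex) set \<Rightarrow> ((real \<Rightarrow> complex) \<Rightarrow> real \<Rightarrow> complex) \<Rightarrow> complex
     \<Rightarrow> (real \<Rightarrow> complex) set" where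
  "deficiency_space a Dom T z =
     {g \<in> L2 a. \<forall>f\<in>Dom. ip a (T f) g = ip a f (\<lambda>x. z * g x)}"

definition one_dimensional :: "real \<Rightarrow> (real \<Rightarrow> complex) set \<Rightarrow> bool" where
  "one_dimensional a N \<longleftrightarrow>
     (\<exists>g\<in>N. \<not> (AE x in lebesgue_on {a..}. g x = 0) \<and>
            (\<forall>f\<in>N. \<exists>c. AE x in lebesgue_on {a..}. f x = c * g x))"

definition deficiency_indices_1_1 ::
  "real \<Rightarrow> (real \<Rightarrow> complex) set \<Rightarrow> ((real \<Rightarrow> complex) \<Rightarrow> real \<Rightarrow> complex) \<Rightarrow> bool" where
  "deficiency_indices_1_1 a Dom T \<longleftrightarrow>
     one_dimensional a (deficiency_space a Dom T \<i>) \<and>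
     one_dimensional a (deficiency_space a Dom T (- \<i>))"

definition sectorial_op ::
  "real \<Rightarrow> (real \<Rightarrow> complex) set \<Rightarrow> ((real \<Rightarrow> complex) \<Rightarrow> real \<Rightarrow> complex) \<Rightarrow> real \<Rightarrow> bool" where
  "sectorial_op a Dom T \<alpha> \<longleftrightarrow>
     0 < \<alpha> \<and> \<alpha> < pi / 2 \<and>
     (\<forall>f\<in>Dom. cot \<alpha> * \<bar>Im (ip a (T f) f)\<bar> \<le> Re (ip a (T f) f))"

text \<open>The minimal operator and \<open>T\<^sub>h\<close> both act as \<open>l\<close>.\<close>

definition Dom_min :: "real \<Rightarrow> (real \<Rightarrow> real) \<Rightarrow> (real \<Rightarrow> complex) set" where
  "Dom_min a q = {y \<in> Hplus a q. y a = 0 \<and> D a y a = 0}"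

definition Dom_T :: "real \<Rightarrow> (real \<Rightarrow> real) \<Rightarrow> complex \<Rightarrow> (real \<Rightarrow> complex) set" where
  "Dom_T a q h = {y \<in> Hplus a q. D a y a = h * y a}"

section \<open>Operators from the space with positive norm to the one with negative norm\<close>

text \<open>
  An element \<open>F\<close> of the dual space is represented by the conjugate-linear functional
  \<open>f \<mapsto> (F, f)\<close>, of which only the values on \<open>Hplus a q\<close> matter. An operator \<open>A\<close> is thus a
  function of two arguments with \<open>A y f = (A y, f)\<close>.
  Since \<open>(F, f)\<close> is the conjugate of \<open>(f, F)\<close>, the relations \<open>(y, \<delta>) = y(a)\<close> and
  \<open>(y, \<delta>') = - y'(a)\<close> read as follows.
\<close>

type_synonym functional = "(real \<Rightarrow> complex) \<Rightarrow> complex"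
type_synonym pm_op = "(real \<Rightarrow> complex) \<Rightarrow> functional"

definition delta :: "real \<Rightarrow> functional" where
  "delta a f = cnj (f a)"

definition delta' :: "real \<Rightarrow> functional" where
  "delta' a f = cnj (- D a f a)"

definition star_ext :: "real \<Rightarrow> (real \<Rightarrow> real) \<Rightarrow> complex \<Rightarrow> real \<Rightarrow> pm_op" where
  "star_ext a q h \<mu> y f =
     ip a (l a q y) f
     - 1 / (complex_of_real \<mu> - h) * (D a y a - h * y a)
         * (complex_of_real \<mu> * delta a f + delta' a f)"

definition adj_op :: "pm_op \<Rightarrow> pm_op" where
  "adj_op A y f = cnj (A f y)"

definition Re_op :: "pm_op \<Rightarrow> pm_op" where
  "Re_op A y f = (A y f + adj_op A y f) / 2"

definition sectorial_pm :: "real \<Rightarrow> (real \<Rightarrow> real) \<Rightarrow> pm_op \<Rightarrow> real \<Rightarrow> bool" where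
  "sectorial_pm a q A \<alpha> \<longleftrightarrow>
     0 < \<alpha> \<and> \<alpha> < pi / 2 \<and>
     (\<forall>f\<in>Hplus a q. cot \<alpha> * \<bar>Im (A f f)\<bar> \<le> Re (A f f))"

section \<open>L-systems with scalar input and output\<close>

datatype L_system = L_system (state_op: pm_op) (channel_op: "complex \<Rightarrow> functional")

definition schrodinger_system ::
  "real \<Rightarrow> (real \<Rightarrow> real) \<Rightarrow> complex \<Rightarrow> real \<Rightarrow> L_system" where
  "schrodinger_system a q h \<mu> =
     L_system (star_ext a q h \<mu>)
       (\<lambda>c f. c * (complex_of_real (sqrt (Im h) / cmod (complex_of_real \<mu> - h))
                    * (complex_of_real \<mu> * delta a f + delta' a f)))"

definition accretive :: "real \<Rightarrow> (real \<Rightarrow> real) \<Rightarrow> L_system \<Rightarrow> bool" where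
  "accretive a q \<Theta> \<longleftrightarrow> (\<forall>f\<in>Hplus a q. 0 \<le> Re (state_op \<Theta> f f))"

text \<open>The adjoint of the channel operator \<open>K\<close>, from \<open>(K c, f) = c * cnj (K\<^sup>* f)\<close>.\<close>

definition channel_adj :: "L_system \<Rightarrow> (real \<Rightarrow> complex) \<Rightarrow> complex" where
  "channel_adj \<Theta> f = cnj (channel_op \<Theta> 1 f)"

text \<open>
  The value of \<open>K\<^sup>* (Re A - z)\<^sup>-\<^sup>1 K\<close> at \<open>1\<close>: here \<open>y\<close> is the solution in \<open>Hplus a q\<close> of
  \<open>(Re A - z) y = K 1\<close>. The description is over the value, since \<open>y\<close> itself is
  determined on \<open>{a..}\<close> only.
\<close>

definition impedance :: "real \<Rightarrow> (real \<Rightarrow> real) \<Rightarrow> L_system \<Rightarrow> complex \<Rightarrow> complex" where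
  "impedance a q \<Theta> z =
     (THE v. \<exists>y\<in>Hplus a q.
        (\<forall>f\<in>Hplus a q. Re_op (state_op \<Theta>) y f - z * ip a y f = channel_op \<Theta> 1 f) \<and>
        v = channel_adj \<Theta> y)"

section \<open>Stieltjes functions\<close>

definition stieltjes :: "(complex \<Rightarrow> complex) \<Rightarrow> bool" where
  "stieltjes V \<longleftrightarrow>
     V holomorphic_on (- \<real>\<^sub>\<ge>\<^sub>0) \<and>
     (\<forall>z \<in> - \<real>\<^sub>\<ge>\<^sub>0. cnj (V z) = V (cnj z)) \<and>
     (\<forall>z. Im z > 0 \<longrightarrow> 0 \<le> Im (V z)) \<and>
     (\<forall>z. Im z \<noteq> 0 \<longrightarrow> 0 \<le> Im (z * V z) / Im z)"

definition tan_ext :: "real \<Rightarrow> ereal" where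
  "tan_ext \<alpha> = (if \<alpha> = pi / 2 then \<infinity> else ereal (tan \<alpha>))"

text \<open>A Stieltjes function is real on the negative half-line.\<close>

definition S_class :: "real \<Rightarrow> real \<Rightarrow> (complex \<Rightarrow> complex) \<Rightarrow> bool" where
  "S_class \<alpha>1 \<alpha>2 V \<longleftrightarrow>
     0 \<le> \<alpha>1 \<and> \<alpha>1 \<le> \<alpha>2 \<and> \<alpha>2 \<le> pi / 2 \<and> stieltjes V \<and>
     ((\<lambda>x. ereal (Re (V (complex_of_real x)))) \<longlongrightarrow> tan_ext \<alpha>1) at_bot \<and>
     ((\<lambda>x. ereal (Re (V (complex_of_real x)))) \<longlongrightarrow> tan_ext \<alpha>2) (at_left 0)"

end

(*
Write u = f(a), v = f'(a), w = mu u - v and s = mu - Re h. Green's formula turns the (star)-extension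
into the Hermitian form Q(f) = (l(f), f) - v conj(u), the regularised "int |f'|^2 + q |f|^2", plus a
quadratic form in the boundary data:
  Re (A f, f) = Q(f) + mu |u|^2 - 2 Re (w conj(u)) + s |w|^2 / |mu - h|^2,
  Im (A f, f) = Im h |w|^2 / |mu - h|^2.
A boundary layer (a function with value 0 and derivative 1 at a and negligible energy) shows that Q
only sees f(a); non-negativity of the minimal operator then gives Q(f) >= 0 when f(a) = 0, and
subtracting a multiple of the Weyl solution phi_2 + m phi_1 at x < 0 and letting x -> -0 gives
Q(f) >= m_infty(-0) |f(a)|^2. Minimising over u yields |Im (A f, f)| <= T(mu) Re (A f, f) with
T(mu) = Im h (m_infty(-0) + mu) / ((m_infty(-0) + Re h) s - (Im h)^2), decreasing in mu.
The impedance is computed from its definition at x < 0, again with the Weyl solution, and its limit at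
-0 is T(mu_star), so tan alpha_2 = T(mu_star) <= tan beta.

Elements of the maximal domain have an absolutely continuous derivative only, so Green's formula needs
the fundamental theorem of calculus for such functions, and with it their differentiability almost
everywhere, which is obtained here from the Vitali covering theorem.
*)

theory Submission
  imports Defs
begin


section \<open>Absolutely continuous functions\<close>

text \<open>Membership in \<open>Hplus\<close> imposes no decay, so a boundary term at infinity in
  Green's formula has to be excluded. This comes from the symmetry of the minimal operator:
  subtracting compactly supported elements with the same values of f(a) and f'(a) moves both
  arguments into \<open>Dom_min\<close>. As q is merely locally summable, these elements are built
  from solutions at spectral parameter 0 times a C^1 cutoff. The variable w is natural because the
  channel vector pairs with f to a multiple of cnj w. The imaginary part of the form sees w alone,
  and u is left free for the minimisation. That f'(a) costs nothing in Q is used twice: to move f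
  with f(a) = 0 into \<open>Dom_min\<close>, and to move the Weyl solution into
  \<open>Dom_T\<close>. There sectoriality of T_h gives m_infty(x) + Re h >= cot \<theta> Im h for
  every x < 0. The bound is uniform in x, so m_infty(-0) + Re h is strictly positive, and \<mu>s >
  \<mu>0 then says exactly that the denominator of T(\<mu>s) is positive.\<close>

hide_const (open) Polynomial.content

text \<open>Absolute continuity in terms of divisions, the form in which it meets gauge integration.\<close>

definition AC :: "real \<Rightarrow> real \<Rightarrow> (real \<Rightarrow> 'a::real_normed_vector) \<Rightarrow> bool" where
  "AC a b f \<longleftrightarrow> (\<forall>e>0. \<exists>d>0. \<forall>p. p division_of \<Union>p \<and> \<Union>p \<subseteq> {a..b} \<and> sum content p < d
      \<longrightarrow> (\<Sum>K\<in>p. norm (f (Sup K) - f (Inf K))) < e)"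

section \<open>Interval divisions, Vitali covers and differentiability almost everywhere\<close>

lemma division_increment_sum:
  fixes f :: "real \<Rightarrow> 'a::real_normed_vector"
  assumes "p division_of {u..v}" "u \<le> v"
  shows "(\<Sum>K\<in>p. f (Sup K) - f (Inf K)) = f v - f u"
proof -
  have fp: "finite p" using assms(1) by auto
  have ne: "\<And>K. K \<in> p \<Longrightarrow> K \<noteq> {} \<and> (\<exists>s t. K = cbox s t)"
    using assms(1) division_ofD(3,4) by blast
  have inK: "Inf K \<in> K" if "K \<in> p" for K
    using ne[OF that] by (auto simp: box_real)
  \<comment> \<open>Any tag serves for telescoping; the left end is one that lies in its
    interval.\<close>
  have "(\<lambda>K. (Inf K, K)) ` p tagged_division_of {u..v}"
    unfolding tagged_division_of
  proof (intro conjI allI impI)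
    show "finite ((\<lambda>K. (Inf K, K)) ` p)" using fp by simp
    have "{K. \<exists>x. (x, K) \<in> (\<lambda>K. (Inf K, K)) ` p} = p" by auto
    then show "\<Union> {K. \<exists>x. (x, K) \<in> (\<lambda>K. (Inf K, K)) ` p} = {u..v}"
      using division_ofD(6)[OF assms(1)] by simp
  next
    fix x K assume "(x, K) \<in> (\<lambda>K. (Inf K, K)) ` p"
    then show "x \<in> K" "K \<subseteq> {u..v}" "\<exists>a b. K = cbox a b"
      using inK ne division_ofD(2)[OF assms(1)] by auto
  next
    fix x1 K1 x2 K2
    assume "(x1, K1) \<in> (\<lambda>K. (Inf K, K)) ` p \<and> (x2, K2) \<in> (\<lambda>K. (Inf K, K)) ` p \<and> (x1, K1) \<noteq> (x2, K2)"
    then show "interior K1 \<inter> interior K2 = {}"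
      using division_ofD(5)[OF assms(1)] by auto
  qed
  from additive_tagged_division_1[OF assms(2) this, of f]
  show ?thesis
    by (subst (asm) sum.reindex) (auto simp: inj_on_def)
qed

text \<open>\<open>r\<close> fills the gaps that \<open>\<D>\<close> leaves in \<open>K\<close>. The
  identity for all \<open>f\<close> yields lengths when \<open>f\<close> is the identity and
  increments when \<open>f\<close> is the function under study. Degenerate gaps contribute nothing
  and are dropped, because a common endpoint of two neighbouring intervals \<open>K\<close> could
  otherwise appear as a gap in both.\<close>

lemma division_inside:
  fixes K :: "real set"
  assumes "\<D> division_of \<Union>\<D>" "\<Union>\<D> \<subseteq> K" "K = cbox s t" "K \<noteq> {}"
  obtains r where "r division_of \<Union>r" "\<Union>r \<subseteq> K" "\<And>J. J \<in> r \<Longrightarrow> interior J \<noteq> {}"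
    "\<And>f::real \<Rightarrow> real. (\<Sum>J\<in>\<D>. f (Sup J) - f (Inf J)) + (\<Sum>J\<in>r. f (Sup J) - f (Inf J)) = f (Sup K) - f (Inf K)"
proof -
  have "s \<le> t" using assms(3,4) by auto
  have KSI: "Sup K = t" "Inf K = s" using assms(3) \<open>s \<le> t\<close> by auto
  obtain q where q: "\<D> \<subseteq> q" "q division_of cbox s t"
    using partial_division_extend_interval[OF assms(1), of s t] assms(2,3) by blast
  define r where "r = {J \<in> q - \<D>. interior J \<noteq> {}}"
  have fq: "finite q" using q by auto
  show thesis
  proof (rule that)
    have "r \<subseteq> q" by (auto simp: r_def)
    show "r division_of \<Union>r" using division_of_subset[OF division_of_union_self[OF q(2)] \<open>r \<subseteq> q\<close>] .
    show "\<Union>r \<subseteq> K" using \<open>r \<subseteq> q\<close> division_ofD(2)[OF q(2)] assms(3) by blast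
    show "interior J \<noteq> {}" if "J \<in> r" for J using that by (simp add: r_def)
    fix f :: "real \<Rightarrow> real"
    let ?i = "\<lambda>J. f (Sup J) - f (Inf J)"
    have z: "?i J = 0" if J: "J \<in> q" "interior J = {}" for J
    proof -
      obtain c d where "J = cbox c d" "J \<noteq> {}" using division_ofD(3,4)[OF q(2)] J by metis
      with J(2) have "c = d" by (auto simp: interior_cbox)
      then show ?thesis using \<open>J = cbox c d\<close> by simp
    qed
    have "f t - f s = sum ?i q"
      using division_increment_sum[of q s t f] q(2) \<open>s \<le> t\<close> by simp
    also have "\<dots> = sum ?i \<D> + sum ?i (q - \<D>)"
      using sum.subset_diff[OF q(1) fq, of ?i] by (simp only: add.commute)
    also have "sum ?i (q - \<D>) = sum ?i r"
      by (rule sum.mono_neutral_right) (use fq z in \<open>auto simp: r_def\<close>)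
    finally show "(\<Sum>J\<in>\<D>. ?i J) + (\<Sum>J\<in>r. ?i J) = ?i K" using KSI by simp
  qed
qed

lemma content_Sup_Inf:
  assumes "p division_of (S::real set)" "K \<in> p"
  shows "content K = Sup K - Inf K"
proof -
  obtain a b where "K = cbox a b" "K \<noteq> {}" using division_ofD(3,4)[OF assms(1)] assms(2) by metis
  then show ?thesis by auto
qed

lemma measure_division:
  assumes "p division_of (S::real set)"
  shows "measure lebesgue S = sum content p"
proof -
  have "measure lebesgue K = content K" if "K \<in> p" for K
    using division_ofD(4)[OF assms that] by auto
  then show ?thesis using content_division[OF assms] by simp
qed

text \<open>The set \<open>E\<close> need not be measurable; \<open>outer\<close> says that its outer measure inside \<open>S\<close> is nearly that of \<open>S\<close>.\<close>

lemma vitali_one_sided: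
  fixes F :: "real \<Rightarrow> real"
  assumes ac: "\<And>p. \<lbrakk>p division_of \<Union>p; \<Union>p \<subseteq> {a..b}; sum content p < \<delta>\<rbrakk>
       \<Longrightarrow> (\<Sum>K\<in>p. norm (F (Sup K) - F (Inf K))) < \<epsilon>"
    and E: "\<And>x d. \<lbrakk>x \<in> E; d > 0\<rbrakk> \<Longrightarrow> \<exists>u v. u < v \<and> u \<le> x \<and> x \<le> v \<and> v - u < d \<and> c * (v - u) \<le> F v - F u"
    and P: "P division_of S" "S \<subseteq> {a..b}"
    and outer: "\<And>T. \<lbrakk>T \<in> lmeasurable; E \<inter> S \<subseteq> T\<rbrakk> \<Longrightarrow> sum content P - \<delta> < measure lebesgue T"
  shows "c * sum content P - \<bar>c\<bar> * \<delta> - \<epsilon> \<le> (\<Sum>K\<in>P. F (Sup K) - F (Inf K))"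
proof -
  have fP: "finite P" using P by auto
  \<comment> \<open>Intervals of slope at least \<open>c\<close>, each inside a single interval of
    \<open>P\<close>. By hypothesis they cover the points of \<open>E\<close> interior to
    \<open>P\<close> finely, as Vitali's theorem requires.\<close>
  define W where "W = {(u,v). u < v \<and> c * (v - u) \<le> F v - F u \<and> (\<exists>K\<in>P. {u..v} \<subseteq> K)}"
  define E0 where "E0 = E \<inter> (\<Union>K\<in>P. interior K)"
  let ?m = "\<lambda>(u,v). (u+v)/2 :: real" and ?r = "\<lambda>(u,v). (v-u)/2 :: real"
  have cb: "cball (?m w) (?r w) = {fst w..snd w}" for w
    by (cases w) (auto simp: cball_eq_atLeastAtMost field_simps)
  have "\<exists>w. w \<in> W \<and> x \<in> cball (?m w) (?r w) \<and> ?r w < d" if x: "x \<in> E0" "0 < d" for x d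
  proof -
    obtain K where K: "K \<in> P" "x \<in> interior K" using x by (auto simp: E0_def)
    then obtain e where e: "e > 0" "ball x e \<subseteq> K" by (meson mem_interior)
    obtain u v where uv: "u < v" "u \<le> x" "x \<le> v" "v - u < min d e" "c * (v - u) \<le> F v - F u"
      using E[of x "min d e"] x e by (auto simp: E0_def)
    have "{u..v} \<subseteq> ball x e" using uv by (auto simp: dist_real_def)
    then have "(u,v) \<in> W" using uv e K by (auto simp: W_def)
    then show ?thesis using uv cb[of "(u,v)"] by (intro exI[of _ "(u,v)"]) auto
  qed
  note cover = this
  have rpos: "0 < ?r w" if "w \<in> W" for w using that by (auto simp: W_def)
  obtain C where C: "countable C" "C \<subseteq> W"
    "pairwise (\<lambda>i j. disjnt (cball (?m i) (?r i)) (cball (?m j) (?r j))) C"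
    "negligible (E0 - (\<Union>i\<in>C. cball (?m i) (?r i)))"
    by (rule Vitali_covering_theorem_cballs[of W ?r E0 ?m, OF rpos cover]) blast
  define \<D> where "\<D> = (\<lambda>w. {fst w..snd w}) ` C"
  have Dneg: "negligible (E0 - \<Union>\<D>)" using C(4) unfolding cb \<D>_def by simp
  have Dp: "\<exists>u v. J = {u..v} \<and> u < v \<and> c * (v - u) \<le> F v - F u \<and> (\<exists>K\<in>P. J \<subseteq> K)" if JD: "J \<in> \<D>" for J
  proof -
    obtain w where w: "w \<in> C" "J = {fst w..snd w}" using JD unfolding \<D>_def by blast
    obtain u v where uv: "w = (u,v)" by (cases w)
    have "(u,v) \<in> W" using C(2) w uv by blast
    then have "J = {u..v} \<and> u < v \<and> c * (v - u) \<le> F v - F u \<and> (\<exists>K\<in>P. J \<subseteq> K)"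
      unfolding W_def using w(2) uv by simp
    then show ?thesis by blast
  qed
  have Ddis: "J1 \<inter> J2 = {}" if J12: "J1 \<in> \<D>" "J2 \<in> \<D>" "J1 \<noteq> J2" for J1 J2
  proof -
    obtain w1 w2 where "w1 \<in> C" "J1 = {fst w1..snd w1}" "w2 \<in> C" "J2 = {fst w2..snd w2}"
      using J12(1,2) unfolding \<D>_def by blast
    moreover from this have "w1 \<noteq> w2" using J12(3) by blast
    ultimately show ?thesis using C(3) unfolding cb pairwise_def disjnt_def by blast
  qed
  have cD: "countable \<D>" using C(1) by (simp add: \<D>_def)
  have Smeas: "S \<in> lmeasurable" and mS: "measure lebesgue S = sum content P"
    using P(1) by (simp_all add: lmeasurable_division measure_division)
  have DS: "\<Union>\<D> \<subseteq> S" using Dp division_ofD(2)[OF P(1)] by blast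
  have Dlm: "d \<in> lmeasurable" if "d \<in> \<D>" for d using Dp[OF that] by auto
  have DmB: "measure lebesgue (\<Union>\<D>') \<le> sum content P" if "\<D>' \<subseteq> \<D>" "finite \<D>'" for \<D>'
    unfolding mS[symmetric]
  proof (rule measure_mono_fmeasurable)
    show "\<Union>\<D>' \<subseteq> S" using DS that by blast
    have "\<D>' \<subseteq> lmeasurable" using Dlm that by blast
    then show "\<Union>\<D>' \<in> sets lebesgue" using fmeasurable.finite_Union[of \<D>'] that by blast
  qed fact
  have UDs: "\<Union>\<D> \<in> sets lebesgue" using cD Dlm by (meson fmeasurableD sets.countable_Union subsetI)
  have UDm: "\<Union>\<D> \<in> lmeasurable" using fmeasurableI2[OF Smeas DS UDs] .
  \<comment> \<open>What the interiors miss of \<open>S\<close> consists of endpoints of finitely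
    many intervals. Together with the Vitali remainder it makes up the null set
    \<open>N\<close>.\<close>
  have nb: "negligible (S - (\<Union>K\<in>P. interior K))"
  proof (rule negligible_subset)
    show "negligible (\<Union>K\<in>P. frontier K)"
    proof (rule negligible_Union)
      show "finite (frontier ` P)" using fP by simp
      fix X assume "X \<in> frontier ` P"
      then obtain K where "K \<in> P" "X = frontier K" by blast
      then obtain s t where "K = cbox s t" using division_ofD(4)[OF P(1)] by meson
      then show "negligible X" using \<open>X = frontier K\<close> negligible_convex_frontier[of K] convex_box(1) by simp
    qed
    show "S - (\<Union>K\<in>P. interior K) \<subseteq> (\<Union>K\<in>P. frontier K)"
    proof
      fix x assume x: "x \<in> S - (\<Union>K\<in>P. interior K)"
      then obtain K where K: "K \<in> P" "x \<in> K" using division_ofD(6)[OF P(1)] by blast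
      then have "x \<in> frontier K" using x closure_subset[of K] unfolding frontier_def by blast
      then show "x \<in> (\<Union>K\<in>P. frontier K)" using K by blast
    qed
  qed
  define N where "N = (E0 - \<Union>\<D>) \<union> (S - (\<Union>K\<in>P. interior K))"
  have Nn: "negligible N" unfolding N_def using Dneg nb by (rule negligible_Un)
  \<comment> \<open>\<open>\<Union>\<D> \<union> N\<close> covers \<open>E \<inter> S\<close>, so
    \<open>outer\<close> forces the selected intervals to have almost the full length of
    \<open>P\<close>; a finite subfamily \<open>\<D>'\<close> then does so too.\<close>
  have "sum content P - \<delta> < measure lebesgue (\<Union>\<D> \<union> N)"
  proof (rule outer)
    show "\<Union>\<D> \<union> N \<in> lmeasurable" using UDm Nn by (simp add: fmeasurable.Un negligible_imp_measurable)
    show "E \<inter> S \<subseteq> \<Union>\<D> \<union> N" by (auto simp: N_def E0_def)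
  qed
  also have "measure lebesgue (\<Union>\<D> \<union> N) = measure lebesgue (\<Union>\<D>)"
    using UDs Nn by (simp add: measure_Un_null_set negligible_iff_null_sets)
  finally have big: "0 < measure lebesgue (\<Union>\<D>) - (sum content P - \<delta>)" by simp
  obtain \<D>' where \<D>': "\<D>' \<subseteq> \<D>" "finite \<D>'" "sum content P - \<delta> < measure lebesgue (\<Union>\<D>')"
    using measure_countable_Union_approachable[OF cD big Dlm DmB] by auto
  have \<D>'div: "X division_of \<Union>X" if "X \<subseteq> \<D>'" for X
  proof (rule division_ofI)
    show "finite X" using \<D>' that finite_subset by blast
    show "\<And>K1 K2. K1 \<in> X \<Longrightarrow> K2 \<in> X \<Longrightarrow> K1 \<noteq> K2 \<Longrightarrow> interior K1 \<inter> interior K2 = {}"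
    proof -
      fix K1 K2 assume "K1 \<in> X" "K2 \<in> X" "K1 \<noteq> K2"
      then have "K1 \<inter> K2 = {}" using Ddis \<D>'(1) that by blast
      then show "interior K1 \<inter> interior K2 = {}" using interior_subset[of K1] interior_subset[of K2] by blast
    qed
    fix K assume "K \<in> X"
    then have "K \<in> \<D>" using \<D>'(1) that by blast
    from Dp[OF this] obtain u v where "K = {u..v}" "u < v" by blast
    then have "K = cbox u v" "K \<noteq> {}" by auto
    then show "K \<noteq> {}" "\<exists>a b. K = cbox a b" by blast+
  qed auto
  have intD: "interior J \<noteq> {}" if "J \<in> \<D>'" for J
  proof -
    have "J \<in> \<D>" using that \<D>'(1) by blast
    from Dp[OF this] obtain u v where "J = {u..v}" "u < v" by blast
    then show ?thesis by simp
  qed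
  define DK where "DK K = {J \<in> \<D>'. J \<subseteq> K}" for K
  define Q where "Q K r \<longleftrightarrow> r division_of \<Union>r \<and> \<Union>r \<subseteq> K \<and> (\<forall>J\<in>r. interior J \<noteq> {}) \<and>
     (\<forall>f::real \<Rightarrow> real. (\<Sum>J\<in>DK K. f (Sup J) - f (Inf J)) + (\<Sum>J\<in>r. f (Sup J) - f (Inf J)) = f (Sup K) - f (Inf K))"
    for K r
  have "\<exists>r. Q K r" if KP: "K \<in> P" for K
  proof -
    obtain s t where K: "K = cbox s t" "K \<noteq> {}" using division_ofD(3,4)[OF P(1) KP] by blast
    have DKs: "DK K \<subseteq> \<D>'" "\<Union>(DK K) \<subseteq> K" by (auto simp: DK_def)
    show ?thesis
    proof (rule division_inside[OF \<D>'div[OF DKs(1)] DKs(2) K])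
      fix r assume r: "r division_of \<Union>r" "\<Union>r \<subseteq> K" "\<And>J. J \<in> r \<Longrightarrow> interior J \<noteq> {}"
        "\<And>f::real \<Rightarrow> real. (\<Sum>J\<in>DK K. f (Sup J) - f (Inf J)) + (\<Sum>J\<in>r. f (Sup J) - f (Inf J)) = f (Sup K) - f (Inf K)"
      have "Q K r" unfolding Q_def by (intro conjI ballI allI r)
      then show ?thesis ..
    qed
  qed
  then have "\<forall>K\<in>P. \<exists>r. Q K r" by blast
  then obtain r where rQ: "\<forall>K\<in>P. Q K (r K)" by (rule bchoice[THEN exE])
  have r: "r K division_of \<Union>(r K)" "\<Union>(r K) \<subseteq> K" "J \<in> r K \<Longrightarrow> interior J \<noteq> {}"
     "(\<Sum>J\<in>DK K. f (Sup J) - f (Inf J)) + (\<Sum>J\<in>r K. f (Sup J) - f (Inf J)) = f (Sup K) - f (Inf K)"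
    if "K \<in> P" for K J and f :: "real \<Rightarrow> real"
  proof -
    note q = bspec[OF rQ that, unfolded Q_def]
    show "r K division_of \<Union>(r K)" "\<Union>(r K) \<subseteq> K" using q by simp_all
    show "interior J \<noteq> {}" if "J \<in> r K" using q that by simp
    show "(\<Sum>J\<in>DK K. f (Sup J) - f (Inf J)) + (\<Sum>J\<in>r K. f (Sup J) - f (Inf J)) = f (Sup K) - f (Inf K)"
      using q by simp
  qed
  have sep: "interior J1 \<inter> interior J2 = {}" if "K1 \<in> P" "K2 \<in> P" "K1 \<noteq> K2" "J1 \<subseteq> K1" "J2 \<subseteq> K2" for J1 J2 K1 K2
    using division_ofD(5)[OF P(1) that(1-3)] that(4,5) interior_mono by blast
  \<comment> \<open>The gaps of all intervals of \<open>P\<close> together. Their total length turns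
    out to be below \<open>\<delta>\<close>, so absolute continuity bounds the increments over them
    by \<open>\<epsilon>\<close>.\<close>
  define R where "R = (\<Union>K\<in>P. r K)"
  have Rdiv: "R division_of \<Union>R"
  proof (rule division_ofI)
    show "finite R" unfolding R_def using fP r(1) by auto
    fix J assume "J \<in> R" then obtain K where "K \<in> P" "J \<in> r K" by (auto simp: R_def)
    then show "J \<noteq> {}" "\<exists>a b. J = cbox a b" using division_ofD(3,4)[OF r(1)] by blast+
    fix J2 assume "J2 \<in> R" "J \<noteq> J2"
    then obtain K2 where "K2 \<in> P" "J2 \<in> r K2" by (auto simp: R_def)
    show "interior J \<inter> interior J2 = {}"
    proof (cases "K = K2")
      case True then show ?thesis using division_ofD(5)[OF r(1)] \<open>J \<noteq> J2\<close> \<open>K \<in> P\<close> \<open>J \<in> r K\<close> \<open>J2 \<in> r K2\<close> by blast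
    next
      case False then show ?thesis
        using sep[OF \<open>K \<in> P\<close> \<open>K2 \<in> P\<close> False] r(2) \<open>K \<in> P\<close> \<open>K2 \<in> P\<close> \<open>J \<in> r K\<close> \<open>J2 \<in> r K2\<close> by blast
    qed
  qed auto
  have Rsub: "\<Union>R \<subseteq> {a..b}" using r(2) P division_ofD(2)[OF P(1)] unfolding R_def by blast
  have split: "(\<Sum>J\<in>\<D>'. f (Sup J) - f (Inf J)) + (\<Sum>J\<in>R. f (Sup J) - f (Inf J)) = (\<Sum>K\<in>P. f (Sup K) - f (Inf K))"
    for f :: "real \<Rightarrow> real"
  proof -
    have "\<D>' = (\<Union>K\<in>P. DK K)" using Dp \<D>'(1) unfolding DK_def by blast
    moreover have "(\<Sum>J\<in>(\<Union>K\<in>P. DK K). f (Sup J) - f (Inf J)) = (\<Sum>K\<in>P. \<Sum>J\<in>DK K. f (Sup J) - f (Inf J))"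
    proof (rule sum.UNION_disjoint[OF fP])
      show "\<forall>i\<in>P. finite (DK i)" using \<D>'(2) by (auto simp: DK_def)
      show "\<forall>i\<in>P. \<forall>j\<in>P. i \<noteq> j \<longrightarrow> DK i \<inter> DK j = {}"
      proof (intro ballI impI)
        fix i j assume ij: "i \<in> P" "j \<in> P" "i \<noteq> j"
        have "False" if "J \<in> DK i" "J \<in> DK j" for J
          using sep[OF ij, of J J] intD[of J] that by (auto simp: DK_def)
        then show "DK i \<inter> DK j = {}" by blast
      qed
    qed
    moreover have "(\<Sum>J\<in>R. f (Sup J) - f (Inf J)) = (\<Sum>K\<in>P. \<Sum>J\<in>r K. f (Sup J) - f (Inf J))"
      unfolding R_def
    proof (rule sum.UNION_disjoint[OF fP])
      show "\<forall>i\<in>P. finite (r i)" using r(1) by auto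
      show "\<forall>i\<in>P. \<forall>j\<in>P. i \<noteq> j \<longrightarrow> r i \<inter> r j = {}"
      proof (intro ballI impI)
        fix i j assume ij: "i \<in> P" "j \<in> P" "i \<noteq> j"
        have "False" if "J \<in> r i" "J \<in> r j" for J
          using sep[OF ij, of J J] r(2)[OF ij(1)] r(2)[OF ij(2)] r(3)[OF ij(1) that(1)] that by auto
        then show "r i \<inter> r j = {}" by blast
      qed
    qed
    ultimately show ?thesis using r(4) by (simp add: sum.distrib[symmetric])
  qed
  have cont: "sum content X = (\<Sum>J\<in>X. Sup J - Inf J)" if "X division_of Y" for X and Y :: "real set"
    using content_Sup_Inf[OF that] by simp
  have c1: "sum content \<D>' + sum content R = sum content P"
    using split[of "\<lambda>x. x"] cont[OF \<D>'div[OF order_refl]] cont[OF Rdiv] cont[OF P(1)] by simp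
  have "measure lebesgue (\<Union>\<D>') = sum content \<D>'"
    using measure_division[OF \<D>'div[OF order_refl]] .
  then have c2: "sum content R < \<delta>" using \<D>'(3) c1 by linarith
  have c3: "0 \<le> sum content R" by (simp add: sum_nonneg)
  have "(\<Sum>K\<in>R. norm (F (Sup K) - F (Inf K))) < \<epsilon>" using ac[OF Rdiv Rsub c2] .
  then have f1: "- \<epsilon> \<le> (\<Sum>K\<in>R. F (Sup K) - F (Inf K))"
    using sum_abs[of "\<lambda>K. F (Sup K) - F (Inf K)" R] unfolding real_norm_def by linarith
  have f2: "c * sum content \<D>' \<le> (\<Sum>J\<in>\<D>'. F (Sup J) - F (Inf J))"
  proof (subst sum_distrib_left, rule sum_mono)
    fix J assume "J \<in> \<D>'"
    then have "J \<in> \<D>" using \<D>'(1) by blast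
    from Dp[OF this] obtain u v where "J = {u..v}" "u < v" "c * (v - u) \<le> F v - F u" by blast
    then show "c * content J \<le> F (Sup J) - F (Inf J)" by simp
  qed
  \<comment> \<open>\<open>c\<close> may be negative, hence the absolute value.\<close>
  have "c * sum content R \<le> \<bar>c\<bar> * sum content R" by (rule mult_right_mono[OF abs_ge_self c3])
  also have "\<dots> \<le> \<bar>c\<bar> * \<delta>" by (rule mult_left_mono[OF less_imp_le[OF c2] abs_ge_zero])
  finally have g1: "c * sum content R \<le> \<bar>c\<bar> * \<delta>" .
  have g2: "c * sum content P = c * sum content \<D>' + c * sum content R"
    by (subst c1[symmetric]) (rule distrib_left)
  show ?thesis using f1 f2 split[of F] g1 g2 by linarith
qed


text \<open>Without measurability of \<open>E\<close>, its outer measure \<open>Inf M\<close> takes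
  the place of a measure. An open \<open>U\<close> around \<open>E\<close> exceeds it by little, and
  finitely many boxes, with union \<open>S\<close>, exhaust \<open>U\<close> up to little. A set
  covering \<open>E \<inter> S\<close> becomes a cover of \<open>E\<close> when \<open>U - S\<close>
  is added, so it cannot be much smaller than \<open>Inf M\<close>. Each of the three approximations
  costs \<open>\<delta>/3\<close>.\<close>

lemma outer_measure_division:
  fixes E :: "real set"
  assumes "E \<subseteq> {a<..<b}" "\<delta> > 0"
  obtains P S T where "P division_of S" "S \<subseteq> {a..b}"
    "\<forall>T. T \<in> lmeasurable \<and> E \<inter> S \<subseteq> T \<longrightarrow> sum content P - \<delta> < measure lebesgue T"
    "E \<subseteq> T" "T \<in> lmeasurable" "measure lebesgue T < sum content P + \<delta>"
proof -
  define M where "M = measure lebesgue ` {T. T \<in> lmeasurable \<and> E \<subseteq> T}"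
  have bdd: "bdd_below M" by (rule bdd_belowI[of _ 0]) (auto simp: M_def)
  have "{a<..<b} \<in> lmeasurable" by simp
  then have ne: "M \<noteq> {}" using assms(1) by (auto simp: M_def)
  have "Inf M < Inf M + \<delta>/3" using assms by simp
  then obtain t where "t \<in> M" "t < Inf M + \<delta>/3" using cInf_lessD[OF ne] by blast
  then obtain T where T: "T \<in> lmeasurable" "E \<subseteq> T" "measure lebesgue T < Inf M + \<delta>/3"
    by (auto simp: M_def)
  have "T \<in> sets lebesgue" "\<delta>/3 > 0" using T assms by auto
  then obtain V where V: "open V" "T \<subseteq> V" "V - T \<in> lmeasurable" "emeasure lebesgue (V - T) < ennreal (\<delta>/3)"
    by (rule sets_lebesgue_outer_open)
  define U where "U = V \<inter> {a<..<b}"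
  have oU: "open U" using V(1) by (simp add: U_def open_Int)
  have EU: "E \<subseteq> U" using assms(1) T(2) V(2) unfolding U_def by blast
  have Ulm: "U \<in> lmeasurable" 
    using bounded_subset[of "{a<..<b}" U] bounded_box[of a b] oU by (intro lmeasurable_open) (auto simp: U_def)
  have "measure lebesgue U \<le> measure lebesgue (T \<union> (V - T))"
  proof (rule measure_mono_fmeasurable)
    show "U \<subseteq> T \<union> (V - T)" by (auto simp: U_def)
    show "T \<union> (V - T) \<in> lmeasurable" using T(1) V(3) by (rule fmeasurable.Un)
  qed (use Ulm in blast)
  also have "\<dots> \<le> measure lebesgue T + measure lebesgue (V - T)"
    by (rule measure_Un_le) (use T(1) V(3) in blast)+
  also have "measure lebesgue (V - T) < \<delta>/3"
    using V(3,4) \<open>\<delta>/3 > 0\<close> by (simp add: emeasure_eq_measure2 ennreal_less_iff)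
  finally have mU: "measure lebesgue U < Inf M + 2*\<delta>/3" using T(3) by simp
  obtain \<D> where D: "countable \<D>" "\<D> \<subseteq> Pow U" "\<And>X. X \<in> \<D> \<Longrightarrow> \<exists>a b. X = cbox a b" "\<Union>\<D> = U"
    using open_countable_Union_open_cbox[OF oU] by blast
  have Dlm: "d \<in> lmeasurable" if "d \<in> \<D>" for d using D(3)[OF that] by auto
  have B: "measure lebesgue (\<Union>\<D>') \<le> measure lebesgue U" if "\<D>' \<subseteq> \<D>" "finite \<D>'" for \<D>'
  proof (rule measure_mono_fmeasurable)
    show "\<Union>\<D>' \<subseteq> U" using D(4) that by blast
    have "\<D>' \<subseteq> lmeasurable" using Dlm that by blast
    then show "\<Union>\<D>' \<in> sets lebesgue" using fmeasurable.finite_Union[of \<D>'] that by blast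
  qed fact
  obtain \<D>' where D': "\<D>' \<subseteq> \<D>" "finite \<D>'" "measure lebesgue U - \<delta>/3 < measure lebesgue (\<Union>\<D>')"
    using measure_countable_Union_approachable[OF D(1) \<open>\<delta>/3 > 0\<close> Dlm B] D(4) by metis
  define S where "S = \<Union>\<D>'"
  have SU: "S \<subseteq> U" using D' D(4) by (auto simp: S_def)
  obtain P where P: "P division_of S"
    using elementary_unions_intervals[OF D'(2)] D(3) D'(1) unfolding S_def by blast
  have Slm: "S \<in> lmeasurable" using lmeasurable_division[OF P] .
  have mS: "measure lebesgue S = sum content P" using measure_division[OF P] .
  have mUS: "measure lebesgue (U - S) < \<delta>/3"
    using measurable_measure_Diff[OF Ulm, of S] Slm SU D'(3) by (simp add: S_def fmeasurableD)
  show thesis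
  proof (rule that[OF P _ _ EU Ulm])
    show "S \<subseteq> {a..b}" using SU by (auto simp: U_def)
    show "measure lebesgue U < sum content P + \<delta>" using D'(3) mS assms(2) by (simp add: S_def)
    have "sum content P - \<delta> < measure lebesgue T2" if T2: "T2 \<in> lmeasurable" "E \<inter> S \<subseteq> T2" for T2
    proof -
    have lm: "T2 \<union> (U - S) \<in> lmeasurable" using T2 Ulm Slm by (intro fmeasurable.Un fmeasurable_Diff) auto
    moreover have "E \<subseteq> T2 \<union> (U - S)" using EU T2 by blast
    ultimately have "Inf M \<le> measure lebesgue (T2 \<union> (U - S))"
      by (intro cInf_lower bdd) (auto simp: M_def)
    also have "\<dots> \<le> measure lebesgue T2 + measure lebesgue (U - S)"
      using T2 Ulm Slm by (intro measure_Un_le) auto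
    finally have "Inf M < measure lebesgue T2 + \<delta>/3" using mUS by simp
    moreover have "sum content P \<le> measure lebesgue U"
      unfolding mS[symmetric] by (rule measure_mono_fmeasurable) (use SU Slm Ulm in auto)
    ultimately show "sum content P - \<delta> < measure lebesgue T2" using mU by linarith
    qed
    then show "\<forall>T. T \<in> lmeasurable \<and> E \<inter> S \<subseteq> T \<longrightarrow> sum content P - \<delta> < measure lebesgue T" by blast
  qed
qed

text \<open>A version of "the upper derivative at \<open>x\<close> is at least \<open>c\<close>" in
  which the intervals may straddle \<open>x\<close>, the shape that Vitali covers have. Applied to
  \<open>- F\<close> and \<open>- p\<close> it says that slopes of at most \<open>p\<close> occur on
  arbitrarily short intervals around \<open>x\<close>.\<close>

definition steep_at :: "(real \<Rightarrow> real) \<Rightarrow> real \<Rightarrow> real \<Rightarrow> bool" where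
  "steep_at F c x \<longleftrightarrow> (\<forall>d>0. \<exists>u v. u < v \<and> u \<le> x \<and> x \<le> v \<and> v - u < d \<and> c * (v - u) \<le> F v - F u)"

lemma AC_uminus: "AC a b F \<Longrightarrow> AC a b (\<lambda>x. - F x)"
  unfolding AC_def by (simp add: norm_minus_commute)

text \<open>
  Compare the increment of \<open>F\<close> over one elementary set that nearly fills the exceptional set from outside:
  it is almost at least \<open>r\<close> times and almost at most \<open>p\<close> times the measure of that set.
\<close>

lemma AC_two_slopes_negligible:
  fixes F :: "real \<Rightarrow> real"
  assumes ac: "AC a b F" and pr: "p < r"
  shows "negligible {x \<in> {a<..<b}. steep_at F r x \<and> steep_at (\<lambda>x. - F x) (- p) x}" (is "negligible ?E")
  unfolding negligible_outer
proof (intro allI impI)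
  fix e :: real assume e: "e > 0"
  \<comment> \<open>The two slope estimates leave an error of at most
    \<open>s * \<delta> + 2 * \<epsilon>\<close>. Both summands are made at most
    \<open>(r - p) * e / 4\<close>, which gives \<open>sum content P \<le> e/2\<close>; the set
    \<open>T\<close> then costs at most a further \<open>\<delta> \<le> e/4\<close>.\<close>
  define \<epsilon> where "\<epsilon> = (r - p) * e / 8"
  have "\<epsilon> > 0" using e pr by (simp add: \<epsilon>_def)
  with ac have "\<exists>d>0. \<forall>P. P division_of \<Union>P \<and> \<Union>P \<subseteq> {a..b} \<and> sum content P < d
      \<longrightarrow> (\<Sum>K\<in>P. norm (F (Sup K) - F (Inf K))) < \<epsilon>" unfolding AC_def by blast
  then obtain \<delta>0 where \<delta>0: "\<delta>0 > 0"
    "\<forall>P. P division_of \<Union>P \<and> \<Union>P \<subseteq> {a..b} \<and> sum content P < \<delta>0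
      \<longrightarrow> (\<Sum>K\<in>P. norm (F (Sup K) - F (Inf K))) < \<epsilon>" by blast
  define s where "s = \<bar>r\<bar> + \<bar>p\<bar> + 1"
  have s: "s > 0" by (simp add: s_def)
  define \<delta> where "\<delta> = min \<delta>0 (min (e/4) (e * (r - p) / (4 * s)))"
  have \<delta>: "\<delta> > 0" "\<delta> \<le> \<delta>0" "\<delta> \<le> e/4" "\<delta> \<le> e * (r - p) / (4 * s)"
    using \<delta>0(1) e pr s by (auto simp: \<delta>_def)
  have \<delta>4: "s * \<delta> \<le> e * (r - p) / 4" using \<delta>(4) s by (simp add: field_simps)
  have "?E \<subseteq> {a<..<b}" by auto
  then obtain P S T where P: "P division_of S" "S \<subseteq> {a..b}"
    "\<forall>T. T \<in> lmeasurable \<and> ?E \<inter> S \<subseteq> T \<longrightarrow> sum content P - \<delta> < measure lebesgue T"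
    "?E \<subseteq> T" "T \<in> lmeasurable" "measure lebesgue T < sum content P + \<delta>"
    by (rule outer_measure_division[OF _ \<delta>(1)])
  have 1: "r * sum content P - \<bar>r\<bar> * \<delta> - \<epsilon> \<le> (\<Sum>K\<in>P. F (Sup K) - F (Inf K))"
  proof (rule vitali_one_sided[OF _ _ P(1,2) P(3)[rule_format, OF conjI]])
    show "(\<Sum>K\<in>p. norm (F (Sup K) - F (Inf K))) < \<epsilon>"
      if "p division_of \<Union> p" "\<Union> p \<subseteq> {a..b}" "sum content p < \<delta>" for p
      by (rule \<delta>0(2)[rule_format]) (use that \<delta>(2) in auto)
  qed (auto simp: steep_at_def)
  have 2: "- p * sum content P - \<bar>- p\<bar> * \<delta> - \<epsilon> \<le> (\<Sum>K\<in>P. - F (Sup K) - - F (Inf K))"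
  proof (rule vitali_one_sided[OF _ _ P(1,2) P(3)[rule_format, OF conjI]])
    show "(\<Sum>K\<in>p. norm (- F (Sup K) - - F (Inf K))) < \<epsilon>"
      if "p division_of \<Union> p" "\<Union> p \<subseteq> {a..b}" "sum content p < \<delta>" for p
      using \<delta>0(2)[rule_format, of p] \<delta>(2) that by (auto simp: abs_minus_commute)
  qed (auto simp: steep_at_def)
  have "(\<Sum>K\<in>P. - F (Sup K) - - F (Inf K)) = - (\<Sum>K\<in>P. F (Sup K) - F (Inf K))"
    by (simp add: sum_negf[symmetric])
  with 1 2 have "(r - p) * sum content P \<le> (\<bar>r\<bar> + \<bar>p\<bar>) * \<delta> + 2 * \<epsilon>"
    by (simp add: algebra_simps)
  also have "\<dots> \<le> s * \<delta> + 2 * \<epsilon>" using \<delta>(1) by (simp add: s_def algebra_simps)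
  also have "\<dots> \<le> e * (r - p) / 4 + 2 * \<epsilon>" using \<delta>4 by simp
  also have "\<dots> = (r - p) * (e / 2)" by (simp add: \<epsilon>_def field_simps)
  finally have "sum content P \<le> e/2" using pr by (simp add: mult_le_cancel_left)
  then have "measure lebesgue T < e" using P(6) \<delta>(3) e by linarith
  then show "\<exists>T. ?E \<subseteq> T \<and> T \<in> lmeasurable \<and> measure lebesgue T < e" using P(4,5) by blast
qed

text \<open>On a set of length below \<open>\<delta>1\<close> the increments of \<open>F\<close> add
  up to less than 1, so a large slope can prevail only on a small part of it. The bound needs this
  short length; therefore windows of length \<open>2 * \<delta>1 / 3\<close> are treated one by one,
  and negligibility is concluded from its local form.\<close>

lemma AC_infinite_slope_negligible:
  fixes F :: "real \<Rightarrow> real"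
  assumes ac: "AC a b F"
  shows "negligible {x \<in> {a<..<b}. \<forall>r. steep_at F r x}" (is "negligible ?E")
proof -
  have "\<exists>d>0. \<forall>P. P division_of \<Union>P \<and> \<Union>P \<subseteq> {a..b} \<and> sum content P < d
      \<longrightarrow> (\<Sum>K\<in>P. norm (F (Sup K) - F (Inf K))) < 1" using ac zero_less_one unfolding AC_def by blast
  then obtain \<delta>1 where \<delta>1: "\<delta>1 > 0"
    "\<forall>P. P division_of \<Union>P \<and> \<Union>P \<subseteq> {a..b} \<and> sum content P < \<delta>1
      \<longrightarrow> (\<Sum>K\<in>P. norm (F (Sup K) - F (Inf K))) < 1" by blast
  have loc: "negligible (?E \<inter> {x - \<delta>1/3<..<x + \<delta>1/3})" (is "negligible ?U") for x
    unfolding negligible_outer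
  proof (intro allI impI)
    fix e :: real assume e: "e > 0"
    define \<delta> where "\<delta> = min \<delta>1 (e/4)"
    have \<delta>: "\<delta> > 0" "\<delta> \<le> \<delta>1" "\<delta> \<le> e/4" using \<delta>1(1) e by (auto simp: \<delta>_def)
    let ?a = "max a (x - \<delta>1/3)" and ?b = "min b (x + \<delta>1/3)"
    have "?U \<subseteq> {?a<..<?b}" by auto
    then obtain P S T where P: "P division_of S" "S \<subseteq> {?a..?b}"
      "\<forall>T. T \<in> lmeasurable \<and> ?U \<inter> S \<subseteq> T \<longrightarrow> sum content P - \<delta> < measure lebesgue T"
      "?U \<subseteq> T" "T \<in> lmeasurable" "measure lebesgue T < sum content P + \<delta>"
      by (rule outer_measure_division[OF _ \<delta>(1)])
    have Sab: "S \<subseteq> {a..b}" using P(2) by auto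
    \<comment> \<open>The increment is below 1 and the error of the Vitali estimate is also 1, so
      slope \<open>8/e\<close> leaves \<open>sum content P < \<delta> + 2 * (e/8)\<close>.\<close>
    have "8/e * sum content P - \<bar>8/e\<bar> * \<delta> - 1 \<le> (\<Sum>K\<in>P. F (Sup K) - F (Inf K))"
    proof (rule vitali_one_sided[OF _ _ P(1) Sab P(3)[rule_format, OF conjI]])
      show "(\<Sum>K\<in>p. norm (F (Sup K) - F (Inf K))) < 1"
        if "p division_of \<Union> p" "\<Union> p \<subseteq> {a..b}" "sum content p < \<delta>" for p
        by (rule \<delta>1(2)[rule_format]) (use that \<delta>(2) in auto)
      fix z d assume "z \<in> ?U" "(d::real) > 0"
      then have "steep_at F (8/e) z" by blast
      then show "\<exists>u v. u < v \<and> u \<le> z \<and> z \<le> v \<and> v - u < d \<and> 8/e * (v - u) \<le> F v - F u"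
        unfolding steep_at_def using \<open>d > 0\<close> by blast
    qed
    also have "(\<Sum>K\<in>P. F (Sup K) - F (Inf K)) < 1"
    proof -
      have "sum content P = measure lebesgue S" using measure_division[OF P(1)] by simp
      also have "\<dots> \<le> measure lebesgue {x - \<delta>1/3..x + \<delta>1/3}"
        by (rule measure_mono_fmeasurable) (use P(2) lmeasurable_division[OF P(1)] in auto)
      also have "\<dots> < \<delta>1" using \<delta>1(1) by simp
      finally have "(\<Sum>K\<in>P. norm (F (Sup K) - F (Inf K))) < 1"
        using \<delta>1(2)[rule_format, of P] P(1) Sab division_ofD(6)[OF P(1)] by auto
      then show ?thesis using sum_abs[of "\<lambda>K. F (Sup K) - F (Inf K)" P] unfolding real_norm_def by linarith
    qed
    finally have "sum content P < \<delta> + e/4" using e by (simp add: field_simps)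
    then have "measure lebesgue T < e" using P(6) \<delta>(3) e by linarith
    then show "\<exists>T. ?U \<subseteq> T \<and> T \<in> lmeasurable \<and> measure lebesgue T < e" using P(4,5) by blast
  qed
  show ?thesis
  proof (subst locally_negligible_alt, rule ballI)
    fix x assume x: "x \<in> ?E"
    let ?U = "?E \<inter> {x - \<delta>1/3<..<x + \<delta>1/3}"
    have "openin (top_of_set ?E) ?U" by (rule openin_open_Int) (rule open_greaterThanLessThan)
    moreover have "x \<in> ?U" using x \<delta>1(1) by simp
    moreover have "negligible ?U" by (rule loc)
    ultimately show "\<exists>U. openin (top_of_set ?E) U \<and> x \<in> U \<and> negligible U" by (intro exI[of _ ?U] conjI)
  qed
qed

lemma not_steep_at_quotient:
  assumes "\<not> steep_at F c x"
  shows "\<forall>\<^sub>F y in at x. (F y - F x) / (y - x) < c"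
proof -
  obtain d where d: "d > 0" "\<And>u v. \<lbrakk>u < v; u \<le> x; x \<le> v; v - u < d\<rbrakk> \<Longrightarrow> F v - F u < c * (v - u)"
    using assms unfolding steep_at_def by (metis not_less)
  show ?thesis
    unfolding eventually_at
  proof (intro exI conjI ballI impI)
    fix y assume y: "y \<noteq> x \<and> dist y x < d"
    show "(F y - F x) / (y - x) < c"
    proof (cases "x < y")
      case True
      then have "F y - F x < c * (y - x)" using d(2)[of x y] y by (simp add: dist_real_def)
      then show ?thesis using True by (simp add: divide_less_eq)
    next
      case False
      then have "y < x" using y by simp
      then have "F x - F y < c * (x - y)" using d(2)[of y x] y by (simp add: dist_real_def)
      then have "(F x - F y) / (x - y) < c" using \<open>y < x\<close> by (simp add: divide_less_eq)
      moreover have "(F x - F y) / (x - y) = (F y - F x) / (y - x)" by (metis minus_diff_eq minus_divide_divide)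
      ultimately show ?thesis by simp
    qed
  qed (fact d(1))
qed

text \<open>The derivative is \<open>L\<close>, the supremum of all eventual lower bounds of the
  difference quotient. For \<open>t > L\<close> take rationals \<open>p < r\<close> between them:
  \<open>p\<close> is not an eventual lower bound, so slopes of at most \<open>p\<close> occur, and
  \<open>rat\<close> then excludes slopes of at least \<open>r\<close>. Rational pairs suffice for
  this and are countable.\<close>

lemma differentiable_if_slopes:
  fixes F :: "real \<Rightarrow> real"
  assumes up: "\<not> steep_at F B x" and lo: "\<not> steep_at (\<lambda>x. - F x) B' x"
    and rat: "\<And>p r. \<lbrakk>p \<in> \<rat>; r \<in> \<rat>; p < r\<rbrakk> \<Longrightarrow> \<not> steep_at F r x \<or> \<not> steep_at (\<lambda>x. - F x) (- p) x"
  shows "F differentiable (at x)"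
proof -
  let ?q = "\<lambda>y. (F y - F x) / (y - x)"
  have dn: "\<forall>\<^sub>F y in at x. c < ?q y" if "\<not> steep_at (\<lambda>x. - F x) (- c) x" for c
  proof -
    have "\<forall>\<^sub>F y in at x. (- F y - - F x) / (y - x) < - c" using not_steep_at_quotient[OF that] .
    then show ?thesis
    proof (rule eventually_mono)
      fix y assume "(- F y - - F x) / (y - x) < - c"
      moreover have "(- F y - - F x) / (y - x) = - ?q y" by (simp add: divide_simps)
      ultimately show "c < ?q y" by simp
    qed
  qed
  define A where "A = {t. \<forall>\<^sub>F y in at x. t < ?q y}"
  have mem: "- B' \<in> A" using dn[of "- B'"] lo by (simp add: A_def)
  have bdd: "t \<le> B" if "t \<in> A" for t
  proof -
    have "\<forall>\<^sub>F y in at x. t < ?q y \<and> ?q y < B"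
      using that not_steep_at_quotient[OF up] by (simp add: A_def eventually_conj)
    then have "\<exists>y. t < ?q y \<and> ?q y < B" by (rule eventually_happens'[rotated]) simp
    then show ?thesis by linarith
  qed
  define L where "L = Sup A"
  have bA: "bdd_above A" using bdd by (meson bdd_aboveI)
  have "(?q \<longlongrightarrow> L) (at x)"
  proof (rule order_tendstoI)
    fix t assume "t < L"
    then obtain s where "s \<in> A" "t < s" using less_cSup_iff[of A t] mem bA by (auto simp: L_def)
    then show "\<forall>\<^sub>F y in at x. t < ?q y" by (auto simp: A_def elim: eventually_mono)
  next
    fix t assume "L < t"
    then obtain p where p: "p \<in> \<rat>" "L < p" "p < t" using Rats_dense_in_real by blast
    then obtain r where r: "r \<in> \<rat>" "p < r" "r < t" using Rats_dense_in_real by blast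
    have "p \<notin> A" using p(2) cSup_upper[OF _ bA, of p] by (auto simp: L_def)
    then have "steep_at (\<lambda>x. - F x) (- p) x" using dn[of p] by (auto simp: A_def)
    then have "\<not> steep_at F r x" using rat[OF p(1) r(1,2)] by blast
    then have "\<forall>\<^sub>F y in at x. ?q y < r" by (rule not_steep_at_quotient)
    then show "\<forall>\<^sub>F y in at x. ?q y < t" by (rule eventually_mono) (use r in simp)
  qed
  then have "(F has_field_derivative L) (at x)" by (simp add: has_field_derivative_iff)
  then show ?thesis using real_differentiable_def by blast
qed

text \<open>The exceptional points have upper derivative plus infinity, lower derivative minus
  infinity, or a rational gap between the two. Interior points only: a two-sided derivative at an
  endpoint involves values that absolute continuity on the interval does not control.\<close>

theorem AC_differentiable_ae:
  fixes F :: "real \<Rightarrow> real"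
  assumes "AC a b F"
  shows "negligible {x \<in> {a<..<b}. \<not> F differentiable (at x)}"
proof -
  let ?N = "\<lambda>(p, r). if p < r then {x \<in> {a<..<b}. steep_at F r x \<and> steep_at (\<lambda>x. - F x) (- p) x} else {}"
  have "negligible (\<Union>z\<in>\<rat>\<times>\<rat>. ?N z)"
  proof (rule negligible_countable_Union)
    show "countable (?N ` (\<rat>\<times>\<rat>))" by (intro countable_image countable_SIGMA countable_rat)
  qed (use AC_two_slopes_negligible[OF assms] in auto)
  moreover have "negligible {x \<in> {a<..<b}. \<forall>r. steep_at F r x}"
    by (rule AC_infinite_slope_negligible[OF assms])
  moreover have "negligible {x \<in> {a<..<b}. \<forall>r. steep_at (\<lambda>x. - F x) r x}"
    by (rule AC_infinite_slope_negligible[OF AC_uminus[OF assms]])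
  ultimately have "negligible ((\<Union>z\<in>\<rat>\<times>\<rat>. ?N z) \<union> ({x \<in> {a<..<b}. \<forall>r. steep_at F r x}
      \<union> {x \<in> {a<..<b}. \<forall>r. steep_at (\<lambda>x. - F x) r x}))" by (intro negligible_Un)
  note neg = this
  show ?thesis
  proof (rule negligible_subset[OF neg], intro subsetI, rule ccontr)
    fix x assume x: "x \<in> {x \<in> {a<..<b}. \<not> F differentiable (at x)}"
      and n: "x \<notin> (\<Union>z\<in>\<rat>\<times>\<rat>. ?N z) \<union> ({x \<in> {a<..<b}. \<forall>r. steep_at F r x}
      \<union> {x \<in> {a<..<b}. \<forall>r. steep_at (\<lambda>x. - F x) r x})"
    obtain B B' where "\<not> steep_at F B x" "\<not> steep_at (\<lambda>x. - F x) B' x" using x n by auto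
    moreover have "\<not> steep_at F r x \<or> \<not> steep_at (\<lambda>x. - F x) (- p) x" if "p \<in> \<rat>" "r \<in> \<rat>" "p < r" for p r
    proof -
      have "x \<notin> ?N (p, r)" using n that by blast
      then show ?thesis using x that by auto
    qed
    ultimately have "F differentiable (at x)" by (rule differentiable_if_slopes)
    then show False using x by simp
  qed
qed


section \<open>Fundamental theorem of calculus for absolutely continuous functions\<close>

lemma abs_cont_on_AC:
  assumes "abs_cont_on a b f"
  shows "AC a b f"
  unfolding AC_def
proof (intro allI impI)
  fix e :: real assume "e > 0"
  with assms have "\<exists>d>0. \<forall>(n::nat) u v. (\<forall>i<n. a \<le> u i \<and> u i \<le> v i \<and> v i \<le> b) \<and>
        disjoint_family_on (\<lambda>i. {u i<..<v i}) {..<n} \<and> (\<Sum>i<n. v i - u i) < d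
        \<longrightarrow> (\<Sum>i<n. cmod (f (v i) - f (u i))) < e"
    unfolding abs_cont_on_def by blast
  then obtain d where d: "d > 0"
    "\<forall>(n::nat) u v. (\<forall>i<n. a \<le> u i \<and> u i \<le> v i \<and> v i \<le> b) \<and>
        disjoint_family_on (\<lambda>i. {u i<..<v i}) {..<n} \<and> (\<Sum>i<n. v i - u i) < d
        \<longrightarrow> (\<Sum>i<n. cmod (f (v i) - f (u i))) < e" by blast
  have "(\<Sum>K\<in>p. norm (f (Sup K) - f (Inf K))) < e"
    if p: "p division_of \<Union>p" "\<Union>p \<subseteq> {a..b}" "sum content p < d" for p
  proof -
    have "finite p" using p(1) by auto
    then obtain h where h: "bij_betw h {..<card p} p"
      using ex_bij_betw_nat_finite[of p] by (auto simp: atLeast0LessThan)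
    let ?u = "\<lambda>i. Inf (h i)" and ?v = "\<lambda>i. Sup (h i)"
    have hp: "h i \<in> p" if "i < card p" for i using h that by (auto simp: bij_betw_def)
    have K: "a \<le> Inf K \<and> Inf K \<le> Sup K \<and> Sup K \<le> b \<and> {Inf K<..<Sup K} = interior K" if Kp: "K \<in> p" for K
    proof -
      obtain c e where ce: "K = cbox c e" "K \<noteq> {}" using division_ofD(3,4)[OF p(1) Kp] by blast
      have "K \<subseteq> {a..b}" using Kp p(2) by blast
      then show ?thesis using ce by auto
    qed
    have "(\<Sum>i<card p. cmod (f (?v i) - f (?u i))) < e"
    proof (rule d(2)[rule_format], intro conjI allI impI)
      show "a \<le> ?u i" "?u i \<le> ?v i" "?v i \<le> b" if "i < card p" for i using K[OF hp[OF that]] by auto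
      show "disjoint_family_on (\<lambda>i. {?u i<..<?v i}) {..<card p}"
        unfolding disjoint_family_on_def
      proof (intro ballI impI)
        fix i j assume ij: "i \<in> {..<card p}" "j \<in> {..<card p}" "i \<noteq> j"
        then have "h i \<noteq> h j" using h by (auto simp: bij_betw_def inj_on_def)
        moreover have "h i \<in> p" "h j \<in> p" using ij hp by auto
        ultimately show "{?u i<..<?v i} \<inter> {?u j<..<?v j} = {}"
          using division_ofD(5)[OF p(1)] K by simp
      qed
      have "(\<Sum>i<card p. ?v i - ?u i) = (\<Sum>K\<in>p. Sup K - Inf K)"
        by (rule sum.reindex_bij_betw[OF h])
      also have "\<dots> = sum content p" using content_Sup_Inf[OF p(1)] by simp
      finally show "(\<Sum>i<card p. ?v i - ?u i) < d" using p(3) by simp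
    qed
    also have "(\<Sum>i<card p. cmod (f (?v i) - f (?u i))) = (\<Sum>K\<in>p. cmod (f (Sup K) - f (Inf K)))"
      by (rule sum.reindex_bij_betw[OF h])
    finally show ?thesis .
  qed
  then show "\<exists>d>0. \<forall>p. p division_of \<Union> p \<and> \<Union> p \<subseteq> {a..b} \<and> sum content p < d \<longrightarrow>
               (\<Sum>K\<in>p. norm (f (Sup K) - f (Inf K))) < e" using d(1) by blast
qed

lemma AC_compose_contraction:
  assumes "AC a b f" "\<And>x y. norm (g (f x) - g (f y)) \<le> norm (f x - f y)"
  shows "AC a b (\<lambda>x. g (f x))"
  unfolding AC_def
proof (intro allI impI)
  fix e :: real assume "e > 0"
  with assms(1) have "\<exists>d>0. \<forall>p. p division_of \<Union> p \<and> \<Union> p \<subseteq> {a..b} \<and> sum content p < d \<longrightarrow>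
               (\<Sum>K\<in>p. norm (f (Sup K) - f (Inf K))) < e" unfolding AC_def by blast
  then obtain d where d: "d > 0" "\<forall>p. p division_of \<Union> p \<and> \<Union> p \<subseteq> {a..b} \<and> sum content p < d \<longrightarrow>
               (\<Sum>K\<in>p. norm (f (Sup K) - f (Inf K))) < e" by blast
  have "(\<Sum>K\<in>p. norm (g (f (Sup K)) - g (f (Inf K)))) \<le> (\<Sum>K\<in>p. norm (f (Sup K) - f (Inf K)))" for p
    by (rule sum_mono) (rule assms(2))
  then show "\<exists>d>0. \<forall>p. p division_of \<Union> p \<and> \<Union> p \<subseteq> {a..b} \<and> sum content p < d \<longrightarrow>
               (\<Sum>K\<in>p. norm (g (f (Sup K)) - g (f (Inf K)))) < e"
    using d by (meson le_less_trans)
qed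

lemma AC_complex_differentiable_ae:
  fixes f :: "real \<Rightarrow> complex"
  assumes "AC a b f"
  shows "negligible {x \<in> {a<..<b}. \<not> f differentiable (at x)}"
proof -
  have "AC a b (\<lambda>x. Re (f x))" "AC a b (\<lambda>x. Im (f x))"
    using abs_Re_le_cmod abs_Im_le_cmod
    by (auto intro!: AC_compose_contraction[OF assms] simp flip: minus_complex.sel)
  then have "negligible ({x \<in> {a<..<b}. \<not> (\<lambda>x. Re (f x)) differentiable (at x)} \<union>
     {x \<in> {a<..<b}. \<not> (\<lambda>x. Im (f x)) differentiable (at x)})"
    by (intro negligible_Un AC_differentiable_ae)
  then show ?thesis
  proof (rule negligible_subset)
    have "f differentiable (at x)" if di: "(\<lambda>x. Re (f x)) differentiable (at x)" "(\<lambda>x. Im (f x)) differentiable (at x)" for x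
    proof -
      obtain r i where "((\<lambda>x. Re (f x)) has_field_derivative r) (at x)" "((\<lambda>x. Im (f x)) has_field_derivative i) (at x)"
        using di unfolding real_differentiable_def by blast
      then have "(f has_vector_derivative Complex r i) (at x)"
        by (simp add: has_vector_derivative_complex_iff)
      then show ?thesis using differentiableI_vector by blast
    qed
    then show "{x \<in> {a<..<b}. \<not> f differentiable (at x)} \<subseteq> {x \<in> {a<..<b}. \<not> (\<lambda>x. Re (f x)) differentiable (at x)} \<union>
     {x \<in> {a<..<b}. \<not> (\<lambda>x. Im (f x)) differentiable (at x)}" by blast
  qed
qed

text \<open>The gauge distinguishes two kinds of tags. Outside \<open>N\<close> it is given by
  differentiability. On \<open>N\<close> it confines the intervals to an open \<open>V\<close> of
  measure below \<open>d\<close>; there the integrand is set to 0 and absolute continuity makes the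
  increments of \<open>f\<close> small. For this second kind continuity of \<open>f\<close> would
  not be enough, as the Cantor function shows.\<close>

theorem fundamental_theorem_of_calculus_AC:
  fixes f :: "real \<Rightarrow> 'a::banach"
  assumes ab: "a \<le> b" and ac: "AC a b f" and N: "negligible N"
    and der: "\<And>x. x \<in> {a..b} - N \<Longrightarrow> (f has_vector_derivative f' x) (at x within {a..b})"
  shows "(f' has_integral (f b - f a)) {a..b}"
proof (rule has_integral_spike[OF N])
  define g where "g x = (if x \<in> N then 0 else f' x)" for x
  show "f' x = g x" if "x \<in> {a..b} - N" for x using that by (simp add: g_def)
  show "(g has_integral (f b - f a)) {a..b}"
    unfolding has_integral_real
  proof (intro allI impI)
    fix e :: real assume e: "e > 0"
    define e1 where "e1 = e / 4"
    \<comment> \<open>The \<open>+ 1\<close> keeps the denominator positive when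
      \<open>a = b\<close>.\<close>
    define e2 where "e2 = e / (4 * (b - a + 1))"
    have e12: "e1 > 0" "e2 > 0" using e ab by (auto simp: e1_def e2_def)
    have "\<exists>d>0. \<forall>p. p division_of \<Union> p \<and> \<Union> p \<subseteq> {a..b} \<and> sum content p < d \<longrightarrow>
               (\<Sum>K\<in>p. norm (f (Sup K) - f (Inf K))) < e1" using ac e12 unfolding AC_def by blast
    then obtain d where d: "d > 0" "\<forall>p. p division_of \<Union> p \<and> \<Union> p \<subseteq> {a..b} \<and> sum content p < d \<longrightarrow>
               (\<Sum>K\<in>p. norm (f (Sup K) - f (Inf K))) < e1" by blast
    have "N \<in> sets lebesgue" using N by (simp add: negligible_iff_null_sets null_setsD2)
    then obtain V where V: "open V" "N \<subseteq> V" "V - N \<in> lmeasurable" "emeasure lebesgue (V - N) < ennreal d"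
      using sets_lebesgue_outer_open[of N d] d(1) by blast
    have Vm: "V \<in> lmeasurable" "measure lebesgue V < d"
    proof -
      have Vu: "V = N \<union> (V - N)" using V(2) by blast
      have Nm: "N \<in> lmeasurable" using N by (rule negligible_imp_measurable)
      show "V \<in> lmeasurable" using fmeasurable.Un[OF Nm V(3)] Vu by simp
      have "measure lebesgue V \<le> measure lebesgue N + measure lebesgue (V - N)"
        by (subst Vu, rule measure_Un_le) (use Nm V(3) in blast)+
      also have "measure lebesgue N = 0" using N by (rule negligible_imp_measure0)
      also have "measure lebesgue (V - N) < d"
        using V(3,4) d(1) by (simp add: emeasure_eq_measure2 ennreal_less_iff)
      finally show "measure lebesgue V < d" by simp
    qed
    have "\<forall>x. \<exists>r>0. x \<in> {a..b} - N \<longrightarrow>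
         (\<forall>y\<in>{a..b}. norm (y-x) < r \<longrightarrow> norm (f y - f x - (y-x) *\<^sub>R f' x) \<le> e2 * norm (y-x))"
    proof
      fix x
      show "\<exists>r>0. x \<in> {a..b} - N \<longrightarrow>
         (\<forall>y\<in>{a..b}. norm (y-x) < r \<longrightarrow> norm (f y - f x - (y-x) *\<^sub>R f' x) \<le> e2 * norm (y-x))"
      proof (cases "x \<in> {a..b} - N")
        case True
        from der[OF this] show ?thesis
          unfolding has_vector_derivative_def has_derivative_within_alt using e12(2) by blast
      next
        case False then show ?thesis using zero_less_one by blast
      qed
    qed
    then obtain r where "\<forall>x. r x > 0 \<and> (x \<in> {a..b} - N \<longrightarrow>
         (\<forall>y\<in>{a..b}. norm (y-x) < r x \<longrightarrow> norm (f y - f x - (y-x) *\<^sub>R f' x) \<le> e2 * norm (y-x)))"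
      by (rule choice[THEN exE])
    then have r0: "r x > 0" and r: "\<lbrakk>x \<in> {a..b} - N; y \<in> {a..b}; norm (y-x) < r x\<rbrakk>
        \<Longrightarrow> norm (f y - f x - (y-x) *\<^sub>R f' x) \<le> e2 * norm (y-x)" for x y
      by auto
    define \<gamma> where "\<gamma> x = (if x \<in> N then V else ball x (r x))" for x
    have gg: "gauge \<gamma>" using V(1,2) r0 by (auto simp: gauge_def \<gamma>_def)
    have pf: "norm ((\<Sum>(x,K)\<in>p. content K *\<^sub>R g x) - (f b - f a)) < e"
      if p: "p tagged_division_of {a..b}" "\<gamma> fine p" for p
    proof -
      have fp: "finite p" using p(1) by auto
      have pK: "\<exists>u v. K = {u..v} \<and> u \<le> v \<and> x \<in> K \<and> K \<subseteq> {a..b}" if xK: "(x,K) \<in> p" for x K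
      proof -
        have "x \<in> K" "K \<subseteq> {a..b}" using p(1) xK by blast+
        moreover obtain u v where "K = cbox u v" using p(1) xK by blast
        ultimately show ?thesis by auto
      qed
      define pN where "pN = {z \<in> p. fst z \<in> N}"
      let ?t = "\<lambda>(x,K). content K *\<^sub>R g x - (f (Sup K) - f (Inf K))"
      have tele: "(\<Sum>(x,K)\<in>p. f (Sup K) - f (Inf K)) = f b - f a"
        by (rule additive_tagged_division_1[OF ab p(1)])
      have "(\<Sum>(x,K)\<in>p. content K *\<^sub>R g x) - (f b - f a) = sum ?t p"
        unfolding tele[symmetric] by (simp add: sum_subtractf[symmetric] case_prod_unfold)
      also have "\<dots> = sum ?t (p - pN) + sum ?t pN"
        by (rule sum.subset_diff) (auto simp: pN_def fp)
      finally have eq: "(\<Sum>(x,K)\<in>p. content K *\<^sub>R g x) - (f b - f a) = sum ?t (p - pN) + sum ?t pN" .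
      have "norm (sum ?t (p - pN)) \<le> (\<Sum>z\<in>p - pN. e2 * content (snd z))"
      proof (rule sum_norm_le)
        fix z assume z: "z \<in> p - pN"
        obtain x K where zx: "z = (x,K)" by (cases z)
        have xN: "x \<notin> N" "(x,K) \<in> p" using z zx by (auto simp: pN_def)
        obtain u v where K: "K = {u..v}" "u \<le> v" "x \<in> K" "K \<subseteq> {a..b}" using pK[OF xN(2)] by blast
        have uv: "u \<in> K" "v \<in> K" using K by auto
        have "K \<subseteq> \<gamma> x" using p(2) xN(2) by blast
        then have "K \<subseteq> ball x (r x)" using xN(1) by (simp add: \<gamma>_def)
        then have nu: "norm (u - x) < r x" and nv: "norm (v - x) < r x"
          using uv by (auto simp: dist_real_def subset_eq)
        have xm: "x \<in> {a..b} - N" using K xN by blast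
        \<comment> \<open>Straddle estimate: \<open>x\<close> lies between \<open>u\<close> and
          \<open>v\<close>, so the distances in the two error terms add up to
          \<open>v - u\<close>.\<close>
        have "norm ((v - u) *\<^sub>R f' x - (f v - f u)) = norm (f u - f x - (u - x) *\<^sub>R f' x - (f v - f x - (v - x) *\<^sub>R f' x))"
          by (auto simp: algebra_simps)
        also have "\<dots> \<le> norm (f u - f x - (u - x) *\<^sub>R f' x) + norm (f v - f x - (v - x) *\<^sub>R f' x)"
          by (rule norm_triangle_ineq4)
        also have "\<dots> \<le> e2 * norm (u - x) + e2 * norm (v - x)"
          by (intro add_mono r xm nu nv) (use uv K in auto)
        also have "\<dots> = e2 * (v - u)" using K by (auto simp: algebra_simps)
        finally show "norm (?t z) \<le> e2 * content (snd z)"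
          using K xN by (simp add: zx g_def)
      qed
      also have "\<dots> \<le> (\<Sum>z\<in>p. e2 * content (snd z))"
        by (rule sum_mono2) (use fp e12 in auto)
      also have "\<dots> = e2 * (\<Sum>(x,K)\<in>p. content K)" by (simp add: sum_distrib_left case_prod_unfold)
      also have "\<dots> = e2 * (b - a)"
        using additive_content_tagged_division[of p a b] p(1) ab by simp
      also have "\<dots> \<le> e2 * (b - a + 1)" using e12 by simp
      also have "\<dots> = e / 4" 
      proof -
        have "c > 0 \<Longrightarrow> e / (4 * c) * c = e / 4" for c :: real by simp
        from this[of "b - a + 1"] ab show ?thesis unfolding e2_def by linarith
      qed
      also have "\<dots> < e / 2" using e by simp
      finally have A: "norm (sum ?t (p - pN)) < e / 2" .
      have B: "norm (sum ?t pN) < e1"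
      proof -
        have pNp: "pN tagged_partial_division_of {a..b}"
          using tagged_partial_division_subset[of p "{a..b}" pN] p(1)
          by (auto simp: pN_def tagged_division_of_def)
        define q where "q = {K \<in> snd ` pN. interior K \<noteq> {}}"
        have qdiv: "q division_of \<Union>q"
          using division_of_subset[OF partial_division_of_tagged_division[OF pNp], of q] by (auto simp: q_def)
        have qab: "\<Union>q \<subseteq> {a..b}" using pK by (fastforce simp: q_def pN_def)
        have qV: "\<Union>q \<subseteq> V" using p(2) by (fastforce simp: q_def pN_def fine_def \<gamma>_def)
        have "sum content q = measure lebesgue (\<Union>q)" using measure_division[OF qdiv] by simp
        also have "\<dots> \<le> measure lebesgue V"
          by (rule measure_mono_fmeasurable) (use qV Vm lmeasurable_division[OF qdiv] in auto)
        finally have "sum content q < d" using Vm by simp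
        then have q1: "(\<Sum>K\<in>q. norm (f (Sup K) - f (Inf K))) < e1" using d(2) qdiv qab by blast
        \<comment> \<open>Vanishing on degenerate intervals is the condition under which a sum over
          tagged intervals may be rewritten as a sum over the intervals.\<close>
        define \<iota> where "\<iota> K = (if interior K = {} then 0 else norm (f (Sup K) - f (Inf K)))" for K
        have "norm (sum ?t pN) \<le> (\<Sum>z\<in>pN. case z of (x, K) \<Rightarrow> \<iota> K)"
        proof (rule sum_norm_le)
          fix z assume z: "z \<in> pN"
          obtain x K where zx: "z = (x,K)" by (cases z)
          then have xK: "(x,K) \<in> p" "x \<in> N" using z by (auto simp: pN_def)
          obtain u v where K: "K = {u..v}" "u \<le> v" using pK[OF xK(1)] by blast
          have "f (Sup K) - f (Inf K) = 0" if "interior K = {}" using that K by simp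
          then show "norm (?t z) \<le> (case z of (x, K) \<Rightarrow> \<iota> K)"
            using xK(2) by (auto simp: zx g_def \<iota>_def norm_minus_commute)
        qed
        also have "\<dots> = sum \<iota> (snd ` pN)"
          by (rule sum.over_tagged_division_lemma[OF tagged_partial_division_of_Union_self[OF pNp]])
            (simp add: \<iota>_def interior_cbox del: box_real)
        also have "\<dots> = (\<Sum>K\<in>q. norm (f (Sup K) - f (Inf K)))"
          by (rule sum.mono_neutral_cong_right) (use fp in \<open>auto simp: q_def \<iota>_def pN_def\<close>)
        finally show ?thesis using q1 by simp
      qed
      show ?thesis unfolding eq using A B norm_triangle_ineq[of "sum ?t (p - pN)" "sum ?t pN"] e by (simp add: e1_def)
    qed
    show "\<exists>\<gamma>. gauge \<gamma> \<and> (\<forall>\<D>. \<D> tagged_division_of {a..b} \<and> \<gamma> fine \<D> \<longrightarrow>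
        norm ((\<Sum>(x, k)\<in>\<D>. content k *\<^sub>R g x) - (f b - f a)) < e)"
      by (intro exI[of _ \<gamma>] conjI gg allI impI) (elim conjE, rule pf)
  qed
qed


section \<open>Regular functions on the half-line\<close>

lemma abs_cont_onE:
  assumes "abs_cont_on a b f" "e > 0"
  obtains d where "d > 0"
    "\<forall>(n::nat) u v. (\<forall>i<n. a \<le> u i \<and> u i \<le> v i \<and> v i \<le> b) \<and>
        disjoint_family_on (\<lambda>i. {u i<..<v i}) {..<n} \<and> (\<Sum>i<n. v i - u i) < d
        \<longrightarrow> (\<Sum>i<n. cmod (f (v i) - f (u i))) < e"
  using assms unfolding abs_cont_on_def by blast

lemma abs_cont_on_continuous:
  assumes "abs_cont_on a b f"
  shows "continuous_on {a..b} f"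
  unfolding continuous_on_iff
proof (intro ballI allI impI)
  fix x e :: real assume x: "x \<in> {a..b}" and e: "e > 0"
  obtain d where d: "d > 0"
    "\<forall>(n::nat) u v. (\<forall>i<n. a \<le> u i \<and> u i \<le> v i \<and> v i \<le> b) \<and>
        disjoint_family_on (\<lambda>i. {u i<..<v i}) {..<n} \<and> (\<Sum>i<n. v i - u i) < d
        \<longrightarrow> (\<Sum>i<n. cmod (f (v i) - f (u i))) < e"
    by (rule abs_cont_onE[OF assms e])
  have "dist (f y) (f x) < e" if y: "y \<in> {a..b}" "dist y x < d" for y
  proof -
    have "(\<Sum>i<1. cmod (f ((\<lambda>_::nat. max x y) i) - f ((\<lambda>_. min x y) i))) < e"
      by (rule d(2)[rule_format]) (use x y in \<open>auto simp: disjoint_family_on_def dist_real_def\<close>)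
    then show ?thesis by (auto simp: dist_norm max_def min_def norm_minus_commute split: if_splits)
  qed
  then show "\<exists>d>0. \<forall>x'\<in>{a..b}. dist x' x < d \<longrightarrow> dist (f x') (f x) < e" using d(1) by blast
qed

text \<open>Common source of closure under sums, products and conjugation, and of the Lipschitz
  criterion. The choice of \<open>e'\<close> with \<open>M + 1\<close> admits \<open>M = 0\<close>,
  which constants use.\<close>

lemma abs_cont_on_increment_bound:
  assumes f: "abs_cont_on a b f" and g: "abs_cont_on a b g" and M: "M \<ge> 0"
    and bound: "\<And>x y. \<lbrakk>x \<in> {a..b}; y \<in> {a..b}\<rbrakk> \<Longrightarrow> cmod (h y - h x) \<le> M * (cmod (f y - f x) + cmod (g y - g x))"
  shows "abs_cont_on a b h"
  unfolding abs_cont_on_def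
proof (intro allI impI)
  fix e :: real assume e: "e > 0"
  define e' where "e' = e / (2 * (M + 1))"
  have e': "e' > 0" using e M by (simp add: e'_def)
  obtain d1 where d1: "d1 > 0"
    "\<forall>(n::nat) u v. (\<forall>i<n. a \<le> u i \<and> u i \<le> v i \<and> v i \<le> b) \<and>
        disjoint_family_on (\<lambda>i. {u i<..<v i}) {..<n} \<and> (\<Sum>i<n. v i - u i) < d1
        \<longrightarrow> (\<Sum>i<n. cmod (f (v i) - f (u i))) < e'"
    by (rule abs_cont_onE[OF f e'])
  obtain d2 where d2: "d2 > 0"
    "\<forall>(n::nat) u v. (\<forall>i<n. a \<le> u i \<and> u i \<le> v i \<and> v i \<le> b) \<and>
        disjoint_family_on (\<lambda>i. {u i<..<v i}) {..<n} \<and> (\<Sum>i<n. v i - u i) < d2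
        \<longrightarrow> (\<Sum>i<n. cmod (g (v i) - g (u i))) < e'"
    by (rule abs_cont_onE[OF g e'])
  show "\<exists>d>0. \<forall>(n::nat) u v. (\<forall>i<n. a \<le> u i \<and> u i \<le> v i \<and> v i \<le> b) \<and>
        disjoint_family_on (\<lambda>i. {u i<..<v i}) {..<n} \<and> (\<Sum>i<n. v i - u i) < d
        \<longrightarrow> (\<Sum>i<n. cmod (h (v i) - h (u i))) < e"
  proof (intro exI[of _ "min d1 d2"] conjI allI impI)
    show "min d1 d2 > 0" using d1 d2 by simp
    fix n :: nat and u v :: "nat \<Rightarrow> real"
    assume H: "(\<forall>i<n. a \<le> u i \<and> u i \<le> v i \<and> v i \<le> b) \<and>
        disjoint_family_on (\<lambda>i. {u i<..<v i}) {..<n} \<and> (\<Sum>i<n. v i - u i) < min d1 d2"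
    have 1: "(\<Sum>i<n. cmod (f (v i) - f (u i))) < e'" by (rule d1(2)[rule_format]) (use H in auto)
    have 2: "(\<Sum>i<n. cmod (g (v i) - g (u i))) < e'" by (rule d2(2)[rule_format]) (use H in auto)
    have "(\<Sum>i<n. cmod (h (v i) - h (u i))) \<le> (\<Sum>i<n. M * (cmod (f (v i) - f (u i)) + cmod (g (v i) - g (u i))))"
    proof (rule sum_mono)
      fix i assume "i \<in> {..<n}"
      then have "a \<le> u i" "u i \<le> v i" "v i \<le> b" using H by auto
      then show "cmod (h (v i) - h (u i)) \<le> M * (cmod (f (v i) - f (u i)) + cmod (g (v i) - g (u i)))"
        by (intro bound) auto
    qed
    also have "\<dots> = M * ((\<Sum>i<n. cmod (f (v i) - f (u i))) + (\<Sum>i<n. cmod (g (v i) - g (u i))))"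
      by (simp only: sum_distrib_left[symmetric] sum.distrib)
    also have "\<dots> \<le> M * (2 * e')" by (rule mult_left_mono) (use 1 2 M in auto)
    also have "\<dots> < (M + 1) * (2 * e')" using e' by simp
    also have "\<dots> = e" using M by (simp add: e'_def field_simps)
    finally show "(\<Sum>i<n. cmod (h (v i) - h (u i))) < e" .
  qed
qed

lemma abs_cont_on_bounded:
  assumes "abs_cont_on a b f"
  obtains B where "B > 0" "\<And>x. x \<in> {a..b} \<Longrightarrow> cmod (f x) \<le> B"
proof -
  have "bounded (f ` {a..b})"
    by (intro compact_imp_bounded compact_continuous_image abs_cont_on_continuous[OF assms]) simp
  then show thesis using that by (auto simp: bounded_pos)
qed

lemma abs_cont_on_ident: "abs_cont_on a b complex_of_real"
  unfolding abs_cont_on_def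
proof (intro allI impI)
  fix e :: real assume e: "e > 0"
  have "(\<Sum>i<n. cmod (complex_of_real (v i) - complex_of_real (u i))) = (\<Sum>i<n. v i - u i)"
    if "\<forall>i<n. a \<le> u i \<and> u i \<le> v i \<and> v i \<le> b" for n :: nat and u v
    by (rule sum.cong) (use that in \<open>auto simp flip: of_real_diff\<close>)
  then show "\<exists>d>0. \<forall>(n::nat) u v. (\<forall>i<n. a \<le> u i \<and> u i \<le> v i \<and> v i \<le> b) \<and>
        disjoint_family_on (\<lambda>i. {u i<..<v i}) {..<n} \<and> (\<Sum>i<n. v i - u i) < d
        \<longrightarrow> (\<Sum>i<n. cmod (complex_of_real (v i) - complex_of_real (u i))) < e"
    using e by (intro exI[of _ e]) auto
qed

lemma abs_cont_on_lipschitz: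
  assumes "M \<ge> 0" "\<And>x y. \<lbrakk>x \<in> {a..b}; y \<in> {a..b}\<rbrakk> \<Longrightarrow> cmod (h y - h x) \<le> M * \<bar>y - x\<bar>"
  shows "abs_cont_on a b h"
proof (rule abs_cont_on_increment_bound[OF abs_cont_on_ident abs_cont_on_ident assms(1)])
  fix x y assume xy: "x \<in> {a..b}" "y \<in> {a..b}"
  have "M * \<bar>y - x\<bar> \<le> M * (\<bar>y - x\<bar> + \<bar>y - x\<bar>)" using assms(1) by (intro mult_left_mono) auto
  then show "cmod (h y - h x) \<le> M * (cmod (complex_of_real y - complex_of_real x) + cmod (complex_of_real y - complex_of_real x))"
    using assms(2)[OF xy] by (simp flip: of_real_diff)
qed

lemma abs_cont_on_mult:
  assumes f: "abs_cont_on a b f" and g: "abs_cont_on a b g"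
  shows "abs_cont_on a b (\<lambda>x. f x * g x)"
proof -
  obtain B where B: "B > 0" "\<And>x. x \<in> {a..b} \<Longrightarrow> cmod (f x) \<le> B" using abs_cont_on_bounded[OF f] by blast
  obtain C where C: "C > 0" "\<And>x. x \<in> {a..b} \<Longrightarrow> cmod (g x) \<le> C" using abs_cont_on_bounded[OF g] by blast
  show ?thesis
  proof (rule abs_cont_on_increment_bound[OF f g, of "B + C"])
    show "B + C \<ge> 0" using B C by simp
    fix x y assume xy: "x \<in> {a..b}" "y \<in> {a..b}"
    have "f y * g y - f x * g x = f y * (g y - g x) + (f y - f x) * g x" by (simp add: algebra_simps)
    then have "cmod (f y * g y - f x * g x) \<le> cmod (f y) * cmod (g y - g x) + cmod (f y - f x) * cmod (g x)"
      by (metis norm_mult norm_triangle_ineq)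
    also have "\<dots> \<le> B * cmod (g y - g x) + cmod (f y - f x) * C"
      by (intro add_mono mult_right_mono mult_left_mono B C xy) auto
    also have "\<dots> \<le> (B + C) * (cmod (f y - f x) + cmod (g y - g x))"
      using B(1) C(1) by (simp add: algebra_simps)
    finally show "cmod (f y * g y - f x * g x) \<le> (B + C) * (cmod (f y - f x) + cmod (g y - g x))" .
  qed
qed

lemma abs_cont_on_const: "abs_cont_on a b (\<lambda>_. c)"
  by (rule abs_cont_on_lipschitz[of 0]) auto

lemma abs_cont_on_add:
  assumes f: "abs_cont_on a b f" and g: "abs_cont_on a b g"
  shows "abs_cont_on a b (\<lambda>x. f x + g x)"
proof (rule abs_cont_on_increment_bound[OF f g zero_le_one])
  fix x y
  have "f y + g y - (f x + g x) = (f y - f x) + (g y - g x)" by simp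
  then show "cmod (f y + g y - (f x + g x)) \<le> 1 * (cmod (f y - f x) + cmod (g y - g x))"
    by (metis mult_1 norm_triangle_ineq)
qed

lemma abs_cont_on_cnj:
  assumes f: "abs_cont_on a b f"
  shows "abs_cont_on a b (\<lambda>x. cnj (f x))"
proof (rule abs_cont_on_increment_bound[OF f f zero_le_one])
  show "cmod (cnj (f y) - cnj (f x)) \<le> 1 * (cmod (f y - f x) + cmod (f y - f x))" for x y
    by (simp flip: complex_cnj_diff)
qed

lemma abs_cont_on_cong:
  assumes f: "abs_cont_on a b f" "\<And>x. x \<in> {a..b} \<Longrightarrow> g x = f x"
  shows "abs_cont_on a b g"
  by (rule abs_cont_on_increment_bound[OF f(1) f(1) zero_le_one]) (simp add: f(2))

lemma loc_abs_cont_algebra: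
  "loc_abs_cont a f \<Longrightarrow> loc_abs_cont a g \<Longrightarrow> loc_abs_cont a (\<lambda>x. f x + g x)"
  "loc_abs_cont a f \<Longrightarrow> loc_abs_cont a g \<Longrightarrow> loc_abs_cont a (\<lambda>x. f x * g x)"
  "loc_abs_cont a f \<Longrightarrow> loc_abs_cont a (\<lambda>x. cnj (f x))"
  "loc_abs_cont a (\<lambda>x. c)"
  by (simp_all add: loc_abs_cont_def abs_cont_on_add abs_cont_on_mult abs_cont_on_cnj abs_cont_on_const)

lemma loc_abs_cont_cong:
  assumes "loc_abs_cont a f" "\<And>x. x \<ge> a \<Longrightarrow> g x = f x"
  shows "loc_abs_cont a g"
  unfolding loc_abs_cont_def
proof (intro allI impI)
  fix b assume "b > a"
  then have "abs_cont_on a b f" using assms(1) by (simp add: loc_abs_cont_def)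
  then show "abs_cont_on a b g" by (rule abs_cont_on_cong) (use assms(2) in simp)
qed

lemma loc_abs_cont_continuous:
  assumes "loc_abs_cont a f"
  shows "continuous_on {a..} f"
  unfolding continuous_on_eq_continuous_within
proof
  fix x assume x: "x \<in> {a..}"
  have "continuous_on {a..x+1} f"
    using assms x by (intro abs_cont_on_continuous) (simp add: loc_abs_cont_def)
  then have "continuous (at x within {a..x+1}) f" using x by (simp add: continuous_on_eq_continuous_within)
  moreover have "at x within {a..x+1} = at x within {a..}"
  proof (rule at_within_nhd)
    show "open {..<x+1}" "x \<in> {..<x+1}" by auto
    show "{a..x+1} \<inter> {..<x+1} - {x} = {a..} \<inter> {..<x+1} - {x}" by auto
  qed
  ultimately show "continuous (at x within {a..}) f" by simp
qed

lemma AE_half_line: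
  "(AE x in lebesgue_on {a..}. P x) \<longleftrightarrow> (\<exists>N. negligible N \<and> (\<forall>x. x \<ge> a \<and> x \<notin> N \<longrightarrow> P x))" for a :: real
proof -
  have "(AE x in lebesgue_on {a..}. P x) \<longleftrightarrow> (AE x in lebesgue. x \<in> {a..} \<longrightarrow> P x)"
    by (rule AE_restrict_space_iff) simp
  also have "\<dots> \<longleftrightarrow> (\<exists>N. negligible N \<and> {x. \<not> (x \<in> {a..} \<longrightarrow> P x)} \<subseteq> N)"
    by (rule eventually_ae_filter_negligible)
  also have "\<dots> \<longleftrightarrow> (\<exists>N. negligible N \<and> (\<forall>x. x \<ge> a \<and> x \<notin> N \<longrightarrow> P x))" by (intro ex_cong) auto
  finally show ?thesis .
qed

lemma loc_abs_cont_differentiable_ae: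
  assumes "loc_abs_cont a f"
  shows "AE x in lebesgue_on {a..}. (f has_vector_derivative D a f x) (at x within {a..})"
  unfolding AE_half_line
proof (intro exI conjI allI impI)
  let ?N = "\<lambda>n::nat. {x \<in> {a<..<a + real (Suc n)}. \<not> f differentiable (at x)}"
  show "negligible ((\<Union>n. ?N n) \<union> {a})"
  proof (intro negligible_Un negligible_Union_nat)
    fix n show "negligible (?N n)"
      by (rule AC_complex_differentiable_ae[OF abs_cont_on_AC]) (use assms in \<open>auto simp: loc_abs_cont_def\<close>)
  qed auto
  fix x assume x: "x \<ge> a \<and> x \<notin> (\<Union>n. ?N n) \<union> {a}"
  obtain n where "x - a < real n" by (rule reals_Archimedean2[THEN exE])
  moreover have "a < x" using x by (simp add: less_le)
  ultimately have "x \<in> {a<..<a + real (Suc n)}" by simp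
  moreover have "x \<notin> ?N n" using x by blast
  ultimately have "f differentiable (at x)" by blast
  then have "f differentiable (at x within {a..})" by (rule differentiable_at_withinI)
  then show "(f has_vector_derivative D a f x) (at x within {a..})"
    unfolding D_def by (simp add: vector_derivative_works)
qed

lemma half_line_not_trivial:
  fixes a x :: real
  assumes "x \<ge> a"
  shows "at x within {a..} \<noteq> bot"
proof -
  have "x islimpt {x<..<x+1}" by (rule islimpt_greaterThanLessThan1) simp
  then have "x islimpt {a..}" by (rule islimpt_subset) (use assms in auto)
  then show ?thesis by (simp add: trivial_limit_within)
qed

lemma D_eqI:
  assumes "(y has_vector_derivative d) (at x within {a..})" "x \<ge> a"
  shows "D a y x = d"
  unfolding D_def by (rule vector_derivative_within[OF half_line_not_trivial[OF assms(2)] assms(1)])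

lemma regular_has_derivative:
  assumes "y \<in> regular a" "x \<ge> a"
  shows "(y has_vector_derivative D a y x) (at x within {a..})"
  using assms unfolding regular_def D_def by (simp add: vector_derivative_works)

lemma regular_second_derivative_ae:
  assumes "y \<in> regular a"
  shows "AE x in lebesgue_on {a..}. (D a y has_vector_derivative D a (D a y) x) (at x within {a..})"
  using assms by (intro loc_abs_cont_differentiable_ae) (simp add: regular_def)

lemma regularI:
  assumes "\<And>x. x \<ge> a \<Longrightarrow> (y has_vector_derivative d x) (at x within {a..})"
    and "loc_abs_cont a y" "loc_abs_cont a d"
  shows "y \<in> regular a" "\<And>x. x \<ge> a \<Longrightarrow> D a y x = d x"
proof -
  show D: "D a y x = d x" if "x \<ge> a" for x using D_eqI[OF assms(1)] that by blast
  have "loc_abs_cont a (D a y)" by (rule loc_abs_cont_cong[OF assms(3) D])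
  moreover have "y differentiable (at x within {a..})" if "x \<ge> a" for x
    using assms(1)[OF that] by (rule differentiableI_vector)
  ultimately show "y \<in> regular a" using assms(2) by (simp add: regular_def)
qed

lemma has_vector_derivative_eq_on_half_line:
  assumes "(f has_vector_derivative d) (at x within {a..})" "x \<ge> a" "\<And>x. x \<ge> a \<Longrightarrow> g x = f x"
  shows "(g has_vector_derivative d) (at x within {a..})"
  by (rule has_vector_derivative_transform[OF _ _ assms(1)]) (use assms in auto)

lemma regular_mult:
  assumes f: "f \<in> regular a" and g: "g \<in> regular a"
  shows "(\<lambda>x. f x * g x) \<in> regular a"
    and "\<And>x. x \<ge> a \<Longrightarrow> D a (\<lambda>x. f x * g x) x = f x * D a g x + D a f x * g x"
    and "AE x in lebesgue_on {a..}. D a (D a (\<lambda>x. f x * g x)) x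
           = f x * D a (D a g) x + 2 * D a f x * D a g x + D a (D a f) x * g x"
proof -
  let ?d = "\<lambda>x. f x * D a g x + D a f x * g x"
  have lac: "loc_abs_cont a f" "loc_abs_cont a g" "loc_abs_cont a (D a f)" "loc_abs_cont a (D a g)"
    using f g by (auto simp: regular_def)
  have d1: "((\<lambda>x. f x * g x) has_vector_derivative ?d x) (at x within {a..})" if "x \<ge> a" for x
    by (rule has_vector_derivative_mult) (use that f g regular_has_derivative in blast)+
  have lacd: "loc_abs_cont a (\<lambda>x. f x * g x)" "loc_abs_cont a ?d"
    by (intro loc_abs_cont_algebra lac)+
  note R = regularI[OF d1 lacd]
  show "(\<lambda>x. f x * g x) \<in> regular a" by (rule R(1))
  show D: "D a (\<lambda>x. f x * g x) x = ?d x" if "x \<ge> a" for x by (rule R(2)[OF _ that])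
  show "AE x in lebesgue_on {a..}. D a (D a (\<lambda>x. f x * g x)) x
           = f x * D a (D a g) x + 2 * D a f x * D a g x + D a (D a f) x * g x"
    using regular_second_derivative_ae[OF f] regular_second_derivative_ae[OF g] AE_space
  proof eventually_elim
    case (elim x)
    then have x: "x \<ge> a" by simp
    have "(?d has_vector_derivative ((f x * D a (D a g) x + D a f x * D a g x)
        + (D a f x * D a g x + D a (D a f) x * g x))) (at x within {a..})"
      by (intro has_vector_derivative_add has_vector_derivative_mult elim regular_has_derivative f g x)
    then have "(D a (\<lambda>x. f x * g x) has_vector_derivative ((f x * D a (D a g) x + D a f x * D a g x)
        + (D a f x * D a g x + D a (D a f) x * g x))) (at x within {a..})"
      by (rule has_vector_derivative_eq_on_half_line[OF _ x D])
    from D_eqI[OF this x] show ?case by (simp add: algebra_simps)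
  qed
qed

lemma regular_add:
  assumes f: "f \<in> regular a" and g: "g \<in> regular a"
  shows "(\<lambda>x. f x + g x) \<in> regular a"
    and "\<And>x. x \<ge> a \<Longrightarrow> D a (\<lambda>x. f x + g x) x = D a f x + D a g x"
    and "AE x in lebesgue_on {a..}. D a (D a (\<lambda>x. f x + g x)) x = D a (D a f) x + D a (D a g) x"
proof -
  let ?d = "\<lambda>x. D a f x + D a g x"
  have lac: "loc_abs_cont a f" "loc_abs_cont a g" "loc_abs_cont a (D a f)" "loc_abs_cont a (D a g)"
    using f g by (auto simp: regular_def)
  have d1: "((\<lambda>x. f x + g x) has_vector_derivative ?d x) (at x within {a..})" if "x \<ge> a" for x
    by (rule has_vector_derivative_add) (use that f g regular_has_derivative in blast)+
  have lacd: "loc_abs_cont a (\<lambda>x. f x + g x)" "loc_abs_cont a ?d"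
    by (intro loc_abs_cont_algebra lac)+
  note R = regularI[OF d1 lacd]
  show "(\<lambda>x. f x + g x) \<in> regular a" by (rule R(1))
  show D: "D a (\<lambda>x. f x + g x) x = ?d x" if "x \<ge> a" for x by (rule R(2)[OF _ that])
  show "AE x in lebesgue_on {a..}. D a (D a (\<lambda>x. f x + g x)) x = D a (D a f) x + D a (D a g) x"
    using regular_second_derivative_ae[OF f] regular_second_derivative_ae[OF g] AE_space
  proof eventually_elim
    case (elim x)
    then have x: "x \<ge> a" by simp
    have "(?d has_vector_derivative (D a (D a f) x + D a (D a g) x)) (at x within {a..})"
      by (intro has_vector_derivative_add elim)
    then have "(D a (\<lambda>x. f x + g x) has_vector_derivative (D a (D a f) x + D a (D a g) x)) (at x within {a..})"
      by (rule has_vector_derivative_eq_on_half_line[OF _ x D])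
    from D_eqI[OF this x] show ?case .
  qed
qed

lemma regular_const:
  "(\<lambda>_. c) \<in> regular a" "\<And>x. x \<ge> a \<Longrightarrow> D a (\<lambda>_. c) x = 0" "\<And>x. x \<ge> a \<Longrightarrow> D a (D a (\<lambda>_. c)) x = 0"
proof -
  have lac: "loc_abs_cont a (\<lambda>_. c)" for c by (simp add: loc_abs_cont_def abs_cont_on_const)
  note R = regularI[of a "\<lambda>_. c" "\<lambda>_. 0", OF has_vector_derivative_const lac lac]
  show "(\<lambda>_. c) \<in> regular a" by (rule R(1))
  show D: "D a (\<lambda>_. c) x = 0" if "x \<ge> a" for x by (rule R(2)[OF that])
  show "D a (D a (\<lambda>_. c)) x = 0" if "x \<ge> a" for x
    by (rule D_eqI[OF has_vector_derivative_eq_on_half_line[OF has_vector_derivative_const _ D]]) (use that in simp_all)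
qed

lemma regular_cmult:
  assumes f: "f \<in> regular a"
  shows "(\<lambda>x. c * f x) \<in> regular a"
    and "\<And>x. x \<ge> a \<Longrightarrow> D a (\<lambda>x. c * f x) x = c * D a f x"
    and "AE x in lebesgue_on {a..}. D a (D a (\<lambda>x. c * f x)) x = c * D a (D a f) x"
proof -
  note R = regular_mult[OF regular_const(1)[of c a] f]
  show "(\<lambda>x. c * f x) \<in> regular a" by (rule R(1))
  show "D a (\<lambda>x. c * f x) x = c * D a f x" if "x \<ge> a" for x
    using R(2)[OF that] regular_const(2)[OF that] by simp
  show "AE x in lebesgue_on {a..}. D a (D a (\<lambda>x. c * f x)) x = c * D a (D a f) x"
    using R(3) AE_space
  proof eventually_elim
    case (elim x)
    then have "x \<ge> a" by simp
    then show ?case using elim(1) regular_const(2,3)[of a x c] by simp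
  qed
qed


section \<open>The maximal domain and Green's formula\<close>

text \<open>Holds because Lebesgue measure is complete. It is wanted because \<open>l a q y\<close>
  has arbitrary values where the second derivative fails to exist, so its measurability is inherited
  from an explicit almost everywhere expression.\<close>

lemma half_line_borel_measurable_AE:
  fixes f g :: "real \<Rightarrow> complex"
  assumes "f \<in> borel_measurable (lebesgue_on {a..})" "AE x in lebesgue_on {a..}. g x = f x"
  shows "g \<in> borel_measurable (lebesgue_on {a..})"
proof -
  have S: "{a..} \<in> sets lebesgue" by simp
  have ae: "AE x in lebesgue. x \<in> {a..} \<longrightarrow> g x = f x"
    using assms(2) by (subst (asm) AE_restrict_space_iff) auto
  have "(\<lambda>x. if x \<in> {a..} then f x else 0) \<in> borel_measurable lebesgue"
    using assms(1) borel_measurable_if[OF S] by blast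
  then have "(\<lambda>x. if x \<in> {a..} then g x else 0) \<in> borel_measurable lebesgue"
    by (rule borel_measurable_AE) (use ae in eventually_elim, auto)
  then show ?thesis using borel_measurable_if[OF S] by blast
qed

lemma L2_AE:
  assumes "f \<in> L2 a" "AE x in lebesgue_on {a..}. g x = f x"
  shows "g \<in> L2 a"
proof -
  have f: "f \<in> borel_measurable (lebesgue_on {a..})" "integrable (lebesgue_on {a..}) (\<lambda>x. (cmod (f x))\<^sup>2)"
    using assms(1) by (auto simp: L2_def)
  have g: "g \<in> borel_measurable (lebesgue_on {a..})" by (rule half_line_borel_measurable_AE[OF f(1) assms(2)])
  have "integrable (lebesgue_on {a..}) (\<lambda>x. (cmod (g x))\<^sup>2)"
  proof (rule Bochner_Integration.integrable_bound[OF f(2)])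
    show "(\<lambda>x. (cmod (g x))\<^sup>2) \<in> borel_measurable (lebesgue_on {a..})" using g by measurable
    show "AE x in lebesgue_on {a..}. norm ((cmod (g x))\<^sup>2) \<le> norm ((cmod (f x))\<^sup>2)"
      using assms(2) by eventually_elim simp
  qed
  with g show ?thesis by (simp add: L2_def)
qed

lemma L2_add:
  assumes "f \<in> L2 a" "g \<in> L2 a"
  shows "(\<lambda>x. f x + g x) \<in> L2 a"
proof -
  have m: "f \<in> borel_measurable (lebesgue_on {a..})" "g \<in> borel_measurable (lebesgue_on {a..})"
    and i: "integrable (lebesgue_on {a..}) (\<lambda>x. (cmod (f x))\<^sup>2)" "integrable (lebesgue_on {a..}) (\<lambda>x. (cmod (g x))\<^sup>2)"
    using assms by (auto simp: L2_def)
  have b: "(cmod (u + v))\<^sup>2 \<le> 2 * (cmod u)\<^sup>2 + 2 * (cmod v)\<^sup>2" for u v :: complex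
  proof -
    have "(cmod (u + v))\<^sup>2 \<le> (cmod u + cmod v)\<^sup>2" by (intro power_mono norm_triangle_ineq) simp
    also have "\<dots> \<le> 2 * (cmod u)\<^sup>2 + 2 * (cmod v)\<^sup>2"
      using zero_le_power2[of "cmod u - cmod v"] by (simp add: power2_eq_square algebra_simps)
    finally show ?thesis .
  qed
  have "integrable (lebesgue_on {a..}) (\<lambda>x. 2 * (cmod (f x))\<^sup>2 + 2 * (cmod (g x))\<^sup>2)" using i by simp
  then have "integrable (lebesgue_on {a..}) (\<lambda>x. (cmod (f x + g x))\<^sup>2)"
    by (rule Bochner_Integration.integrable_bound) (use m b in \<open>auto simp: power2_eq_square[symmetric]\<close>)
  with m show ?thesis by (simp add: L2_def)
qed

lemma L2_cmult: "f \<in> L2 a \<Longrightarrow> (\<lambda>x. c * f x) \<in> L2 a"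
  by (auto simp: L2_def norm_mult power_mult_distrib)

lemma ip_integrable:
  assumes "f \<in> L2 a" "g \<in> L2 a"
  shows "integrable (lebesgue_on {a..}) (\<lambda>x. f x * cnj (g x))"
proof -
  have m: "f \<in> borel_measurable (lebesgue_on {a..})" "g \<in> borel_measurable (lebesgue_on {a..})"
    and i: "integrable (lebesgue_on {a..}) (\<lambda>x. (cmod (f x))\<^sup>2)" "integrable (lebesgue_on {a..}) (\<lambda>x. (cmod (g x))\<^sup>2)"
    using assms by (auto simp: L2_def)
  have b: "u * v \<le> u\<^sup>2 + v\<^sup>2" if "u \<ge> 0" "v \<ge> 0" for u v :: real
  proof -
    have "2 * (u * v) \<le> u\<^sup>2 + v\<^sup>2" using sum_squares_bound[of u v] by (simp add: mult.assoc)
    moreover have "0 \<le> u * v" using that by simp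
    ultimately show ?thesis by linarith
  qed
  have "integrable (lebesgue_on {a..}) (\<lambda>x. (cmod (f x))\<^sup>2 + (cmod (g x))\<^sup>2)" using i by simp
  then show ?thesis
  proof (rule Bochner_Integration.integrable_bound)
    have "cnj \<in> borel_measurable borel"
      by (intro borel_measurable_continuous_onI continuous_on_cnj continuous_on_id)
    from measurable_compose[OF m(2) this]
    show "(\<lambda>x. f x * cnj (g x)) \<in> borel_measurable (lebesgue_on {a..})"
      by (rule borel_measurable_times[OF m(1)])
    show "AE x in lebesgue_on {a..}. norm (f x * cnj (g x)) \<le> norm ((cmod (f x))\<^sup>2 + (cmod (g x))\<^sup>2)"
      using b[OF norm_ge_zero norm_ge_zero] by (intro AE_I2) (simp add: norm_mult)
  qed
qed

lemma ip_cnj: "cnj (ip a f g) = ip a g f"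
  unfolding ip_def by (subst Bochner_Integration.integral_cnj[symmetric]) (simp add: mult.commute)

lemma ip_add_left:
  assumes "f \<in> L2 a" "g \<in> L2 a" "k \<in> L2 a"
  shows "ip a (\<lambda>x. f x + g x) k = ip a f k + ip a g k"
  unfolding ip_def by (simp add: distrib_right ip_integrable assms)

lemma ip_cmult_left: "ip a (\<lambda>x. c * f x) k = c * ip a f k"
  unfolding ip_def by (simp add: mult.assoc)

lemma ip_add_right:
  assumes "f \<in> L2 a" "g \<in> L2 a" "k \<in> L2 a"
  shows "ip a k (\<lambda>x. f x + g x) = ip a k f + ip a k g"
  using arg_cong[OF ip_add_left[OF assms], of cnj] by (simp add: ip_cnj)

lemma ip_cmult_right: "ip a k (\<lambda>x. c * f x) = cnj c * ip a k f"
  using arg_cong[OF ip_cmult_left[of a c f k], of cnj] by (simp add: ip_cnj)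

lemma ip_AE_left:
  assumes "f \<in> L2 a" "k \<in> L2 a" "AE x in lebesgue_on {a..}. g x = f x"
  shows "ip a g k = ip a f k"
  unfolding ip_def
proof (rule integral_cong_AE)
  have "g \<in> L2 a" using L2_AE assms by blast
  then show "(\<lambda>x. g x * cnj (k x)) \<in> borel_measurable (lebesgue_on {a..})"
    using ip_integrable[OF _ assms(2)] by (blast intro: borel_measurable_integrable)
  show "(\<lambda>x. f x * cnj (k x)) \<in> borel_measurable (lebesgue_on {a..})"
    using ip_integrable[OF assms(1,2)] by (blast intro: borel_measurable_integrable)
  show "AE x in lebesgue_on {a..}. g x * cnj (k x) = f x * cnj (k x)"
    using assms(3) by eventually_elim simp
qed

lemma ip_AE_right:
  assumes "f \<in> L2 a" "k \<in> L2 a" "AE x in lebesgue_on {a..}. g x = f x"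
  shows "ip a k g = ip a k f"
  using arg_cong[OF ip_AE_left[OF assms], of cnj] by (simp add: ip_cnj)

lemma ip_self: "ip a f f = complex_of_real (LINT x|lebesgue_on {a..}. (cmod (f x))\<^sup>2)"
  unfolding ip_def by (simp flip: complex_norm_square integral_complex_of_real)

lemma ip_self_nonneg: "0 \<le> Re (ip a f f)"
  unfolding ip_self by simp

lemma continuous_AE_zero_half_line:
  fixes f :: "real \<Rightarrow> complex"
  assumes "continuous_on {a..} f" "AE x in lebesgue_on {a..}. f x = 0" "x \<ge> a"
  shows "f x = 0"
proof (rule ccontr)
  assume nz: "f x \<noteq> 0"
  obtain N where N: "negligible N" "\<And>x. x \<ge> a \<Longrightarrow> x \<notin> N \<Longrightarrow> f x = 0"
    using assms(2) unfolding AE_half_line by blast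
  obtain d where d: "d > 0" "\<And>y. \<lbrakk>y \<ge> a; dist y x < d\<rbrakk> \<Longrightarrow> dist (f y) (f x) < cmod (f x)"
    using assms(1,3) nz unfolding continuous_on_iff by (metis atLeast_iff zero_less_norm_iff)
  have "{x<..<x + d} \<subseteq> N"
  proof
    fix y assume y: "y \<in> {x<..<x + d}"
    then have "dist (f y) (f x) < cmod (f x)" using assms(3) by (intro d(2)) (auto simp: dist_real_def)
    then have "f y \<noteq> 0" by (auto simp: dist_norm)
    then show "y \<in> N" using N(2)[of y] y assms(3) by auto
  qed
  then have "negligible {x<..<x + d}" using N(1) negligible_subset by blast
  then have "negligible (box x (x + d))" by simp
  then show False using d(1) unfolding negligible_interval by simp
qed

text \<open>Vanishing norm gives zero almost everywhere, and continuity upgrades this to every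
  point, so that boundary values at \<open>a\<close> make sense of it. Serves the uniqueness in the
  definition of the impedance.\<close>

lemma ip_self_eq_0:
  assumes "f \<in> L2 a" "f \<in> regular a" "Re (ip a f f) = 0"
  shows "f a = 0" "D a f a = 0"
proof -
  have i: "integrable (lebesgue_on {a..}) (\<lambda>x. (cmod (f x))\<^sup>2)" using assms(1) by (simp add: L2_def)
  have "(LINT x|lebesgue_on {a..}. (cmod (f x))\<^sup>2) = 0" using assms(3) by (simp add: ip_self)
  then have "AE x in lebesgue_on {a..}. (cmod (f x))\<^sup>2 = 0"
    using integral_nonneg_eq_0_iff_AE[OF i] by simp
  then have ae: "AE x in lebesgue_on {a..}. f x = 0" by simp
  have "continuous_on {a..} f" using assms(2) by (intro loc_abs_cont_continuous) (simp add: regular_def)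
  then have z: "f x = 0" if "x \<ge> a" for x using continuous_AE_zero_half_line ae that by blast
  then show "f a = 0" by simp
  show "D a f a = 0"
    by (rule D_eqI[OF has_vector_derivative_eq_on_half_line[OF has_vector_derivative_const]]) (use z in auto)
qed

lemma l_add_ae:
  assumes "f \<in> regular a" "g \<in> regular a"
  shows "AE x in lebesgue_on {a..}. l a q (\<lambda>x. f x + g x) x = l a q f x + l a q g x"
  using regular_add(3)[OF assms] by eventually_elim (simp add: l_def algebra_simps)

lemma l_cmult_ae:
  assumes "f \<in> regular a"
  shows "AE x in lebesgue_on {a..}. l a q (\<lambda>x. c * f x) x = c * l a q f x"
  using regular_cmult(3)[OF assms, of c] by eventually_elim (simp add: l_def algebra_simps)

lemma l_lin_ae:
  assumes "f \<in> regular a" "g \<in> regular a"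
  shows "AE x in lebesgue_on {a..}. l a q (\<lambda>x. f x + c * g x) x = l a q f x + c * l a q g x"
  using l_add_ae[OF assms(1) regular_cmult(1)[OF assms(2), of c], of q] l_cmult_ae[OF assms(2), of q c]
  by eventually_elim simp

lemma regular_lin:
  assumes "f \<in> regular a" "g \<in> regular a"
  shows "(\<lambda>x. f x + c * g x) \<in> regular a" "\<And>x. x \<ge> a \<Longrightarrow> D a (\<lambda>x. f x + c * g x) x = D a f x + c * D a g x"
  using regular_add(1,2)[OF assms(1) regular_cmult(1)[OF assms(2), of c]] regular_cmult(2)[OF assms(2), of _ c]
  by simp_all

lemma Hplus_D:
  assumes "f \<in> Hplus a q"
  shows "f \<in> L2 a" "f \<in> regular a" "l a q f \<in> L2 a"
  using assms by (auto simp: Hplus_def)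

lemma Hplus_lin:
  assumes "f \<in> Hplus a q" "g \<in> Hplus a q"
  shows "(\<lambda>x. f x + c * g x) \<in> Hplus a q"
proof -
  note f = Hplus_D[OF assms(1)] and g = Hplus_D[OF assms(2)]
  have "l a q (\<lambda>x. f x + c * g x) \<in> L2 a"
    by (rule L2_AE[OF L2_add[OF f(3) L2_cmult[OF g(3)]] l_lin_ae[OF f(2) g(2)]])
  then show ?thesis using L2_add[OF f(1) L2_cmult[OF g(1)]] regular_lin(1)[OF f(2) g(2)]
    by (simp add: Hplus_def)
qed

text \<open>\<open>W\<close> is the Wronskian of \<open>f\<close> and the conjugate of
  \<open>g\<close>. The real potential cancels, so the derivative of \<open>W\<close> is minus the
  integrand, but only almost everywhere; absolute continuity of \<open>W\<close> allows it to be
  integrated nevertheless.\<close>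

lemma green_interval:
  assumes f: "f \<in> regular a" and g: "g \<in> regular a" and ab: "a < b"
  defines "W \<equiv> \<lambda>x. D a f x * cnj (g x) - f x * cnj (D a g x)"
  shows "((\<lambda>x. l a q f x * cnj (g x) - f x * cnj (l a q g x)) has_integral (W a - W b)) {a..b}"
proof -
  let ?F = "\<lambda>x. l a q f x * cnj (g x) - f x * cnj (l a q g x)"
  have lac: "loc_abs_cont a f" "loc_abs_cont a g" "loc_abs_cont a (D a f)" "loc_abs_cont a (D a g)"
    using f g by (auto simp: regular_def)
  have "W = (\<lambda>x. D a f x * cnj (g x) + (-1) * (f x * cnj (D a g x)))" by (simp add: W_def)
  moreover have "loc_abs_cont a (\<lambda>x. D a f x * cnj (g x) + (-1) * (f x * cnj (D a g x)))"
    by (intro loc_abs_cont_algebra lac)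
  ultimately have "loc_abs_cont a W" by simp
  then have ac: "AC a b W" using ab by (intro abs_cont_on_AC) (simp add: loc_abs_cont_def)
  have "AE x in lebesgue_on {a..}. (W has_vector_derivative - ?F x) (at x within {a..})"
    using regular_second_derivative_ae[OF f] regular_second_derivative_ae[OF g] AE_space
  proof eventually_elim
    case (elim x)
    then have x: "x \<ge> a" by simp
    have "(W has_vector_derivative ((D a f x * cnj (D a g x) + D a (D a f) x * cnj (g x))
       - (f x * cnj (D a (D a g) x) + D a f x * cnj (D a g x)))) (at x within {a..})"
      unfolding W_def
      by (intro has_vector_derivative_diff has_vector_derivative_mult has_vector_derivative_cnj elim
          regular_has_derivative f g x)
    then show ?case by (simp add: l_def algebra_simps)
  qed
  from this[unfolded AE_half_line] obtain N where
    N: "negligible N" "\<forall>x. x \<ge> a \<and> x \<notin> N \<longrightarrow> (W has_vector_derivative - ?F x) (at x within {a..})"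
    by (elim exE conjE)
  have "((\<lambda>x. - ?F x) has_integral (W b - W a)) {a..b}"
  proof (rule fundamental_theorem_of_calculus_AC[OF _ ac N(1)])
    fix x assume "x \<in> {a..b} - N"
    then show "(W has_vector_derivative - ?F x) (at x within {a..b})"
      by (intro has_vector_derivative_within_subset[of W "- ?F x" x "{a..}" "{a..b}"] N(2)[rule_format]) auto
  qed (use ab in simp)
  from has_integral_neg[OF this] show ?thesis by simp
qed

text \<open>The inequality \<open>x > b\<close> is strict because at \<open>b\<close> itself the
  derivative also depends on values to the left.\<close>

lemma vanishing_tail:
  assumes s: "\<And>x. x \<ge> b \<Longrightarrow> s x = 0" and x: "x > b" and ab: "a \<le> b"
  shows "D a s x = 0" "l a q s x = 0"
proof -
  have zero: "D a y x = 0" if y: "\<And>x. x > b \<Longrightarrow> y x = 0" "x > b" for y x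
  proof (rule D_eqI)
    show "(y has_vector_derivative 0) (at x within {a..})"
      by (rule has_vector_derivative_at_within,
          rule has_vector_derivative_transform_within_open[OF has_vector_derivative_const, of "{b<..}"])
        (use y in auto)
  qed (use y(2) ab in simp)
  have s': "D a s x = 0" if "x > b" for x using zero[of s x] s that by simp
  show "D a s x = 0" by (rule s'[OF x])
  show "l a q s x = 0" using zero[of "D a s" x] s' s[of x] x by (simp add: l_def)
qed

text \<open>The compact support of \<open>s\<close> kills the Wronskian at the right end, however
  \<open>f\<close> behaves at infinity.\<close>

lemma green_compact:
  assumes f: "f \<in> Hplus a q" and s: "s \<in> Hplus a q" and ab: "a \<le> b" and tail: "\<And>x. x \<ge> b \<Longrightarrow> s x = 0"
  shows "ip a (l a q f) s - ip a f (l a q s) = D a f a * cnj (s a) - f a * cnj (D a s a)"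
proof -
  let ?F = "\<lambda>x. l a q f x * cnj (s x) - f x * cnj (l a q s x)"
  let ?I = "D a f a * cnj (s a) - f a * cnj (D a s a)"
  note f' = Hplus_D[OF f] and s' = Hplus_D[OF s]
  \<comment> \<open>Green's formula is applied up to \<open>b + 1\<close>, as \<open>D a s\<close>
    is known to vanish only strictly beyond \<open>b\<close>.\<close>
  have "a < b + 1" using ab by simp
  from green_interval[OF f'(2) s'(2) this, of q]
  have "(?F has_integral ?I) {a..b+1}"
    using vanishing_tail(1)[of b s "b+1" a, OF tail _ ab] tail[of "b+1"] by simp
  note FI = this
  let ?G = "\<lambda>x. if x \<in> {a..b+1} then ?F x else 0"
  have "(?G has_integral ?I) {a..b+1}" by (rule has_integral_eq[OF _ FI]) simp
  then have GI: "(?G has_integral ?I) {a..}" by (rule has_integral_on_superset) auto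
  have "(?F has_integral ?I) {a..}"
  proof (rule has_integral_eq[OF _ GI])
    fix x assume x: "x \<in> {a..}"
    show "?G x = ?F x"
    proof (cases "x \<le> b + 1")
      case True then show ?thesis using x by simp
    next
      case False
      then have "s x = 0" "l a q s x = 0"
        using vanishing_tail(2)[of b s x a q, OF tail _ ab] tail[of x] by simp_all
      then show ?thesis by simp
    qed
  qed
  then have 1: "integral {a..} ?F = ?I" by (rule integral_unique)
  have "integrable (lebesgue_on {a..}) ?F"
    by (intro Bochner_Integration.integrable_diff ip_integrable f' s')
  from lebesgue_integral_eq_integral[OF this] have "integral\<^sup>L (lebesgue_on {a..}) ?F = integral {a..} ?F" by simp
  moreover have "integral\<^sup>L (lebesgue_on {a..}) ?F = ip a (l a q f) s - ip a f (l a q s)"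
    unfolding ip_def by (intro Bochner_Integration.integral_diff ip_integrable f' s')
  ultimately show ?thesis using 1 by simp
qed


section \<open>Cut-off solutions of compact support\<close>

definition ramp :: "real \<Rightarrow> real \<Rightarrow> real \<Rightarrow> real" where
  "ramp a e x = max 0 (1 - (x - a) / e)"

text \<open>Squaring moves the kink of \<open>ramp\<close> at \<open>a + e\<close> from the first to
  the second derivative: the result is C^1 with Lipschitz derivative, hence \<open>regular\<close>.
  At \<open>a\<close> it has value 1 and slope \<open>- 2 / e\<close>.\<close>

definition cutoff :: "real \<Rightarrow> real \<Rightarrow> real \<Rightarrow> complex" where
  "cutoff a e x = complex_of_real ((ramp a e x)\<^sup>2)"

lemma ramp_bounds:
  assumes "e > 0" "x \<ge> a"
  shows "0 \<le> ramp a e x" "ramp a e x \<le> 1"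
  using assms by (auto simp: ramp_def)

lemma ramp_eq_0: "e > 0 \<Longrightarrow> x \<ge> a + e \<Longrightarrow> ramp a e x = 0"
  by (simp add: ramp_def field_simps)

lemma ramp_lipschitz:
  assumes "e > 0"
  shows "\<bar>ramp a e y - ramp a e x\<bar> \<le> 1 / e * \<bar>y - x\<bar>"
proof -
  have "\<bar>ramp a e y - ramp a e x\<bar> \<le> \<bar>(y - a) / e - (x - a) / e\<bar>" by (auto simp: ramp_def)
  also have "(y - a) / e - (x - a) / e = 1 / e * (y - x)" by (simp add: diff_divide_distrib)
  also have "\<bar>1 / e * (y - x)\<bar> = 1 / e * \<bar>y - x\<bar>" using assms by (simp add: abs_mult)
  finally show ?thesis .
qed

lemma max_square_has_derivative: "((\<lambda>s::real. (max 0 s)\<^sup>2) has_real_derivative 2 * max 0 s) (at s)"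
proof -
  consider "s > 0" | "s < 0" | "s = 0" by linarith
  then show ?thesis
  proof cases
    case 1
    have "((\<lambda>s::real. s\<^sup>2) has_real_derivative 2 * max 0 s) (at s)"
      using 1 by (auto intro!: derivative_eq_intros)
    then show ?thesis
      by (rule has_field_derivative_transform_within_open[of _ _ _ "{0<..}"]) (use 1 in auto)
  next
    case 2
    have "((\<lambda>s::real. 0) has_real_derivative 2 * max 0 s) (at s)"
      using 2 by (auto intro!: derivative_eq_intros)
    then show ?thesis
      by (rule has_field_derivative_transform_within_open[of _ _ _ "{..<0}"]) (use 2 in auto)
  next
    case 3
    have "((\<lambda>h::real. ((max 0 h)\<^sup>2 - (max 0 0)\<^sup>2) / (h - 0)) \<longlongrightarrow> 0) (at 0)"
    proof (rule Lim_null_comparison)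
      show "\<forall>\<^sub>F h in at 0. norm (((max 0 h)\<^sup>2 - (max 0 0)\<^sup>2) / (h - 0)) \<le> \<bar>h\<bar>"
        by (rule always_eventually) (auto simp: max_def power2_eq_square)
      show "((\<lambda>h::real. \<bar>h\<bar>) \<longlongrightarrow> 0) (at 0)"
        by (rule tendsto_rabs_zero) (rule tendsto_ident_at)
    qed
    then show ?thesis using 3 by (simp add: has_field_derivative_iff)
  qed
qed

lemma cutoff_has_derivative:
  assumes "e > 0"
  shows "(cutoff a e has_vector_derivative complex_of_real (- 2 / e * ramp a e x)) (at x within S)"
proof -
  have "((\<lambda>x. 1 - (x - a) / e) has_real_derivative (- 1 / e)) (at x within S)"
    using assms by (auto intro!: derivative_eq_intros)
  from DERIV_chain2[OF max_square_has_derivative this]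
  have "((\<lambda>x. (ramp a e x)\<^sup>2) has_real_derivative (- 2 / e * ramp a e x)) (at x within S)"
    by (simp add: ramp_def mult_ac)
  then show ?thesis
    unfolding cutoff_def
    by (rule has_vector_derivative_of_real)
qed

lemma cutoff_regular:
  assumes e: "e > 0"
  shows "cutoff a e \<in> regular a" "\<And>x. x \<ge> a \<Longrightarrow> D a (cutoff a e) x = complex_of_real (- 2 / e * ramp a e x)"
proof -
  have 1: "loc_abs_cont a (cutoff a e)"
    unfolding loc_abs_cont_def
  proof (intro allI impI)
    fix b
    show "abs_cont_on a b (cutoff a e)"
    proof (rule abs_cont_on_lipschitz[of "2 / e"])
      fix x y assume xy: "x \<in> {a..b}" "y \<in> {a..b}"
      have "\<bar>(ramp a e y)\<^sup>2 - (ramp a e x)\<^sup>2\<bar> = \<bar>ramp a e y - ramp a e x\<bar> * \<bar>ramp a e y + ramp a e x\<bar>"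
        by (simp add: power2_eq_square abs_mult[symmetric] algebra_simps)
      also have "\<dots> \<le> (1 / e * \<bar>y - x\<bar>) * 2"
        using ramp_bounds[OF e, of a x] ramp_bounds[OF e, of a y] xy
        by (intro mult_mono ramp_lipschitz e) (use e in auto)
      finally show "cmod (cutoff a e y - cutoff a e x) \<le> 2 / e * \<bar>y - x\<bar>"
        by (simp only: cutoff_def of_real_diff[symmetric] norm_of_real) (simp add: mult.commute)
    qed (use e in simp)
  qed
  have 2: "loc_abs_cont a (\<lambda>x. complex_of_real (- 2 / e * ramp a e x))"
    unfolding loc_abs_cont_def
  proof (intro allI impI)
    fix b
    show "abs_cont_on a b (\<lambda>x. complex_of_real (- 2 / e * ramp a e x))"
    proof (rule abs_cont_on_lipschitz[of "2 / e * (1 / e)"])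
      fix x y assume "x \<in> {a..b}" "y \<in> {a..b}"
      have "cmod (complex_of_real (- 2 / e * ramp a e y) - complex_of_real (- 2 / e * ramp a e x))
         = 2 / e * \<bar>ramp a e y - ramp a e x\<bar>"
      proof -
        have "- 2 / e * ramp a e y - - 2 / e * ramp a e x = - (2 / e * (ramp a e y - ramp a e x))"
          by (simp add: algebra_simps)
        then show ?thesis using e by (simp only: of_real_diff[symmetric] norm_of_real abs_minus_cancel abs_mult) simp
      qed
      also have "\<dots> \<le> 2 / e * (1 / e * \<bar>y - x\<bar>)" using e by (intro mult_left_mono ramp_lipschitz) auto
      finally show "cmod (complex_of_real (- 2 / e * ramp a e y) - complex_of_real (- 2 / e * ramp a e x))
        \<le> 2 / e * (1 / e) * \<bar>y - x\<bar>" by (simp only: mult.assoc)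
    qed (use e in simp)
  qed
  note R = regularI[OF cutoff_has_derivative[OF e] 1 2]
  show "cutoff a e \<in> regular a" by (rule R(1))
  show "D a (cutoff a e) x = complex_of_real (- 2 / e * ramp a e x)" if "x \<ge> a" for x by (rule R(2)[OF that])
qed

lemma cutoff_second_derivative:
  assumes e: "e > 0" and x: "x \<ge> a" "x \<noteq> a + e"
  shows "D a (D a (cutoff a e)) x = (if x < a + e then complex_of_real (2 / e\<^sup>2) else 0)"
proof (rule D_eqI[OF _ x(1)])
  let ?c = "if x < a + e then complex_of_real (2 / e\<^sup>2) else 0"
  let ?g = "\<lambda>x. complex_of_real (- 2 / e * ramp a e x)"
  have "(?g has_vector_derivative ?c) (at x)"
  proof (cases "x < a + e")
    case True
    have "((\<lambda>x. - 2 / e * (1 - (x - a) / e)) has_real_derivative (2 / e\<^sup>2)) (at x)"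
      using e by (auto intro!: derivative_eq_intros simp: power2_eq_square)
    then have "((\<lambda>x. complex_of_real (- 2 / e * (1 - (x - a) / e))) has_vector_derivative complex_of_real (2 / e\<^sup>2)) (at x)"
      by (rule has_vector_derivative_of_real)
    then have "(?g has_vector_derivative complex_of_real (2 / e\<^sup>2)) (at x)"
      by (rule has_vector_derivative_transform_within_open[of _ _ _ "{..<a+e}"])
        (use True e in \<open>auto simp: ramp_def max_def field_simps\<close>)
    then show ?thesis using True by simp
  next
    case False
    have "(?g has_vector_derivative 0) (at x)"
      by (rule has_vector_derivative_transform_within_open[OF has_vector_derivative_const, of "{a+e<..}"])
        (use False x e ramp_eq_0 in auto)
    then show ?thesis using False by simp
  qed
  then have "(?g has_vector_derivative ?c) (at x within {a..})" by (rule has_vector_derivative_at_within)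
  then show "(D a (cutoff a e) has_vector_derivative ?c) (at x within {a..})"
    by (rule has_vector_derivative_eq_on_half_line[OF _ x(1) cutoff_regular(2)[OF e]])
qed

lemma AE_half_line_neq: "AE x in lebesgue_on {a..}. x \<noteq> (c::real)"
  unfolding AE_half_line by (rule exI[of _ "{c}"]) auto

lemma indicator_half_line:
  assumes "a \<le> b"
  shows "integrable (lebesgue_on {a..}) (indicator {a..b} :: real \<Rightarrow> real)"
    "(LINT x|lebesgue_on {a..}. indicator {a..b} x) = b - a"
proof -
  have sub: "{a..b} \<subseteq> {a..}" by auto
  have s: "{a..b} \<in> sets (lebesgue_on {a..})" using sub by (simp add: sets_restrict_space_iff)
  have e: "emeasure (lebesgue_on {a..}) {a..b} = ennreal (b - a)"
    using sub assms by (simp add: emeasure_restrict_space)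
  show "integrable (lebesgue_on {a..}) (indicator {a..b} :: real \<Rightarrow> real)"
    by (rule integrable_real_indicator[OF s]) (simp add: e)
  have "(LINT x|lebesgue_on {a..}. indicator {a..b} x) = measure (lebesgue_on {a..}) ({a..b} \<inter> space (lebesgue_on {a..}))"
    by (rule Bochner_Integration.integral_indicator)
  also have "{a..b} \<inter> space (lebesgue_on {a..}) = {a..b}" using sub by auto
  also have "measure (lebesgue_on {a..}) {a..b} = b - a" using e assms by (simp add: measure_def)
  finally show "(LINT x|lebesgue_on {a..}. indicator {a..b} x) = b - a" .
qed

lemma compact_L2:
  assumes "g \<in> borel_measurable (lebesgue_on {a..})" "a \<le> b" "\<And>x. x \<ge> a \<Longrightarrow> cmod (g x) \<le> C * indicator {a..b} x"
  shows "g \<in> L2 a"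
proof -
  have "integrable (lebesgue_on {a..}) (\<lambda>x. C\<^sup>2 * indicator {a..b} x)"
    using indicator_half_line(1)[OF assms(2)] by simp
  then have "integrable (lebesgue_on {a..}) (\<lambda>x. (cmod (g x))\<^sup>2)"
  proof (rule Bochner_Integration.integrable_bound)
    show "(\<lambda>x. (cmod (g x))\<^sup>2) \<in> borel_measurable (lebesgue_on {a..})" using assms(1) by measurable
    show "AE x in lebesgue_on {a..}. norm ((cmod (g x))\<^sup>2) \<le> norm (C\<^sup>2 * indicator {a..b} x)"
    proof (rule AE_I2)
      fix x assume "x \<in> space (lebesgue_on {a..})"
      then have "(cmod (g x))\<^sup>2 \<le> (C * indicator {a..b} x)\<^sup>2" using assms(3) by (intro power_mono) auto
      then show "norm ((cmod (g x))\<^sup>2) \<le> norm (C\<^sup>2 * indicator {a..b} x)"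
        by (auto simp: indicator_def split: if_splits)
    qed
  qed
  with assms(1) show ?thesis by (simp add: L2_def)
qed

text \<open>Stands in for the Cauchy-Schwarz inequality in the boundary layer, where explicit
  pointwise majorants are at hand.\<close>

lemma ip_bound:
  assumes "f \<in> L2 a" "g \<in> L2 a" "integrable (lebesgue_on {a..}) h"
    "AE x in lebesgue_on {a..}. cmod (f x) * cmod (g x) \<le> h x"
  shows "cmod (ip a f g) \<le> integral\<^sup>L (lebesgue_on {a..}) h"
proof -
  have i: "integrable (lebesgue_on {a..}) (\<lambda>x. f x * cnj (g x))" by (rule ip_integrable[OF assms(1,2)])
  have "cmod (ip a f g) \<le> (LINT x|lebesgue_on {a..}. cmod (f x * cnj (g x)))"
    unfolding ip_def by (rule integral_norm_bound)
  also have "\<dots> \<le> integral\<^sup>L (lebesgue_on {a..}) h"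
    by (rule integral_mono_AE) (use integrable_norm[OF i] assms(3,4) in \<open>auto simp: norm_mult\<close>)
  finally show ?thesis .
qed

text \<open>
  The potential is only locally summable, so a compactly supported smooth function need not belong to
  the maximal domain; cutting off a solution of \<open>l(y) = 0\<close> removes \<open>q\<close> from the result.
\<close>

lemma cut_solution:
  assumes e: "e > 0" and sol: "solves a q 0 \<phi>"
  defines "s \<equiv> \<lambda>x. \<phi> x * cutoff a e x"
  shows "s \<in> Hplus a q" "s a = \<phi> a" "D a s a = D a \<phi> a - complex_of_real (2 / e) * \<phi> a" "\<And>x. x \<ge> a + e \<Longrightarrow> s x = 0"
    "AE x in lebesgue_on {a..}. l a q s x
        = complex_of_real (4 / e * ramp a e x) * D a \<phi> x - (if x < a + e then complex_of_real (2 / e\<^sup>2) else 0) * \<phi> x"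
proof -
  let ?k = "\<lambda>x. if x < a + e then complex_of_real (2 / e\<^sup>2) else 0"
  let ?g = "\<lambda>x. complex_of_real (4 / e * ramp a e x) * D a \<phi> x - ?k x * \<phi> x"
  have \<phi>: "\<phi> \<in> regular a" "AE x in lebesgue_on {a..}. l a q \<phi> x = 0" using sol by (auto simp: solves_def)
  note R = regular_mult[OF \<phi>(1) cutoff_regular(1)[OF e]]
  have ra: "ramp a e a = 1" by (simp add: ramp_def)
  show "s a = \<phi> a" by (simp add: s_def cutoff_def ra)
  show "D a s a = D a \<phi> a - complex_of_real (2 / e) * \<phi> a"
    unfolding s_def by (subst R(2)) (simp_all add: cutoff_regular(2)[OF e] cutoff_def ra)
  show tail: "s x = 0" if "x \<ge> a + e" for x using ramp_eq_0[OF e that] by (simp add: s_def cutoff_def)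
  show ae: "AE x in lebesgue_on {a..}. l a q s x = ?g x"
    \<comment> \<open>The point \<open>a + e\<close> is excluded because the second derivative of
      \<open>cutoff\<close> jumps there.\<close>
    using R(3) \<phi>(2) AE_half_line_neq[where a=a and c="a + e"] AE_space
  proof eventually_elim
    case (elim x)
    then have x: "x \<ge> a" by simp
    have "l a q s x = cutoff a e x * l a q \<phi> x - \<phi> x * D a (D a (cutoff a e)) x - 2 * D a \<phi> x * D a (cutoff a e) x"
      using elim(1) by (simp add: l_def s_def algebra_simps)
    then show ?case
      using elim(2) by (simp add: cutoff_second_derivative[OF e x elim(3)] cutoff_regular(2)[OF e x])
  qed
  have c: "continuous_on {a..} \<phi>" "continuous_on {a..} (D a \<phi>)"
    using \<phi>(1) by (auto simp: regular_def intro: loc_abs_cont_continuous)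
  have m: "\<phi> \<in> borel_measurable (lebesgue_on {a..})" "D a \<phi> \<in> borel_measurable (lebesgue_on {a..})"
    using c by (auto intro: continuous_imp_measurable_on_sets_lebesgue)
  have lb: "f \<in> borel_measurable borel \<Longrightarrow> f \<in> borel_measurable (lebesgue_on {a..})" for f :: "real \<Rightarrow> complex"
    by (rule measurable_restrict_space1) (simp add: measurable_completion)
  have m2: "(\<lambda>x. complex_of_real (4 / e * ramp a e x)) \<in> borel_measurable (lebesgue_on {a..})"
     "?k \<in> borel_measurable (lebesgue_on {a..})" "cutoff a e \<in> borel_measurable (lebesgue_on {a..})"
  proof -
    show "(\<lambda>x. complex_of_real (4 / e * ramp a e x)) \<in> borel_measurable (lebesgue_on {a..})"
      by (rule lb) (unfold ramp_def, measurable)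
    show "?k \<in> borel_measurable (lebesgue_on {a..})" by (rule lb) measurable
    show "cutoff a e \<in> borel_measurable (lebesgue_on {a..})"
      by (rule lb) (unfold ramp_def cutoff_def, measurable)
  qed
  have "compact {a..a+e}" by simp
  have "continuous_on {a..a+e} \<phi>" "continuous_on {a..a+e} (D a \<phi>)" using c continuous_on_subset by (metis Icc_subset_Ici_iff order_refl)+
  then have "bounded (\<phi> ` {a..a+e})" "bounded (D a \<phi> ` {a..a+e})"
    by (auto intro!: compact_imp_bounded compact_continuous_image)
  then obtain B C where B: "\<And>x. x \<in> {a..a+e} \<Longrightarrow> cmod (\<phi> x) \<le> B" and C: "\<And>x. x \<in> {a..a+e} \<Longrightarrow> cmod (D a \<phi> x) \<le> C"
    unfolding bounded_iff by blast
  have BC: "B \<ge> 0" "C \<ge> 0" using B[of a] C[of a] e by (meson atLeastAtMost_iff le_add_same_cancel1 less_imp_le norm_ge_zero order_refl order_trans)+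
  have sL: "s \<in> L2 a"
  proof (rule compact_L2[of _ _ "a + e" B])
    show "s \<in> borel_measurable (lebesgue_on {a..})" unfolding s_def using m(1) m2(3) by (rule borel_measurable_times)
    show "a \<le> a + e" using e by simp
    fix x assume x: "x \<ge> a"
    show "cmod (s x) \<le> B * indicator {a..a+e} x"
    proof (cases "x \<le> a + e")
      case True
      have "cmod (s x) = cmod (\<phi> x) * (ramp a e x)\<^sup>2" by (simp add: s_def cutoff_def norm_mult norm_power)
      also have "\<dots> \<le> B * 1"
        using ramp_bounds[OF e x] B[of x] True x BC by (intro mult_mono) (auto simp: power_le_one)
      finally show ?thesis using True x by simp
    next
      case False then show ?thesis using tail[of x] by simp
    qed
  qed
  have gL: "?g \<in> L2 a"
  proof (rule compact_L2[of _ _ "a + e" "4 / e * C + 2 / e\<^sup>2 * B"])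
    show "?g \<in> borel_measurable (lebesgue_on {a..})"
      by (intro borel_measurable_diff borel_measurable_times m m2)
    show "a \<le> a + e" using e by simp
    fix x assume x: "x \<ge> a"
    show "cmod (?g x) \<le> (4 / e * C + 2 / e\<^sup>2 * B) * indicator {a..a+e} x"
    proof (cases "x \<le> a + e")
      case True
      have "cmod (?g x) \<le> cmod (complex_of_real (4 / e * ramp a e x) * D a \<phi> x) + cmod (?k x * \<phi> x)"
        by (rule norm_triangle_ineq4)
      also have "\<dots> = (4 / e * ramp a e x) * cmod (D a \<phi> x) + cmod (?k x) * cmod (\<phi> x)"
      proof -
        have "\<bar>4 / e * ramp a e x\<bar> = 4 / e * ramp a e x" using e ramp_bounds[OF e x] by simp
        then show ?thesis by (simp only: norm_mult norm_of_real)
      qed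
      also have "\<dots> \<le> (4 / e) * C + 2 / e\<^sup>2 * B"
      proof (intro add_mono mult_mono)
        show "4 / e * ramp a e x \<le> 4 / e" using e ramp_bounds[OF e x] by (simp add: divide_simps)
        show "cmod (?k x) \<le> 2 / e\<^sup>2" using e by (simp add: norm_divide norm_power)
      qed (use B[of x] C[of x] True x e BC in auto)
      finally show ?thesis using True x by simp
    next
      case False then show ?thesis using ramp_eq_0[OF e, of a x] by simp
    qed
  qed
  have "l a q s \<in> L2 a" by (rule L2_AE[OF gL ae])
  then show "s \<in> Hplus a q" using sL R(1) by (simp add: Hplus_def s_def)
qed


section \<open>Linearity, the boundary bracket and behaviour near the endpoint\<close>

lemma solves_lin:
  assumes "solves a q z f" "solves a q z g"
  shows "solves a q z (\<lambda>x. f x + c * g x)"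
proof -
  have r: "f \<in> regular a" "g \<in> regular a" and ae: "AE x in lebesgue_on {a..}. l a q f x = z * f x"
    "AE x in lebesgue_on {a..}. l a q g x = z * g x" using assms by (auto simp: solves_def)
  have "AE x in lebesgue_on {a..}. l a q (\<lambda>x. f x + c * g x) x = z * (f x + c * g x)"
    using l_lin_ae[OF r, of q c] ae by eventually_elim (simp add: algebra_simps)
  then show ?thesis using regular_lin(1)[OF r] by (simp add: solves_def)
qed

text \<open>The defect of symmetry of \<open>l\<close> on the maximal domain; formally the
  difference of the Wronskians at \<open>a\<close> and at infinity.\<close>

definition bracket :: "real \<Rightarrow> (real \<Rightarrow> real) \<Rightarrow> (real \<Rightarrow> complex) \<Rightarrow> (real \<Rightarrow> complex) \<Rightarrow> complex" where
  "bracket a q f g = ip a (l a q f) g - ip a f (l a q g)"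

lemma bracket_cnj: "bracket a q g f = - cnj (bracket a q f g)"
  by (simp add: bracket_def ip_cnj)

lemma ip_lin_left:
  assumes "f \<in> L2 a" "g \<in> L2 a" "k \<in> L2 a"
  shows "ip a (\<lambda>x. f x + c * g x) k = ip a f k + c * ip a g k"
  using ip_add_left[OF assms(1) L2_cmult[OF assms(2)] assms(3)] by (simp add: ip_cmult_left)

lemma ip_lin_right:
  assumes "f \<in> L2 a" "g \<in> L2 a" "k \<in> L2 a"
  shows "ip a k (\<lambda>x. f x + c * g x) = ip a k f + cnj c * ip a k g"
  using ip_add_right[OF assms(1) L2_cmult[OF assms(2)] assms(3)] by (simp add: ip_cmult_right)

lemma ip_l_lin:
  assumes "f \<in> Hplus a q" "g \<in> Hplus a q" "k \<in> L2 a"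
  shows "ip a (l a q (\<lambda>x. f x + c * g x)) k = ip a (l a q f) k + c * ip a (l a q g) k"
    "ip a k (l a q (\<lambda>x. f x + c * g x)) = ip a k (l a q f) + cnj c * ip a k (l a q g)"
proof -
  note f = Hplus_D[OF assms(1)] and g = Hplus_D[OF assms(2)]
  note L = L2_add[OF f(3) L2_cmult[OF g(3), of c]]
  show "ip a (l a q (\<lambda>x. f x + c * g x)) k = ip a (l a q f) k + c * ip a (l a q g) k"
    using ip_AE_left[OF L assms(3) l_lin_ae[OF f(2) g(2)]] ip_lin_left[OF f(3) g(3) assms(3)] by simp
  show "ip a k (l a q (\<lambda>x. f x + c * g x)) = ip a k (l a q f) + cnj c * ip a k (l a q g)"
    using ip_AE_right[OF L assms(3) l_lin_ae[OF f(2) g(2)]] ip_lin_right[OF f(3) g(3) assms(3)] by simp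
qed

lemma bracket_lin:
  assumes "f \<in> Hplus a q" "g \<in> Hplus a q" "k \<in> Hplus a q"
  shows "bracket a q (\<lambda>x. f x + c * g x) k = bracket a q f k + c * bracket a q g k"
  unfolding bracket_def
  by (simp add: ip_l_lin[OF assms(1,2) Hplus_D(1)[OF assms(3)]]
      ip_lin_left[OF Hplus_D(1)[OF assms(1)] Hplus_D(1)[OF assms(2)] Hplus_D(3)[OF assms(3)]] algebra_simps)

text \<open>Integrating the bounded derivative gives linear decay towards \<open>a\<close>, which
  later offsets one power of \<open>1 / e\<close> produced by the cutoff.\<close>

lemma solution_bounds_near_a:
  assumes "y \<in> regular a" "y a = 0"
  obtains M where "M > 0" "\<And>x. x \<in> {a..a+1} \<Longrightarrow> cmod (D a y x) \<le> M" "\<And>x. x \<in> {a..a+1} \<Longrightarrow> cmod (y x) \<le> M * (x - a)"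
proof -
  have "abs_cont_on a (a+1) (D a y)" using assms(1) by (simp add: regular_def loc_abs_cont_def)
  then obtain M where M: "M > 0" "\<And>x. x \<in> {a..a+1} \<Longrightarrow> cmod (D a y x) \<le> M" using abs_cont_on_bounded by blast
  have "cmod (y x) \<le> M * (x - a)" if x: "x \<in> {a..a+1}" for x
  proof -
    have "(D a y has_integral (y x - y a)) {a..x}"
    proof (rule fundamental_theorem_of_calculus)
      fix t assume "t \<in> {a..x}"
      then show "(y has_vector_derivative D a y t) (at t within {a..x})"
        by (intro has_vector_derivative_within_subset[OF regular_has_derivative[OF assms(1)]]) auto
    qed (use x in simp)
    note I = this
    have "\<forall>t\<in>{a..x}. cmod (D a y t) \<le> M" using M(2) x by simp
    then have "cmod (y x - y a) \<le> M * (x - a)"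
      using has_integral_bound[of M "D a y" "y x - y a" a x] I M(1) x by simp
    then show ?thesis using x assms(2) by simp
  qed
  then show thesis using that M by blast
qed

section \<open>The form of the Schroedinger operator\<close>

text \<open>The two solutions at spectral parameter 0 are the raw material for elements of
  \<open>Hplus\<close> with prescribed boundary values at \<open>a\<close> and compact
  support.\<close>

locale nonneg_schrodinger =
  fixes a :: real and q :: "real \<Rightarrow> real" and \<phi>1 \<phi>2 :: "real \<Rightarrow> complex"
  assumes nonneg: "nonneg_op a (Dom_min a q) (l a q)"
    and sol1: "solves a q 0 \<phi>1" "\<phi>1 a = 0" "D a \<phi>1 a = 1"
    and sol2: "solves a q 0 \<phi>2" "\<phi>2 a = -1" "D a \<phi>2 a = 0"
begin

lemma compact_with_boundary_values:
  obtains s where "s \<in> Hplus a q" "s a = u" "D a s a = v" "\<forall>x\<ge>a+1. s x = 0"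
proof -
  \<comment> \<open>The cutoff of width 1 has slope -2 at \<open>a\<close> and so lowers the
    derivative by \<open>2 * u\<close>, which \<open>\<alpha>\<close> restores. The combination
    below is \<open>\<alpha>\<close> times the first solution minus \<open>u\<close> times the
    second (whose value at \<open>a\<close> is -1), written in the form \<open>f + c * g\<close> of
    the linearity lemmas.\<close>
  define \<alpha> where "\<alpha> = v + 2 * u"
  let ?\<phi> = "\<lambda>x. (\<phi>1 x + (\<alpha> - 1) * \<phi>1 x) + (- u) * \<phi>2 x"
  have sol: "solves a q 0 ?\<phi>" by (intro solves_lin sol1 sol2)
  have r: "\<phi>1 \<in> regular a" "\<phi>2 \<in> regular a" using sol1 sol2 by (auto simp: solves_def)
  have Da: "D a ?\<phi> a = \<alpha>"
    using regular_lin(2)[OF regular_lin(1)[OF r(1) r(1)] r(2), of a "\<alpha> - 1" "- u"] regular_lin(2)[OF r(1) r(1), of a "\<alpha> - 1"]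
      sol1(3) sol2(3) by simp
  note C = cut_solution[OF zero_less_one sol]
  show thesis
  proof (rule that[OF C(1)])
    show "\<forall>x\<ge>a+1. ?\<phi> x * cutoff a 1 x = 0" using C(4) by blast
    show "?\<phi> a * cutoff a 1 a = u" using C(2) sol1(2) sol2(2) by simp
    show "D a (\<lambda>x. ?\<phi> x * cutoff a 1 x) a = v" using C(3) Da sol1(2) sol2(2) by (simp add: \<alpha>_def)
  qed
qed

text \<open>There is no contribution from infinity. After subtraction of compactly supported
  \<open>s\<close> and \<open>t\<close> with the same boundary data, the remainders lie in
  \<open>Dom_min\<close>, where the operator is symmetric; every other bracket has a compactly
  supported argument and falls under \<open>green_compact\<close>.\<close>

lemma green_formula:
  assumes f: "f \<in> Hplus a q" and g: "g \<in> Hplus a q"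
  shows "bracket a q f g = D a f a * cnj (g a) - f a * cnj (D a g a)"
proof -
  have compact: "bracket a q k t = D a k a * cnj (t a) - k a * cnj (D a t a)"
    if "k \<in> Hplus a q" "t \<in> Hplus a q" "\<forall>x\<ge>a+1. t x = 0" for k t
    unfolding bracket_def by (rule green_compact[OF that(1,2), of "a+1"]) (use that(3) in auto)
  obtain s where s: "s \<in> Hplus a q" "s a = f a" "D a s a = D a f a" "\<forall>x\<ge>a+1. s x = 0"
    by (rule compact_with_boundary_values)
  obtain t where t: "t \<in> Hplus a q" "t a = g a" "D a t a = D a g a" "\<forall>x\<ge>a+1. t x = 0"
    by (rule compact_with_boundary_values)
  define f0 where "f0 = (\<lambda>x. f x + (-1) * s x)"
  define g0 where "g0 = (\<lambda>x. g x + (-1) * t x)"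
  have f0: "f0 \<in> Dom_min a q"
    unfolding f0_def Dom_min_def
    using Hplus_lin[OF f s(1), of "-1"] regular_lin(2)[OF Hplus_D(2)[OF f] Hplus_D(2)[OF s(1)], of a "-1"] s(2,3) by simp
  have g0: "g0 \<in> Dom_min a q"
    unfolding g0_def Dom_min_def
    using Hplus_lin[OF g t(1), of "-1"] regular_lin(2)[OF Hplus_D(2)[OF g] Hplus_D(2)[OF t(1)], of a "-1"] t(2,3) by simp
  have h0: "f0 \<in> Hplus a q" "g0 \<in> Hplus a q" using f0 g0 by (auto simp: Dom_min_def)
  have "bracket a q f0 g0 = 0"
    using nonneg f0 g0 by (simp add: bracket_def nonneg_op_def symmetric_op_def)
  moreover have "bracket a q f0 t = 0" using compact[OF h0(1) t(1,4)] f0 by (simp add: Dom_min_def)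
  \<comment> \<open>Linearity is available in the first argument, so the splitting of
    \<open>g\<close> is done with the arguments exchanged and carried back by
    \<open>bracket_cnj\<close>.\<close>
  moreover have "bracket a q g f0 = bracket a q g0 f0 + bracket a q t f0"
  proof -
    have "g = (\<lambda>x. g0 x + 1 * t x)" by (simp add: g0_def)
    then show ?thesis using bracket_lin[OF h0(2) t(1) h0(1), of 1] by simp
  qed
  ultimately have "bracket a q g f0 = 0" using bracket_cnj[of a q g0 f0] bracket_cnj[of a q t f0] by simp
  then have z: "bracket a q f0 g = 0" using bracket_cnj[of a q f0 g] by simp
  have "f = (\<lambda>x. f0 x + 1 * s x)" by (simp add: f0_def)
  then have "bracket a q f g = bracket a q f0 g + bracket a q s g" using bracket_lin[OF h0(1) s(1) g, of 1] by simp
  also have "\<dots> = - cnj (bracket a q g s)" using z bracket_cnj[of a q s g] by simp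
  also have "\<dots> = D a f a * cnj (g a) - f a * cnj (D a g a)"
    using compact[OF g s(1,4)] s(2,3) by simp
  finally show ?thesis .
qed

text \<open>Formally \<open>form f f\<close> is the integral of \<open>|f'|\<^sup>2 + q |f|\<^sup>2\<close>, after integration by parts.\<close>

definition form :: "(real \<Rightarrow> complex) \<Rightarrow> (real \<Rightarrow> complex) \<Rightarrow> complex" where
  "form f g = ip a (l a q f) g - D a f a * cnj (g a)"

text \<open>The boundary term subtracted in \<open>form\<close> is exactly what Green's formula
  assigns to the asymmetry of \<open>l\<close>.\<close>

lemma form_cnj:
  assumes "f \<in> Hplus a q" "g \<in> Hplus a q"
  shows "cnj (form f g) = form g f"
  using green_formula[OF assms(2,1)] by (simp add: form_def bracket_def ip_cnj algebra_simps)

lemma form_lin_left: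
  assumes "f \<in> Hplus a q" "g \<in> Hplus a q" "k \<in> Hplus a q"
  shows "form (\<lambda>x. f x + c * g x) k = form f k + c * form g k"
  unfolding form_def
  by (simp add: ip_l_lin[OF assms(1,2) Hplus_D(1)[OF assms(3)]]
     regular_lin(2)[OF Hplus_D(2)[OF assms(1)] Hplus_D(2)[OF assms(2)]] algebra_simps)

lemma form_lin_right:
  assumes "f \<in> Hplus a q" "g \<in> Hplus a q" "k \<in> Hplus a q"
  shows "form k (\<lambda>x. f x + c * g x) = form k f + cnj c * form k g"
  unfolding form_def
  by (simp add: ip_lin_right[OF Hplus_D(1)[OF assms(1)] Hplus_D(1)[OF assms(2)] Hplus_D(3)[OF assms(3)]] algebra_simps)

lemma form_lin:
  assumes "f \<in> Hplus a q" "g \<in> Hplus a q"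
  shows "form (\<lambda>x. f x + c * g x) (\<lambda>x. f x + c * g x)
    = form f f + cnj c * form f g + c * cnj (form f g) + c * cnj c * form g g"
  by (simp add: form_lin_left[OF assms Hplus_lin[OF assms]] form_lin_right[OF assms assms(1)]
      form_lin_right[OF assms assms(2)] form_cnj[OF assms] algebra_simps)

text \<open>
  Cut \<open>\<phi>1\<close> off at distance \<open>e\<close>: the cut function is \<open>O(e)\<close> and its image under \<open>l\<close> is \<open>O(1/e)\<close>, on an
  interval of length \<open>e\<close>.
\<close>

lemma boundary_layer:
  assumes f: "f \<in> Hplus a q" and \<epsilon>: "\<epsilon> > 0"
  obtains \<xi> where "\<xi> \<in> Hplus a q" "\<xi> a = 0" "D a \<xi> a = 1"
    "cmod (ip a (l a q f) \<xi>) < \<epsilon>" "cmod (ip a (l a q \<xi>) \<xi>) < \<epsilon>"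
proof -
  have r: "\<phi>1 \<in> regular a" using sol1 by (simp add: solves_def)
  obtain M where M: "M > 0" "\<And>x. x \<in> {a..a+1} \<Longrightarrow> cmod (D a \<phi>1 x) \<le> M"
    "\<And>x. x \<in> {a..a+1} \<Longrightarrow> cmod (\<phi>1 x) \<le> M * (x - a)"
    using solution_bounds_near_a[OF r sol1(2)] by blast
  define F where "F = Re (ip a (l a q f) (l a q f))"
  have F: "F \<ge> 0" unfolding F_def by (rule ip_self_nonneg)
  \<comment> \<open>Collects the constants of the two estimates below,
    \<open>M * e * (1 + F)\<close> and \<open>6 * M\<^sup>2 * e\<close>, so that
    \<open>K * e < \<epsilon>\<close> settles both.\<close>
  define K where "K = M * (1 + F) + 6 * M\<^sup>2 + 1"
  have K: "K > 0" using M(1) F by (simp add: K_def add_nonneg_pos)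
  define e where "e = min 1 (\<epsilon> / (2 * K))"
  have e: "e > 0" "e \<le> 1" using K \<epsilon> by (auto simp: e_def)
  have "e \<le> \<epsilon> / (2 * K)" by (simp add: e_def)
  then have "K * e \<le> \<epsilon> / 2" using K by (simp add: field_simps)
  then have eK: "K * e < \<epsilon>" using \<epsilon> by simp
  define \<xi> where "\<xi> = (\<lambda>x. \<phi>1 x * cutoff a e x)"
  note C = cut_solution[OF e(1) sol1(1), folded \<xi>_def]
  have \<xi>: "\<xi> \<in> Hplus a q" "\<xi> a = 0" "D a \<xi> a = 1" using C(1,3) sol1 by (simp_all add: \<xi>_def)
  have b\<xi>: "cmod (\<xi> x) \<le> M * e * indicator {a..a+e} x" if x: "x \<ge> a" for x
  proof (cases "x \<le> a + e")
    case True
    have "cmod (\<xi> x) = cmod (\<phi>1 x) * (ramp a e x)\<^sup>2" by (simp add: \<xi>_def cutoff_def norm_mult norm_power)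
    also have "\<dots> \<le> M * (x - a) * 1"
      using ramp_bounds[OF e(1) x] M(3)[of x] M(1) True x e by (intro mult_mono) (auto simp: power_le_one)
    also have "\<dots> \<le> M * e" using M(1) True by simp
    finally show ?thesis using True x by simp
  next
    case False then show ?thesis using C(4)[of x] by (simp add: \<xi>_def)
  qed
  \<comment> \<open>On the layer the solution is at most \<open>M * e\<close>, which turns the
    \<open>2 / e\<^sup>2\<close> from the second derivative of the cutoff into
    \<open>2 * M / e\<close>; the mixed term adds \<open>4 * M / e\<close>.\<close>
  have bl: "AE x in lebesgue_on {a..}. cmod (l a q \<xi> x) \<le> 6 * M / e"
    using C(5) AE_space
  proof eventually_elim
    case (elim x)
    then have x: "x \<ge> a" by simp
    let ?k = "if x < a + e then complex_of_real (2 / e\<^sup>2) else 0"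
    show ?case
    proof (cases "x < a + e")
      case True
      have xs: "x \<in> {a..a+1}" using x True e by simp
      have "cmod (l a q \<xi> x) \<le> cmod (complex_of_real (4 / e * ramp a e x) * D a \<phi>1 x) + cmod (?k * \<phi>1 x)"
        unfolding elim(1) by (rule norm_triangle_ineq4)
      also have "\<dots> = \<bar>4 / e * ramp a e x\<bar> * cmod (D a \<phi>1 x) + \<bar>2 / e\<^sup>2\<bar> * cmod (\<phi>1 x)"
        using True by (simp only: norm_mult norm_of_real if_True)
      also have "\<dots> \<le> (4 / e) * M + 2 / e\<^sup>2 * (M * e)"
      proof (intro add_mono mult_mono)
        show "\<bar>4 / e * ramp a e x\<bar> \<le> 4 / e" using e ramp_bounds[OF e(1) x] by (simp add: divide_simps abs_mult)
        have "cmod (\<phi>1 x) \<le> M * (x - a)" by (rule M(3)[OF xs])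
        also have "\<dots> \<le> M * e" using M(1) True by simp
        finally show "cmod (\<phi>1 x) \<le> M * e" .
      qed (use M(2)[OF xs] M(1) e in auto)
      also have "\<dots> = 6 * M / e" using e by (simp add: power2_eq_square field_simps)
      finally show ?thesis .
    next
      case False
      then show ?thesis using elim(1) ramp_eq_0[OF e(1), of a x] M(1) e by simp
    qed
  qed
  have ae: "a \<le> a + e" using e by simp
  note ind = indicator_half_line[OF ae]
  have lfi: "integrable (lebesgue_on {a..}) (\<lambda>x. (cmod (l a q f x))\<^sup>2)" using Hplus_D(3)[OF f] by (simp add: L2_def)
  have 1: "cmod (ip a (l a q f) \<xi>) < \<epsilon>"
  proof -
    let ?h = "\<lambda>x. M * e * (indicator {a..a+e} x + (cmod (l a q f x))\<^sup>2)"
    have "cmod (ip a (l a q f) \<xi>) \<le> integral\<^sup>L (lebesgue_on {a..}) ?h"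
    proof (rule ip_bound[OF Hplus_D(3)[OF f] Hplus_D(1)[OF \<xi>(1)]])
      show "integrable (lebesgue_on {a..}) ?h" using ind(1) lfi by simp
      show "AE x in lebesgue_on {a..}. cmod (l a q f x) * cmod (\<xi> x) \<le> ?h x"
      proof (rule AE_I2)
        fix x assume "x \<in> space (lebesgue_on {a..})"
        then have x: "x \<ge> a" by simp
        let ?t = "cmod (l a q f x)"
        \<comment> \<open>Bounding \<open>?t\<close> by \<open>1 + ?t\<^sup>2\<close> makes the
          majorant integrable: the constant lives on the layer, the square on the whole
          half-line.\<close>
        have "2 * ?t \<le> ?t\<^sup>2 + 1" using zero_le_power2[of "?t - 1"] by (simp add: power2_diff)
        then have t: "?t \<le> 1 + ?t\<^sup>2" using norm_ge_zero[of "l a q f x"] by linarith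
        have "?t * cmod (\<xi> x) \<le> ?t * (M * e * indicator {a..a+e} x)" by (rule mult_left_mono[OF b\<xi>[OF x]]) simp
        also have "\<dots> = M * e * (?t * indicator {a..a+e} x)" by simp
        also have "\<dots> \<le> ?h x"
          by (rule mult_left_mono) (use t M(1) e in \<open>auto simp: indicator_def\<close>)
        finally show "?t * cmod (\<xi> x) \<le> ?h x" .
      qed
    qed
    also have "\<dots> = M * e * (e + F)"
      using ind lfi by (simp add: F_def ip_self)
    also have "\<dots> \<le> M * e * (1 + F)" using M(1) e by (intro mult_left_mono) auto
    also have "\<dots> \<le> K * e" using M(1) e by (simp add: K_def algebra_simps)
    also have "\<dots> < \<epsilon>" by (rule eK)
    finally show ?thesis .
  qed
  have 2: "cmod (ip a (l a q \<xi>) \<xi>) < \<epsilon>"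
  proof -
    let ?h = "\<lambda>x. 6 * M\<^sup>2 * indicator {a..a+e} x"
    have "cmod (ip a (l a q \<xi>) \<xi>) \<le> integral\<^sup>L (lebesgue_on {a..}) ?h"
    proof (rule ip_bound[OF Hplus_D(3)[OF \<xi>(1)] Hplus_D(1)[OF \<xi>(1)]])
      show "integrable (lebesgue_on {a..}) ?h" using ind(1) by simp
      show "AE x in lebesgue_on {a..}. cmod (l a q \<xi> x) * cmod (\<xi> x) \<le> ?h x"
        using bl AE_space
      proof eventually_elim
        case (elim x)
        then have x: "x \<ge> a" by simp
        have "cmod (l a q \<xi> x) * cmod (\<xi> x) \<le> (6 * M / e) * (M * e * indicator {a..a+e} x)"
          by (rule mult_mono[OF elim(1) b\<xi>[OF x]]) (use M(1) e in auto)
        also have "\<dots> = ?h x" using e by (simp add: power2_eq_square)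
        finally show ?case .
      qed
    qed
    also have "\<dots> = 6 * M\<^sup>2 * e" using ind by simp
    also have "\<dots> \<le> K * e" using M(1) e F by (simp add: K_def mult_right_mono)
    also have "\<dots> < \<epsilon>" by (rule eK)
    finally show ?thesis .
  qed
  show thesis by (rule that[OF \<xi> 1 2])
qed

text \<open>Adding a multiple of the boundary layer \<open>\<xi>\<close> changes the derivative at
  \<open>a\<close> but not the value. Since \<open>\<xi> a = 0\<close>, the boundary terms of
  \<open>form f \<xi>\<close> and \<open>form \<xi> \<xi>\<close> vanish, and the remaining inner
  products are as small as desired.\<close>

lemma change_derivative:
  assumes f: "f \<in> Hplus a q" and \<epsilon>: "\<epsilon> > 0"
  obtains g where "g \<in> Hplus a q" "g a = f a" "D a g a = d" "\<bar>Re (form g g) - Re (form f f)\<bar> < \<epsilon>"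
proof -
  define c where "c = d - D a f a"
  define K where "K = 2 * cmod c + (cmod c)\<^sup>2 + 1"
  have K: "K > 0" by (simp add: K_def add_nonneg_pos)
  define t where "t = \<epsilon> / K"
  have t: "t > 0" "K * t = \<epsilon>" using K \<epsilon> by (simp_all add: t_def)
  obtain \<xi> where \<xi>: "\<xi> \<in> Hplus a q" "\<xi> a = 0" "D a \<xi> a = 1"
    "cmod (ip a (l a q f) \<xi>) < t" "cmod (ip a (l a q \<xi>) \<xi>) < t"
    using boundary_layer[OF f t(1)] by blast
  let ?g = "\<lambda>x. f x + c * \<xi> x"
  have b: "cmod (form f \<xi>) < t" "cmod (form \<xi> \<xi>) < t" using \<xi> by (simp_all add: form_def)
  have "form ?g ?g - form f f = cnj c * form f \<xi> + (c * cnj (form f \<xi>) + c * cnj c * form \<xi> \<xi>)"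
    using form_lin[OF f \<xi>(1), of c] by simp
  then have "cmod (form ?g ?g - form f f) \<le> cmod (cnj c * form f \<xi>) + (cmod (c * cnj (form f \<xi>)) + cmod (c * cnj c * form \<xi> \<xi>))"
    by (metis (no_types, lifting) add_left_mono norm_triangle_ineq order_trans)
  also have "\<dots> = 2 * cmod c * cmod (form f \<xi>) + (cmod c)\<^sup>2 * cmod (form \<xi> \<xi>)"
    by (simp add: norm_mult power2_eq_square)
  also have "\<dots> \<le> 2 * cmod c * t + (cmod c)\<^sup>2 * t"
    using b by (intro add_mono mult_left_mono) auto
  also have "\<dots> = (K - 1) * t" by (simp add: K_def algebra_simps)
  also have "\<dots> < K * t" using t(1) by (simp add: left_diff_distrib)
  also have "\<dots> = \<epsilon>" by (rule t(2))
  finally have "\<bar>Re (form ?g ?g) - Re (form f f)\<bar> < \<epsilon>"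
    using abs_Re_le_cmod[of "form ?g ?g - form f f"] by simp
  moreover have "D a ?g a = d"
    using regular_lin(2)[OF Hplus_D(2)[OF f] Hplus_D(2)[OF \<xi>(1)], of a c] \<xi>(3) by (simp add: c_def)
  ultimately show thesis using that[OF Hplus_lin[OF f \<xi>(1)]] \<xi>(2) by simp
qed

lemma form_nonneg:
  assumes f: "f \<in> Hplus a q" and fa: "f a = 0"
  shows "0 \<le> Re (form f f)"
proof (rule field_le_epsilon)
  fix \<epsilon> :: real assume "\<epsilon> > 0"
  then obtain g where g: "g \<in> Hplus a q" "g a = f a" "D a g a = 0" "\<bar>Re (form g g) - Re (form f f)\<bar> < \<epsilon>"
    using change_derivative[OF f] by blast
  then have "g \<in> Dom_min a q" using fa by (simp add: Dom_min_def)
  then have "0 \<le> Re (ip a (l a q g) g)" using nonneg by (simp add: nonneg_op_def)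
  then have "0 \<le> Re (form g g)" using g by (simp add: form_def)
  then show "0 \<le> Re (form f f) + \<epsilon>" using g(4) by linarith
qed

lemma weyl_solution_Hplus:
  assumes "solves a q z \<psi>" "\<psi> \<in> L2 a"
  shows "\<psi> \<in> Hplus a q" "k \<in> L2 a \<Longrightarrow> ip a (l a q \<psi>) k = z * ip a \<psi> k"
proof -
  have ae: "AE x in lebesgue_on {a..}. l a q \<psi> x = z * \<psi> x" and r: "\<psi> \<in> regular a"
    using assms(1) by (auto simp: solves_def)
  have zL: "(\<lambda>x. z * \<psi> x) \<in> L2 a" by (rule L2_cmult[OF assms(2)])
  show "\<psi> \<in> Hplus a q" using L2_AE[OF zL ae] r assms(2) by (simp add: Hplus_def)
  show "ip a (l a q \<psi>) k = z * ip a \<psi> k" if "k \<in> L2 a"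
    using ip_AE_left[OF zL that ae] by (simp add: ip_cmult_left)
qed

text \<open>\<open>g = f + f(a) \<psi>\<close> vanishes at \<open>a\<close>. Because \<psi> solves
  the equation at \<open>x\<close>, the form \<open>form - x ip\<close> has no cross terms between
  \<open>g\<close> and \<psi>. Its value on \<psi> is \<open>D a \<psi> a\<close>, and on
  \<open>g\<close> it is non-negative as \<open>x \<le> 0\<close>.\<close>

lemma weyl_form_bound:
  fixes x :: real
  assumes sol: "solves a q (complex_of_real x) \<psi>" "\<psi> \<in> L2 a" "\<psi> a = -1" and x: "x \<le> 0"
    and f: "f \<in> Hplus a q"
  shows "Re (D a \<psi> a) * (cmod (f a))\<^sup>2 + x * Re (ip a f f) \<le> Re (form f f)"
proof -
  note \<psi> = weyl_solution_Hplus[OF sol(1,2)]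
  define c where "c = f a"
  define g where "g = (\<lambda>x. f x + c * \<psi> x)"
  have g: "g \<in> Hplus a q" "g a = 0" using Hplus_lin[OF f \<psi>(1)] sol(3) by (simp_all add: g_def c_def)
  have fg: "f = (\<lambda>x. g x + (- c) * \<psi> x)" by (simp add: g_def)
  have B1: "form \<psi> g = x * ip a \<psi> g" using \<psi>(2)[OF Hplus_D(1)[OF g(1)]] g(2) by (simp add: form_def)
  have B2: "form \<psi> \<psi> = x * ip a \<psi> \<psi> + D a \<psi> a" using \<psi>(2)[OF sol(2)] sol(3) by (simp add: form_def)
  have B3: "form g \<psi> = x * ip a g \<psi>"
    using form_cnj[OF \<psi>(1) g(1)] B1 by (simp add: ip_cnj flip: form_cnj[OF \<psi>(1) g(1)])
  have "form f f = form g g + cnj (- c) * form g \<psi> + (- c) * cnj (form g \<psi>) + (- c) * cnj (- c) * form \<psi> \<psi>"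
    by (subst (1 2) fg) (rule form_lin[OF g(1) \<psi>(1)])
  moreover have "ip a f f = ip a g g + cnj (- c) * ip a g \<psi> + (- c) * cnj (ip a g \<psi>) + (- c) * cnj (- c) * ip a \<psi> \<psi>"
  proof -
    note L = Hplus_D(1)[OF g(1)] sol(2)
    have "ip a f f = ip a g f + (- c) * ip a \<psi> f"
      by (subst (1) fg) (rule ip_lin_left[OF L Hplus_D(1)[OF f]])
    moreover have "ip a g f = ip a g g + cnj (- c) * ip a g \<psi>" by (subst fg) (rule ip_lin_right[OF L L(1)])
    moreover have "ip a \<psi> f = ip a \<psi> g + cnj (- c) * ip a \<psi> \<psi>" by (subst fg) (rule ip_lin_right[OF L L(2)])
    ultimately show ?thesis by (simp add: ip_cnj algebra_simps)
  qed
  then have "ip a f f - ip a g g = cnj (- c) * ip a g \<psi> + (- c) * cnj (ip a g \<psi>) + (- c) * cnj (- c) * ip a \<psi> \<psi>"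
    by simp
  \<comment> \<open>The cross terms of \<open>form f f\<close> are \<open>x\<close> times those of
    \<open>ip a f f\<close>; eliminating them leaves the boundary contribution of \<psi>.\<close>
  ultimately have "form f f = form g g + x * (ip a f f - ip a g g) + c * cnj c * D a \<psi> a"
    by (simp only: B2 B3) (simp add: algebra_simps ip_cnj)
  then have "Re (form f f) = Re (form g g) + x * (Re (ip a f f) - Re (ip a g g)) + Re (D a \<psi> a) * (cmod c)\<^sup>2"
    by (simp add: complex_norm_square[symmetric] flip: of_real_power)
  moreover have "0 \<le> Re (form g g)" by (rule form_nonneg[OF g])
  moreover have "x * Re (ip a g g) \<le> 0" using x ip_self_nonneg by (simp add: mult_nonpos_nonneg)
  ultimately show ?thesis by (simp add: c_def algebra_simps)
qed

text \<open>The derivative at \<open>a\<close> is the difference of two Hermitian quantities, hence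
  real.\<close>

lemma weyl_value_real:
  fixes x :: real
  assumes sol: "solves a q (complex_of_real x) \<psi>" "\<psi> \<in> L2 a" "\<psi> a = -1"
  shows "Im (D a \<psi> a) = 0" "Re (form \<psi> \<psi>) = x * Re (ip a \<psi> \<psi>) + Re (D a \<psi> a)"
proof -
  note \<psi> = weyl_solution_Hplus[OF sol(1,2)]
  have B2: "form \<psi> \<psi> = x * ip a \<psi> \<psi> + D a \<psi> a" using \<psi>(2)[OF sol(2)] sol(3) by (simp add: form_def)
  then show "Re (form \<psi> \<psi>) = x * Re (ip a \<psi> \<psi>) + Re (D a \<psi> a)" by simp
  have "Im (form \<psi> \<psi>) = 0" using form_cnj[OF \<psi>(1) \<psi>(1)] by (metis cnj.simps(2) equation_minus_iff neg_equal_zero)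
  moreover have "Im (ip a \<psi> \<psi>) = 0" by (simp add: ip_self)
  ultimately show "Im (D a \<psi> a) = 0" using B2 by simp
qed


section \<open>The star-extensions and the impedance function\<close>

text \<open>The boundary value paired with by \<open>\<mu> \<delta> + \<delta>'\<close>.\<close>

definition co_value :: "real \<Rightarrow> (real \<Rightarrow> complex) \<Rightarrow> complex" where
  "co_value \<mu> f = complex_of_real \<mu> * f a - D a f a"

lemma co_value_lin:
  assumes "f \<in> Hplus a q" "g \<in> Hplus a q"
  shows "co_value \<mu> (\<lambda>x. f x + c * g x) = co_value \<mu> f + c * co_value \<mu> g"
  using regular_lin(2)[OF Hplus_D(2)[OF assms(1)] Hplus_D(2)[OF assms(2)], of a c]
  by (simp add: co_value_def algebra_simps)

text \<open>In terms of \<open>co_value\<close> the factor \<open>D a f a - h * f a\<close> is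
  \<open>(\<mu> - h) * f a - co_value \<mu> f\<close>, so the non-real denominator survives only in
  the term that is quadratic in \<open>co_value\<close>.\<close>

lemma star_ext_form:
  assumes h: "Im h \<noteq> 0"
  shows "star_ext a q h \<mu> f g = form f g + \<mu> * f a * cnj (g a) - co_value \<mu> f * cnj (g a)
     - f a * cnj (co_value \<mu> g) + co_value \<mu> f * cnj (co_value \<mu> g) / (complex_of_real \<mu> - h)"
proof -
  have nz: "complex_of_real \<mu> - h \<noteq> 0" using h by (auto simp: complex_eq_iff)
  have "D a f a - h * f a = (complex_of_real \<mu> - h) * f a - co_value \<mu> f"
    by (simp add: co_value_def algebra_simps)
  moreover have "complex_of_real \<mu> * delta a g + delta' a g = cnj (co_value \<mu> g)"
    by (simp add: co_value_def delta_def delta'_def)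
  ultimately have "star_ext a q h \<mu> f g = ip a (l a q f) g
      - 1 / (complex_of_real \<mu> - h) * ((complex_of_real \<mu> - h) * f a - co_value \<mu> f) * cnj (co_value \<mu> g)"
    by (simp add: star_ext_def)
  also have "\<dots> = ip a (l a q f) g - f a * cnj (co_value \<mu> g)
      + co_value \<mu> f * cnj (co_value \<mu> g) / (complex_of_real \<mu> - h)"
    using nz by (simp add: field_simps)
  also have "ip a (l a q f) g = form f g + D a f a * cnj (g a)" by (simp add: form_def)
  also have "D a f a = \<mu> * f a - co_value \<mu> f" by (simp add: co_value_def)
  finally show ?thesis by (simp add: algebra_simps)
qed

lemma inverse_shift:
  assumes "Im h \<noteq> 0"
  shows "1 / (complex_of_real \<mu> - h)
    = Complex ((\<mu> - Re h) / ((\<mu> - Re h)\<^sup>2 + (Im h)\<^sup>2)) (Im h / ((\<mu> - Re h)\<^sup>2 + (Im h)\<^sup>2))"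
  by (simp add: complex_eq_iff Re_divide Im_divide)

text \<open>All terms except the last are Hermitian already; the last one keeps the real part of
  \<open>1 / (\<mu> - h)\<close>.\<close>

lemma Re_op_star_ext:
  assumes h: "Im h \<noteq> 0" and f: "f \<in> Hplus a q" and g: "g \<in> Hplus a q"
  shows "Re_op (star_ext a q h \<mu>) f g = form f g + \<mu> * f a * cnj (g a) - co_value \<mu> f * cnj (g a)
     - f a * cnj (co_value \<mu> g)
     + complex_of_real ((\<mu> - Re h) / ((\<mu> - Re h)\<^sup>2 + (Im h)\<^sup>2)) * co_value \<mu> f * cnj (co_value \<mu> g)"
proof -
  let ?N = "(\<mu> - Re h)\<^sup>2 + (Im h)\<^sup>2" and ?i = "1 / (complex_of_real \<mu> - h)"
  define r where "r = complex_of_real ((\<mu> - Re h) / ?N)"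
  have i: "?i + cnj ?i = 2 * r"
    unfolding inverse_shift[OF h] r_def by (simp add: complex_eq_iff)
  have "Re_op (star_ext a q h \<mu>) f g = (form f g + cnj (form g f)) / 2 + \<mu> * f a * cnj (g a)
     - co_value \<mu> f * cnj (g a) - f a * cnj (co_value \<mu> g)
     + (?i + cnj ?i) / 2 * co_value \<mu> f * cnj (co_value \<mu> g)"
    unfolding Re_op_def adj_op_def star_ext_form[OF h] by (simp add: field_simps)
  then show ?thesis unfolding i r_def[symmetric] using form_cnj[OF g f] by simp
qed

lemma star_ext_quadratic:
  fixes \<mu> :: real
  assumes h: "Im h \<noteq> 0" and f: "f \<in> Hplus a q"
  defines "N \<equiv> (\<mu> - Re h)\<^sup>2 + (Im h)\<^sup>2"
  shows "Re (star_ext a q h \<mu> f f) = Re (form f f) + \<mu> * (cmod (f a))\<^sup>2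
      - 2 * Re (co_value \<mu> f * cnj (f a)) + (\<mu> - Re h) / N * (cmod (co_value \<mu> f))\<^sup>2"
    "Im (star_ext a q h \<mu> f f) = Im h / N * (cmod (co_value \<mu> f))\<^sup>2"
proof -
  let ?w = "co_value \<mu> f"
  have "Im (cnj (form f f)) = Im (form f f)" using form_cnj[OF f f] by simp
  then have im: "Im (form f f) = 0" by simp
  have "star_ext a q h \<mu> f f = form f f + complex_of_real (\<mu> * (cmod (f a))\<^sup>2)
     - (?w * cnj (f a) + cnj (?w * cnj (f a))) + complex_of_real ((cmod ?w)\<^sup>2) * (1 / (complex_of_real \<mu> - h))"
    unfolding star_ext_form[OF h] by (simp add: complex_norm_square algebra_simps del: of_real_power)
  then have *: "star_ext a q h \<mu> f f = form f f + complex_of_real (\<mu> * (cmod (f a))\<^sup>2)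
     - complex_of_real (2 * Re (?w * cnj (f a))) + complex_of_real ((cmod ?w)\<^sup>2) * Complex ((\<mu> - Re h) / N) (Im h / N)"
    unfolding complex_add_cnj inverse_shift[OF h] N_def .
  show "Re (star_ext a q h \<mu> f f) = Re (form f f) + \<mu> * (cmod (f a))\<^sup>2
      - 2 * Re (?w * cnj (f a)) + (\<mu> - Re h) / N * (cmod ?w)\<^sup>2"
    unfolding * by simp
  show "Im (star_ext a q h \<mu> f f) = Im h / N * (cmod ?w)\<^sup>2"
    unfolding * by (simp add: im)
qed

text \<open>The denominator is the familiar \<open>(\<mu> - Re h) * m + \<mu> * Re h - |h|^2\<close>
  with \<open>m = D a \<psi> a\<close>, arranged so that its sign is visible.\<close>

lemma impedance_value:
  fixes x :: real
  assumes h: "Im h > 0" and acc: "accretive a q (schrodinger_system a q h \<mu>)" and x: "x < 0"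
    and sol: "solves a q (complex_of_real x) \<psi>" "\<psi> \<in> L2 a" "\<psi> a = -1"
    and nz: "(Re (D a \<psi> a) + Re h) * (\<mu> - Re h) - (Im h)\<^sup>2 \<noteq> 0"
  shows "impedance a q (schrodinger_system a q h \<mu>) (complex_of_real x)
    = complex_of_real (Im h * (Re (D a \<psi> a) + \<mu>) / ((Re (D a \<psi> a) + Re h) * (\<mu> - Re h) - (Im h)\<^sup>2))"
proof -
  let ?A = "star_ext a q h \<mu>"
  define m s k N d where "m = Re (D a \<psi> a)" and "s = \<mu> - Re h" and "k = Im h" and "N = s\<^sup>2 + k\<^sup>2"
    and "d = (m + Re h) * s - k\<^sup>2"
  have k: "k > 0" "Im h \<noteq> 0" using h by (simp_all add: k_def)
  have N: "N > 0" using k by (simp add: N_def add_nonneg_pos)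
  have d: "d \<noteq> 0" using nz by (simp add: d_def m_def s_def k_def)
  define \<kappa> where "\<kappa> = sqrt k / cmod (complex_of_real \<mu> - h)"
  have "(cmod (complex_of_real \<mu> - h))\<^sup>2 = N" by (simp add: cmod_power2 N_def s_def k_def)
  then have \<kappa>2: "\<kappa> * \<kappa> = k / N" using k by (simp add: \<kappa>_def power2_eq_square[symmetric] power_divide)
  \<comment> \<open>Inserting \<open>y = c \<psi>\<close> into \<open>(Re A - x) y = K 1\<close> leaves only boundary terms and determines \<open>c\<close>.\<close>
  define c where "c = - \<kappa> * N / d"
  note \<psi> = weyl_solution_Hplus[OF sol(1,2)]
  have D\<psi>: "D a \<psi> a = complex_of_real m"
    using weyl_value_real(1)[OF sol] by (simp add: complex_eq_iff m_def)
  \<comment> \<open>This is \<open>c\<close> times \<psi>, written so that the lemmas on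
    \<open>f + c * g\<close> apply.\<close>
  define y where "y = (\<lambda>t. \<psi> t + complex_of_real (c - 1) * \<psi> t)"
  have y: "y \<in> Hplus a q" unfolding y_def by (rule Hplus_lin[OF \<psi>(1) \<psi>(1)])
  have ya: "y a = complex_of_real (- c)" by (simp add: y_def sol(3) algebra_simps)
  have wy: "co_value \<mu> y = complex_of_real (- c * (\<mu> + m))"
    unfolding y_def co_value_lin[OF \<psi>(1) \<psi>(1)] by (simp add: co_value_def sol(3) D\<psi> algebra_simps)
  have chan: "channel_op (schrodinger_system a q h \<mu>) 1 f = \<kappa> * cnj (co_value \<mu> f)" for f
    by (simp add: schrodinger_system_def \<kappa>_def k_def co_value_def delta_def delta'_def)
  have chan_adj: "channel_adj (schrodinger_system a q h \<mu>) f = \<kappa> * co_value \<mu> f" for f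
    by (simp add: channel_adj_def chan)
  have st: "state_op (schrodinger_system a q h \<mu>) = ?A" by (simp add: schrodinger_system_def)
  \<comment> \<open>Turns the coefficient \<open>c * (N - s * (\<mu> + m)) / N\<close> met below
    into \<open>- c * d / N\<close>, which explains the choice of \<open>c\<close>.\<close>
  have sN: "s * (\<mu> + m) = N + d" by (simp add: N_def d_def s_def power2_eq_square algebra_simps)
  have key: "Re_op ?A y f - complex_of_real x * ip a y f = \<kappa> * cnj (co_value \<mu> f)" if f: "f \<in> Hplus a q" for f
  proof -
    have F: "form \<psi> f = x * ip a \<psi> f - m * cnj (f a)"
      using \<psi>(2)[OF Hplus_D(1)[OF f]] by (simp add: form_def D\<psi>)
    have Fy: "form y f = c * (x * ip a \<psi> f - m * cnj (f a))"
      unfolding y_def form_lin_left[OF \<psi>(1) \<psi>(1) f] F by (simp add: algebra_simps)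
    have Iy: "ip a y f = c * ip a \<psi> f"
      unfolding y_def ip_lin_left[OF sol(2) sol(2) Hplus_D(1)[OF f]] by (simp add: algebra_simps)
    define r where "r = s / N"
    have "Re_op ?A y f - complex_of_real x * ip a y f
       = complex_of_real (c - r * (c * (\<mu> + m))) * cnj (co_value \<mu> f)"
      unfolding Re_op_star_ext[OF k(2) y f, of \<mu>, folded s_def k_def, folded N_def, folded r_def] ya wy Fy Iy
      by (simp add: algebra_simps co_value_def)
    also have "c - r * (c * (\<mu> + m)) = c - s / N * (c * (\<mu> + m))" by (simp add: r_def)
    also have "c - s / N * (c * (\<mu> + m)) = c * (N - s * (\<mu> + m)) / N" using N by (simp add: field_simps)
    also have "\<dots> = \<kappa>" unfolding sN c_def using N d by simp
    finally show ?thesis .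
  qed
  have "impedance a q (schrodinger_system a q h \<mu>) (complex_of_real x) = \<kappa> * co_value \<mu> y"
    unfolding impedance_def st chan chan_adj
  proof (rule the_equality)
    show "\<exists>y'\<in>Hplus a q. (\<forall>f\<in>Hplus a q. Re_op ?A y' f - complex_of_real x * ip a y' f = \<kappa> * cnj (co_value \<mu> f)) \<and>
        complex_of_real \<kappa> * co_value \<mu> y = complex_of_real \<kappa> * co_value \<mu> y'"
      using y key by blast
    \<comment> \<open>Accretivity makes the solution unique, since \<open>x < 0\<close>.\<close>
    fix v assume "\<exists>y'\<in>Hplus a q. (\<forall>f\<in>Hplus a q. Re_op ?A y' f - complex_of_real x * ip a y' f = \<kappa> * cnj (co_value \<mu> f)) \<and>
        v = complex_of_real \<kappa> * co_value \<mu> y'"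
    then obtain y' where y': "y' \<in> Hplus a q"
      "\<forall>f\<in>Hplus a q. Re_op ?A y' f - complex_of_real x * ip a y' f = \<kappa> * cnj (co_value \<mu> f)"
      "v = complex_of_real \<kappa> * co_value \<mu> y'" by blast
    define z where "z = (\<lambda>t. y' t + (-1) * y t)"
    have z: "z \<in> Hplus a q" unfolding z_def by (rule Hplus_lin[OF y'(1) y])
    have za: "z a = y' a - y a" by (simp add: z_def)
    \<comment> \<open>\<open>P\<close> and \<open>R\<close> are the coefficients of
      \<open>f a\<close> and \<open>co_value \<mu> f\<close> for a fixed second argument
      \<open>z\<close>, so that linearity in the first argument can be read off.\<close>
    define P where "P = complex_of_real \<mu> * cnj (z a) - cnj (co_value \<mu> z)"
    define R where "R = complex_of_real ((\<mu> - Re h) / ((\<mu> - Re h)\<^sup>2 + (Im h)\<^sup>2)) * cnj (co_value \<mu> z) - cnj (z a)"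
    have sesq: "Re_op ?A f z = form f z + f a * P + co_value \<mu> f * R" if "f \<in> Hplus a q" for f
      unfolding Re_op_star_ext[OF k(2) that z] P_def R_def right_diff_distrib by (simp only: mult_ac) algebra
    have e: "form z z = form y' z - form y z" "co_value \<mu> z = co_value \<mu> y' - co_value \<mu> y"
      using form_lin_left[OF y'(1) y z, of "-1", folded z_def] co_value_lin[OF y'(1) y, of \<mu> "-1", folded z_def] by simp_all
    have "Re_op ?A z z = Re_op ?A y' z - Re_op ?A y z"
      unfolding sesq[OF z] sesq[OF y] sesq[OF y'(1)] e za by (simp add: algebra_simps)
    also have "\<dots> = complex_of_real x * (ip a y' z - ip a y z)"
      using y'(2)[rule_format, OF z] key[OF z] by (simp add: algebra_simps)
    also have "ip a y' z - ip a y z = ip a z z"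
      using ip_lin_left[OF Hplus_D(1)[OF y'(1)] Hplus_D(1)[OF y] Hplus_D(1)[OF z], of "-1", folded z_def] by simp
    finally have "Re (Re_op ?A z z) = x * Re (ip a z z)" by simp
    moreover have "Re (Re_op ?A z z) \<ge> 0"
      using acc z by (simp add: Re_op_def adj_op_def accretive_def st)
    ultimately have "x * Re (ip a z z) \<ge> 0" by simp
    then have "Re (ip a z z) \<le> 0" using x by (simp add: zero_le_mult_iff)
    then have "Re (ip a z z) = 0" using ip_self_nonneg[of a z] by simp
    from ip_self_eq_0[OF Hplus_D(1,2)[OF z] this] have "co_value \<mu> z = 0" by (simp add: co_value_def)
    then have "co_value \<mu> y' = co_value \<mu> y"
      using co_value_lin[OF y'(1) y, of \<mu> "-1", folded z_def] by simp
    then show "v = complex_of_real \<kappa> * co_value \<mu> y" using y'(3) by simp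
  qed
  also have "\<dots> = complex_of_real (\<kappa> * (- c * (\<mu> + m)))" by (simp add: wy)
  also have "\<kappa> * (- c * (\<mu> + m)) = (\<kappa> * \<kappa>) * N / d * (\<mu> + m)" by (simp add: c_def)
  also have "\<dots> = k * (m + \<mu>) / d" unfolding \<kappa>2 using N by (simp add: add.commute)
  finally show ?thesis by (simp only: m_def k_def s_def d_def)
qed

text \<open>Since \<psi> has value -1 at \<open>a\<close>, changing its derivative there to
  \<open>- h\<close> puts it into \<open>Dom_T\<close> at negligible cost. Sectoriality is then
  tested on the result, where \<open>ip a (l a q g) g = form g g + h\<close>, and
  \<open>form \<psi> \<psi>\<close> is at most \<open>D a \<psi> a\<close> because
  \<open>x \<le> 0\<close>. The lower bound does not depend on \<open>x\<close>.\<close>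

lemma sectorial_weyl_lower_bound:
  fixes x :: real
  assumes sec: "sectorial_op a (Dom_T a q h) (l a q) \<theta>" and h: "Im h > 0" and x: "x \<le> 0"
    and sol: "solves a q (complex_of_real x) \<psi>" "\<psi> \<in> L2 a" "\<psi> a = -1"
  shows "cot \<theta> * Im h \<le> Re (D a \<psi> a) + Re h"
proof (rule field_le_epsilon)
  fix \<epsilon> :: real assume "\<epsilon> > 0"
  then obtain g where g: "g \<in> Hplus a q" "g a = \<psi> a" "D a g a = - h" "\<bar>Re (form g g) - Re (form \<psi> \<psi>)\<bar> < \<epsilon>"
    using change_derivative[OF weyl_solution_Hplus(1)[OF sol(1,2)]] by blast
  then have "g \<in> Dom_T a q h" using sol(3) by (simp add: Dom_T_def)
  then have "cot \<theta> * \<bar>Im (ip a (l a q g) g)\<bar> \<le> Re (ip a (l a q g) g)"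
    using sec by (simp add: sectorial_op_def)
  moreover have "ip a (l a q g) g = form g g + h" using g sol(3) by (simp add: form_def)
  moreover have "Im (form g g) = 0"
  proof -
    have "Im (cnj (form g g)) = Im (form g g)" using form_cnj[OF g(1) g(1)] by simp
    then show ?thesis by simp
  qed
  ultimately have "cot \<theta> * Im h \<le> Re (form g g) + Re h" using h by simp
  moreover have "Re (form \<psi> \<psi>) \<le> Re (D a \<psi> a)"
    using weyl_value_real(2)[OF sol] mult_nonpos_nonneg[OF x ip_self_nonneg[of a \<psi>]] by simp
  ultimately show "cot \<theta> * Im h \<le> Re (D a \<psi> a) + Re h + \<epsilon>" using g(4) by linarith
qed

text \<open>With \<open>p + s = m0 + \<mu>\<close>, the best \<open>u\<close> for given
  \<open>w\<close> is \<open>w / (p + s)\<close>, and what remains of the real part is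
  \<open>(p * s - k\<^sup>2) / (p + s)\<close> times \<open>w\<^sup>2 / N\<close>. The common factor
  \<open>w\<^sup>2 / N\<close> also governs the imaginary part, so the ratio depends on
  \<open>s\<close> alone and is worst at the smallest parameter.\<close>

lemma star_ext_sectorial_estimate:
  assumes h: "Im h > 0" and p: "m0 + Re h > 0"
    and form: "\<And>f. f \<in> Hplus a q \<Longrightarrow> m0 * (cmod (f a))\<^sup>2 \<le> Re (form f f)"
    and s: "(Im h)\<^sup>2 < (m0 + Re h) * (\<mu>s - Re h)" and \<mu>: "\<mu>s \<le> \<mu>" and f: "f \<in> Hplus a q"
  defines "T \<equiv> Im h * (m0 + \<mu>s) / ((m0 + Re h) * (\<mu>s - Re h) - (Im h)\<^sup>2)"
  shows "\<bar>Im (star_ext a q h \<mu> f f)\<bar> \<le> T * Re (star_ext a q h \<mu> f f)"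
proof -
  define p s0 s k N where "p = m0 + Re h" and "s0 = \<mu>s - Re h" and "s = \<mu> - Re h" and "k = Im h" and "N = s\<^sup>2 + k\<^sup>2"
  have pk: "p > 0" "k > 0" using p h by (simp_all add: p_def k_def)
  have s0: "k\<^sup>2 < p * s0" using s by (simp add: p_def s0_def k_def)
  then have "0 < p * s0" using zero_le_power2[of k] by linarith
  then have s0p: "s0 > 0" using pk(1) by (simp add: zero_less_mult_iff)
  have sp: "s \<ge> s0" using \<mu> by (simp add: s_def s0_def)
  have N: "N > 0" using pk by (simp add: N_def add_nonneg_pos)
  define u w where "u = cmod (f a)" and "w = cmod (co_value \<mu> f)"
  have uw: "u \<ge> 0" "w \<ge> 0" by (simp_all add: u_def w_def)
  \<comment> \<open>Monotonicity in \<open>s\<close>: the derivative of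
    \<open>(p * s - k\<^sup>2) / (p + s)\<close> is
    \<open>(p\<^sup>2 + k\<^sup>2) / (p + s)\<^sup>2\<close>; the identity is its cross-multiplied
    difference version.\<close>
  have r: "(p * s0 - k\<^sup>2) / (p + s0) \<le> (p * s - k\<^sup>2) / (p + s)"
  proof -
    have "(p * s0 - k\<^sup>2) * (p + s) + (s - s0) * (p\<^sup>2 + k\<^sup>2) = (p * s - k\<^sup>2) * (p + s0)"
      by (simp add: power2_eq_square algebra_simps)
    moreover have "0 \<le> (s - s0) * (p\<^sup>2 + k\<^sup>2)" using sp by simp
    ultimately have "(p * s0 - k\<^sup>2) * (p + s) \<le> (p * s - k\<^sup>2) * (p + s0)" by linarith
    then show ?thesis using pk s0p sp by (simp add: divide_simps)
  qed
  have im: "Im (star_ext a q h \<mu> f f) = k / N * w\<^sup>2"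
    using star_ext_quadratic(2)[of h f \<mu>] h f by (simp add: k_def N_def s_def w_def)
  \<comment> \<open>The phases of \<open>f a\<close> and \<open>co_value\<close> are free, so the
    cross term is replaced by its worst case and only moduli remain.\<close>
  have "Re (co_value \<mu> f * cnj (f a)) \<le> w * u"
    using complex_Re_le_cmod[of "co_value \<mu> f * cnj (f a)"] by (simp add: norm_mult u_def w_def)
  then have re: "(p + s) * u\<^sup>2 - 2 * (w * u) + s / N * w\<^sup>2 \<le> Re (star_ext a q h \<mu> f f)"
    using star_ext_quadratic(1)[of h f \<mu>] h f form[OF f]
    by (simp add: p_def k_def N_def s_def w_def u_def algebra_simps)
  have ps: "p + s > 0" using pk s0p sp by linarith
  \<comment> \<open>Completing the square in \<open>u\<close>.\<close>
  have "0 \<le> ((p + s) * u - w)\<^sup>2 / (p + s)" using ps by simp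
  also have "\<dots> = (p + s) * u\<^sup>2 - 2 * (w * u) + w\<^sup>2 / (p + s)"
    using ps by (simp add: power2_eq_square field_simps)
  finally have "s / N * w\<^sup>2 - w\<^sup>2 / (p + s) \<le> Re (star_ext a q h \<mu> f f)" using re by linarith
  moreover have "s / N * w\<^sup>2 - w\<^sup>2 / (p + s) = (p * s - k\<^sup>2) / (p + s) * (w\<^sup>2 / N)"
  proof -
    have "s / N - 1 / (p + s) = (s * (p + s) - N) / (N * (p + s))" using N ps by (simp add: field_simps)
    also have "s * (p + s) - N = p * s - k\<^sup>2" by (simp add: N_def power2_eq_square algebra_simps)
    finally have *: "s / N - 1 / (p + s) = (p * s - k\<^sup>2) / (N * (p + s))" .
    have "s / N * w\<^sup>2 - w\<^sup>2 / (p + s) = (s / N - 1 / (p + s)) * w\<^sup>2" by (simp add: left_diff_distrib)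
    then show ?thesis unfolding * by (simp add: mult.commute)
  qed
  moreover have "(p * s0 - k\<^sup>2) / (p + s0) * (w\<^sup>2 / N) \<le> (p * s - k\<^sup>2) / (p + s) * (w\<^sup>2 / N)"
    by (rule mult_right_mono[OF r]) (use N in simp)
  ultimately have lower: "(p * s0 - k\<^sup>2) / (p + s0) * (w\<^sup>2 / N) \<le> Re (star_ext a q h \<mu> f f)" by linarith
  have T: "T = k * (p + s0) / (p * s0 - k\<^sup>2)" by (simp add: T_def p_def s0_def k_def)
  have "T > 0" unfolding T using pk s0 s0p by simp
  have "\<bar>Im (star_ext a q h \<mu> f f)\<bar> = k / N * w\<^sup>2" unfolding im using pk N by simp
  also have "\<dots> = T * ((p * s0 - k\<^sup>2) / (p + s0) * (w\<^sup>2 / N))"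
    unfolding T using s0 pk s0p by simp
  also have "\<dots> \<le> T * Re (star_ext a q h \<mu> f f)" by (rule mult_left_mono[OF lower]) (use \<open>T > 0\<close> in simp)
  finally show ?thesis .
qed

end

section \<open>Passage to the limit at -0 and the sector angle\<close>

theorem theorem5:
  fixes a :: real and q :: "real \<Rightarrow> real" and h :: complex
    and \<phi>1 \<phi>2 :: "complex \<Rightarrow> real \<Rightarrow> complex" and m :: "complex \<Rightarrow> complex"
    and m0 \<theta> \<mu>0 \<mu>s \<alpha>1 \<alpha>2 :: real and \<Theta> :: L_system
  assumes "locally_summable a q"
    and "nonneg_op a (Dom_min a q) (l a q)"
    and "deficiency_indices_1_1 a (Dom_min a q) (l a q)"
    and "\<And>z. solves a q z (\<phi>1 z) \<and> \<phi>1 z a = 0 \<and> D a (\<phi>1 z) a = 1"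
    and "\<And>z. solves a q z (\<phi>2 z) \<and> \<phi>2 z a = -1 \<and> D a (\<phi>2 z) a = 0"
    and "\<And>z. z \<in> - \<real>\<^sub>\<ge>\<^sub>0 \<Longrightarrow> (\<lambda>x. \<phi>2 z x + m z * \<phi>1 z x) \<in> L2 a"
    and "((\<lambda>x. m (complex_of_real x)) \<longlongrightarrow> complex_of_real m0) (at_left 0)"
    and "Im h > 0"
    and "sectorial_op a (Dom_T a q h) (l a q) \<theta>"
    and "\<mu>0 = (Im h)\<^sup>2 / (m0 + Re h) + Re h"
    and "\<mu>0 < \<mu>s"
    and "\<Theta> = schrodinger_system a q h \<mu>s"
    and "accretive a q \<Theta>"
    and "S_class \<alpha>1 \<alpha>2 (impedance a q \<Theta>)"
  shows "\<alpha>2 < pi / 2 \<and>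
    (\<exists>\<beta>. 0 < \<beta> \<and> \<beta> < pi / 2 \<and> tan \<beta> = tan \<alpha>2 + 2 * sqrt (tan \<alpha>1 * tan \<alpha>2) \<and>
         (\<forall>\<mu>\<ge>\<mu>s. sectorial_pm a q (star_ext a q h \<mu>) \<beta>))"
proof -
  interpret nonneg_schrodinger a q "\<phi>1 0" "\<phi>2 0"
    using assms(2,4,5) by unfold_locales auto
  define k p s where "k = Im h" and "p = m0 + Re h" and "s = \<mu>s - Re h"
  have k: "k > 0" using assms(8) by (simp add: k_def)
  define \<psi> where "\<psi> x = (\<lambda>t. \<phi>2 (complex_of_real x) t + m (complex_of_real x) * \<phi>1 (complex_of_real x) t)" for x
  have \<psi>: "solves a q (complex_of_real x) (\<psi> x)" "\<psi> x \<in> L2 a" "\<psi> x a = -1"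
    "D a (\<psi> x) a = m (complex_of_real x)" if x: "x < 0" for x
  proof -
    note s1 = assms(4)[of "complex_of_real x"] and s2 = assms(5)[of "complex_of_real x"]
    show "solves a q (complex_of_real x) (\<psi> x)" unfolding \<psi>_def using s1 s2 by (intro solves_lin) auto
    have "complex_of_real x \<in> - \<real>\<^sub>\<ge>\<^sub>0" using x by simp
    then show "\<psi> x \<in> L2 a" unfolding \<psi>_def by (rule assms(6))
    show "\<psi> x a = -1" using s1 s2 by (simp add: \<psi>_def)
    show "D a (\<psi> x) a = m (complex_of_real x)"
      using regular_lin(2)[of "\<phi>2 (complex_of_real x)" a "\<phi>1 (complex_of_real x)" a "m (complex_of_real x)"] s1 s2
      by (simp add: \<psi>_def solves_def)
  qed
  have neg: "\<forall>\<^sub>F x in at_left 0. x < (0::real)" by (simp add: eventually_at_filter)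
  have mlim: "((\<lambda>x. Re (m (complex_of_real x))) \<longlongrightarrow> m0) (at_left 0)"
    using tendsto_Re[OF assms(7)] by simp
  \<comment> \<open>The uniform lower bound survives the limit; strict positivity of
    \<open>p\<close> follows because \<open>cot \<theta>\<close> and \<open>k\<close> are
    positive.\<close>
  have "cot \<theta> * k \<le> p"
  proof (rule tendsto_lowerbound)
    show "((\<lambda>x. Re (m (complex_of_real x)) + Re h) \<longlongrightarrow> p) (at_left 0)"
      unfolding p_def by (intro tendsto_add mlim tendsto_const)
    show "\<forall>\<^sub>F x in at_left 0. cot \<theta> * k \<le> Re (m (complex_of_real x)) + Re h"
      using neg
    proof eventually_elim
      case (elim x)
      then show ?case
        using sectorial_weyl_lower_bound[OF assms(9,8) _ \<psi>(1-3)[OF elim]] \<psi>(4)[OF elim] by (simp add: k_def)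
    qed
  qed simp
  moreover have "cot \<theta> > 0"
    using assms(9) by (auto simp: sectorial_op_def cot_def intro!: divide_pos_pos cos_gt_zero_pi sin_gt_zero)
  ultimately have p: "p > 0" using k by (meson mult_pos_pos less_le_trans)
  \<comment> \<open>As \<open>x\<close> tends to -0 the term with the norm of \<open>f\<close>
    disappears for each fixed \<open>f\<close>.\<close>
  have form_bound: "m0 * (cmod (f a))\<^sup>2 \<le> Re (form f f)" if f: "f \<in> Hplus a q" for f
  proof (rule tendsto_upperbound)
    have "((\<lambda>x. Re (m (complex_of_real x)) * (cmod (f a))\<^sup>2 + x * Re (ip a f f))
        \<longlongrightarrow> m0 * (cmod (f a))\<^sup>2 + 0 * Re (ip a f f)) (at_left 0)"
      by (intro tendsto_add tendsto_mult mlim tendsto_const tendsto_ident_at)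
    then show "((\<lambda>x. Re (m (complex_of_real x)) * (cmod (f a))\<^sup>2 + x * Re (ip a f f))
        \<longlongrightarrow> m0 * (cmod (f a))\<^sup>2) (at_left 0)" by simp
    show "\<forall>\<^sub>F x in at_left 0. Re (m (complex_of_real x)) * (cmod (f a))\<^sup>2 + x * Re (ip a f f) \<le> Re (form f f)"
      using neg
    proof eventually_elim
      case (elim x)
      then show ?case using weyl_form_bound[OF \<psi>(1-3)[OF elim] _ f] \<psi>(4)[OF elim] by simp
    qed
  qed simp
  have "k\<^sup>2 / p < s" using assms(10,11) by (simp add: k_def p_def s_def)
  \<comment> \<open>This is \<open>\<mu>0 < \<mu>s\<close> cleared of its denominator, and the
    positivity of the denominator of \<open>T\<close>.\<close>
  then have ps: "k\<^sup>2 < p * s" using p by (simp add: field_simps)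
  define T where "T = k * (m0 + \<mu>s) / (p * s - k\<^sup>2)"
  have "0 < p * s" using ps zero_le_power2[of k] by linarith
  then have "s > 0" using p by (simp add: zero_less_mult_iff)
  then have "m0 + \<mu>s > 0" using p by (simp add: p_def s_def)
  then have T: "T > 0" using k ps by (simp add: T_def)
  have V: "((\<lambda>x. Re (impedance a q \<Theta> (complex_of_real x))) \<longlongrightarrow> T) (at_left 0)"
  proof (rule Lim_transform_eventually)
    let ?V = "\<lambda>x. k * (Re (m (complex_of_real x)) + \<mu>s) / ((Re (m (complex_of_real x)) + Re h) * s - k\<^sup>2)"
    show "(?V \<longlongrightarrow> T) (at_left 0)"
      unfolding T_def p_def by (intro tendsto_intros mlim) (use ps in \<open>simp add: p_def\<close>)
    have "((\<lambda>x. (Re (m (complex_of_real x)) + Re h) * s - k\<^sup>2) \<longlongrightarrow> p * s - k\<^sup>2) (at_left 0)"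
      unfolding p_def by (intro tendsto_intros mlim)
    \<comment> \<open>The formula for the impedance needs a non-zero denominator; near 0 it inherits
      positivity from its limit.\<close>
    then have "\<forall>\<^sub>F x in at_left 0. 0 < (Re (m (complex_of_real x)) + Re h) * s - k\<^sup>2"
      by (rule order_tendstoD) (use ps in simp)
    with neg show "\<forall>\<^sub>F x in at_left 0. ?V x = Re (impedance a q \<Theta> (complex_of_real x))"
    proof eventually_elim
      case (elim x)
      then show ?case
        using impedance_value[OF assms(8) _ elim(1) \<psi>(1-3)[OF elim(1)]] assms(12,13) \<psi>(4)[OF elim(1)]
        by (simp add: k_def s_def)
    qed
  qed
  have S: "0 \<le> \<alpha>1" "\<alpha>1 \<le> \<alpha>2" "\<alpha>2 \<le> pi / 2"
    "((\<lambda>x. ereal (Re (impedance a q \<Theta> (complex_of_real x)))) \<longlongrightarrow> tan_ext \<alpha>2) (at_left 0)"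
    using assms(14) by (auto simp: S_class_def)
  have "tan_ext \<alpha>2 = ereal T"
    \<comment> \<open>The limit is the finite number \<open>T\<close>, which also rules out
      \<alpha>2 = \<open>pi / 2\<close>.\<close>
    by (rule tendsto_unique[OF _ S(4)]) (use V in simp_all)
  then have \<alpha>2: "\<alpha>2 < pi / 2" "tan \<alpha>2 = T" using S(3) by (auto simp: tan_ext_def split: if_splits)
  have "\<alpha>1 < pi / 2" using S(2) \<alpha>2(1) by linarith
  then have "tan \<alpha>1 \<ge> 0" using S(1) by (rule tan_pos_pi2_le[rotated])
  then have root: "sqrt (tan \<alpha>1 * tan \<alpha>2) \<ge> 0" using T \<alpha>2 by simp
  define t where "t = tan \<alpha>2 + 2 * sqrt (tan \<alpha>1 * tan \<alpha>2)"
  \<comment> \<open>The root is non-negative, so \<beta> is at least the angle with tangent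
    \<open>T\<close>; sectoriality with constant \<open>T\<close> passes to the larger
    \<open>t\<close> because the real part is non-negative.\<close>
  have t: "t \<ge> T" using root \<alpha>2 by (simp add: t_def)
  define \<beta> where "\<beta> = arctan t"
  have \<beta>: "0 < \<beta>" "\<beta> < pi / 2" "tan \<beta> = t" using t T arctan_ubound[of t] by (simp_all add: \<beta>_def tan_arctan)
  have "sectorial_pm a q (star_ext a q h \<mu>) \<beta>" if \<mu>: "\<mu> \<ge> \<mu>s" for \<mu>
    unfolding sectorial_pm_def
  proof (intro conjI ballI \<beta>(1,2))
    fix f assume f: "f \<in> Hplus a q"
    have est: "\<bar>Im (star_ext a q h \<mu> f f)\<bar> \<le> T * Re (star_ext a q h \<mu> f f)"
      using star_ext_sectorial_estimate[OF assms(8) _ form_bound _ \<mu> f] p ps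
      by (simp add: T_def k_def p_def s_def)
    then have "0 \<le> T * Re (star_ext a q h \<mu> f f)" by (rule order_trans[OF abs_ge_zero])
    then have "0 \<le> Re (star_ext a q h \<mu> f f)" using T by (simp add: zero_le_mult_iff)
    with t have "\<bar>Im (star_ext a q h \<mu> f f)\<bar> \<le> t * Re (star_ext a q h \<mu> f f)"
      using est mult_right_mono by (meson order_trans)
    moreover have "cot \<beta> = 1 / t" by (simp add: cot_def tan_def flip: \<beta>(3))
    moreover have "t > 0" using t T by linarith
    ultimately show "cot \<beta> * \<bar>Im (star_ext a q h \<mu> f f)\<bar> \<le> Re (star_ext a q h \<mu> f f)"
      by (simp add: divide_le_eq mult.commute)
  qed
  then show ?thesis using \<alpha>2(1) \<beta> unfolding t_def by blast
qed

end
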